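(* Let $\mathbb{H}$ be a real Hilbert space and $p$ a positive integer, with $\dim\mathbb{H}\ge 2p$ if $\mathbb{H}$ is finite dimensional. Then the Grassmann manifold $(\mathbf{Gr}(p,\mathbb{H}),\langle\cdot,\cdot\rangle)$ is a complete Hilbert manifold satisfying the Hopf-Rinow theorem, i.e. any two of its points can be connected by a minimizing geodesic.
   Context: $\mathbf{St}(p,\mathbb{H})=\{x\in L(\mathbb{R}^p,\mathbb{H}) : x^t\circ x=\mathrm{Id}_{\mathbb{R}^p}\}$ carries the Riemannian metric induced by the inner product $\langle x,y\rangle=\mathrm{Tr}(x^t\circ y)$ on the Hilbert space $L(\mathbb{R}^p,\mathbb{H})$ of linear maps. The group $\mathrm{O}(p)$ acts freely and isometrically on it by $(A,x)\mapsto x\circ A^t$; $\mathbf{Gr}(p,\mathbb{H})=\mathbf{St}(p,\mathbb{H})/\mathrm{O}(p)$ is the manifold of $p$-dimensional subspaces of $\mathbb{H}$, with the Riemannian metric (also denoted $\langle\cdot,\cdot\rangle$) such that the projection $\mathbf{St}(p,\mathbb{H})\to\mathbf{Gr}(p,\mathbb{H})$ is a Riemannian submersion. A Hilbert manifold is a smooth manifold modeled on a Hilbert space with a Riemannian metric inducing equivalent norms on tangent spaces; complete means complete for the Riemannian distance. $\mathbb{H}$ is not assumed separable. *)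

theory Defs
  imports "HOL-Analysis.Analysis"
begin

section \<open>Smooth maps between Hilbert spaces\<close>

text \<open>Model spaces are closed linear subspaces of an ambient Hilbert space, so all notions of
  differential calculus below are relative to a subspace \<open>E\<close> (take \<open>E = UNIV\<close> for the whole space).
  A \<open>k\<close>-linear map on \<open>E\<close> is represented by a function on the lists of length \<open>k\<close> over \<open>E\<close>.\<close>

definition bounded_multilinear_on ::
    "'a::real_normed_vector set \<Rightarrow> nat \<Rightarrow> ('a list \<Rightarrow> 'b::real_normed_vector) \<Rightarrow> bool" where
  "bounded_multilinear_on E k T \<longleftrightarrow>
     (\<forall>vs i a b r. set vs \<subseteq> E \<and> length vs = k \<and> i < k \<and> a \<in> E \<and> b \<in> E \<longrightarrow>
        T (vs[i := a + b]) = T (vs[i := a]) + T (vs[i := b]) \<and>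
        T (vs[i := r *\<^sub>R a]) = r *\<^sub>R T (vs[i := a])) \<and>
     (\<exists>K. \<forall>vs. set vs \<subseteq> E \<and> length vs = k \<longrightarrow> norm (T vs) \<le> K * prod_list (map norm vs))"

text \<open>The map \<open>u \<mapsto> T u\<close> from \<open>S\<close> (relatively open in \<open>E\<close>) to the normed space of bounded
  \<open>k\<close>-linear maps on \<open>E\<close> is of class \<open>C\<^sup>\<infinity>\<close> in the Frechet sense. For \<open>n \<ge> k\<close>, the restriction of
  \<open>D u\<close> to lists of length \<open>n\<close> is the iterated derivative of order \<open>n - k\<close>, and the last clause says
  that \<open>h \<mapsto> (vs \<mapsto> D u (h # vs))\<close> is its Frechet derivative at \<open>u\<close>, with respect to the operator
  norm of \<open>n\<close>-linear maps.\<close>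

definition smooth_multilinear_on ::
    "'a::real_normed_vector set \<Rightarrow> 'a set \<Rightarrow> nat \<Rightarrow> ('a \<Rightarrow> 'a list \<Rightarrow> 'b::real_normed_vector) \<Rightarrow> bool" where
  "smooth_multilinear_on E S k T \<longleftrightarrow>
     (\<exists>D. (\<forall>u\<in>S. \<forall>vs. set vs \<subseteq> E \<and> length vs = k \<longrightarrow> D u vs = T u vs) \<and>
       (\<forall>n\<ge>k. \<forall>u\<in>S. bounded_multilinear_on E n (D u) \<and>
         (\<forall>\<epsilon>>0. \<exists>\<delta>>0. \<forall>h\<in>E. u + h \<in> S \<and> norm h < \<delta> \<longrightarrow>
           (\<forall>vs. set vs \<subseteq> E \<and> length vs = n \<longrightarrow>
              norm (D (u + h) vs - D u vs - D u (h # vs)) \<le> \<epsilon> * norm h * prod_list (map norm vs)))))"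

definition smooth_on ::
    "'a::real_normed_vector set \<Rightarrow> 'a set \<Rightarrow> ('a \<Rightarrow> 'b::real_normed_vector) \<Rightarrow> bool" where
  "smooth_on E S f \<longleftrightarrow> smooth_multilinear_on E S 0 (\<lambda>u _. f u)"

definition dir_deriv ::
    "('a::real_normed_vector \<Rightarrow> 'b::real_normed_vector) \<Rightarrow> 'a \<Rightarrow> 'a \<Rightarrow> 'b" where
  "dir_deriv f u v = vector_derivative (\<lambda>s::real. f (u + s *\<^sub>R v)) (at 0)"


section \<open>Riemannian Hilbert manifolds\<close>

text \<open>A chart consists of its domain, its model space, its coordinate map, and the
  expression of the Riemannian metric in these coordinates: \<open>chart_metric C u v w\<close> is the inner
  product of the tangent vectors with coordinates \<open>v\<close> and \<open>w\<close> at the point with coordinate \<open>u\<close>.\<close>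

record ('m, 'e) riem_chart =
  chart_dom :: "'m set"
  chart_space :: "'e set"
  chart_map :: "'m \<Rightarrow> 'e"
  chart_metric :: "'e \<Rightarrow> 'e \<Rightarrow> 'e \<Rightarrow> real"

record ('m, 'e) riem_structure =
  points :: "'m set"
  atlas :: "('m, 'e) riem_chart set"

definition chart_range :: "('m, 'e) riem_chart \<Rightarrow> 'e set" where
  "chart_range C = chart_map C ` chart_dom C"

definition transition :: "('m, 'e) riem_chart \<Rightarrow> ('m, 'e) riem_chart \<Rightarrow> 'e \<Rightarrow> 'e" where
  "transition C C' = chart_map C' \<circ> inv_into (chart_dom C) (chart_map C)"

definition manifold_open ::
    "('m, 'e::{real_inner,complete_space}) riem_structure \<Rightarrow> 'm set \<Rightarrow> bool" where
  "manifold_open M W \<longleftrightarrow> W \<subseteq> points M \<and>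
     (\<forall>C\<in>atlas M. openin (top_of_set (chart_space C)) (chart_map C ` (W \<inter> chart_dom C)))"

text \<open>The model spaces of any two charts are required to be isometric, i.e. all charts
  take values in copies of one and the same Hilbert space.\<close>

definition hilbert_manifold ::
    "('m, 'e::{real_inner,complete_space}) riem_structure \<Rightarrow> bool" where
  "hilbert_manifold M \<longleftrightarrow>
     points M = (\<Union>C\<in>atlas M. chart_dom C) \<and>
     (\<forall>C\<in>atlas M. subspace (chart_space C) \<and> closed (chart_space C) \<and>
        inj_on (chart_map C) (chart_dom C) \<and>
        openin (top_of_set (chart_space C)) (chart_range C)) \<and>
     (\<forall>C\<in>atlas M. \<forall>C'\<in>atlas M.
        (\<exists>f. linear f \<and> f ` chart_space C = chart_space C' \<and>
           (\<forall>v\<in>chart_space C. norm (f v) = norm v)) \<and>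
        openin (top_of_set (chart_space C)) (chart_map C ` (chart_dom C \<inter> chart_dom C')) \<and>
        smooth_on (chart_space C) (chart_map C ` (chart_dom C \<inter> chart_dom C')) (transition C C')) \<and>
     (\<forall>a\<in>points M. \<forall>b\<in>points M. a \<noteq> b \<longrightarrow>
        (\<exists>V W. manifold_open M V \<and> manifold_open M W \<and> a \<in> V \<and> b \<in> W \<and> V \<inter> W = {}))"

definition riemannian_hilbert_manifold ::
    "('m, 'e::{real_inner,complete_space}) riem_structure \<Rightarrow> bool" where
  "riemannian_hilbert_manifold M \<longleftrightarrow> hilbert_manifold M \<and>
     (\<forall>C\<in>atlas M.
        smooth_multilinear_on (chart_space C) (chart_range C) 2
          (\<lambda>u vs. chart_metric C u (vs ! 0) (vs ! 1)) \<and>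
        (\<forall>u\<in>chart_range C.
           (\<forall>v\<in>chart_space C. \<forall>w\<in>chart_space C. chart_metric C u v w = chart_metric C u w v) \<and>
           (\<exists>a>0. \<exists>b. \<forall>v\<in>chart_space C.
              a * (norm v)\<^sup>2 \<le> chart_metric C u v v \<and> chart_metric C u v v \<le> b * (norm v)\<^sup>2))) \<and>
     (\<forall>C\<in>atlas M. \<forall>C'\<in>atlas M. \<forall>m \<in> chart_dom C \<inter> chart_dom C'.
        \<forall>v\<in>chart_space C. \<forall>w\<in>chart_space C.
          chart_metric C (chart_map C m) v w =
          chart_metric C' (chart_map C' m)
            (dir_deriv (transition C C') (chart_map C m) v)
            (dir_deriv (transition C C') (chart_map C m) w))"


subsection \<open>Riemannian distance and completeness\<close>

definition C1_curve_on ::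
    "('m, 'e::{real_inner,complete_space}) riem_structure \<Rightarrow> real \<Rightarrow> real \<Rightarrow> (real \<Rightarrow> 'm) \<Rightarrow> bool" where
  "C1_curve_on M a b \<gamma> \<longleftrightarrow>
     (\<forall>t\<in>{a..b}. \<exists>C\<in>atlas M. \<exists>\<delta>>0. \<exists>v.
        (\<forall>s\<in>{a..b}. \<bar>s - t\<bar> < \<delta> \<longrightarrow> \<gamma> s \<in> chart_dom C \<and>
           ((chart_map C \<circ> \<gamma>) has_vector_derivative v s) (at s within {a..b})) \<and>
        continuous_on ({a..b} \<inter> {t - \<delta><..<t + \<delta>}) v)"

text \<open>Piecewise \<open>C\<^sup>1\<close> curves on the unit interval; \<open>B\<close> is the set of breakpoints.\<close>

definition piecewise_C1_curve ::
    "('m, 'e::{real_inner,complete_space}) riem_structure \<Rightarrow> (real \<Rightarrow> 'm) \<Rightarrow> bool" where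
  "piecewise_C1_curve M \<gamma> \<longleftrightarrow>
     (\<exists>B. finite B \<and> {0, 1} \<subseteq> B \<and> B \<subseteq> {0..1} \<and>
        (\<forall>a\<in>B. \<forall>b\<in>B. a < b \<and> {a<..<b} \<inter> B = {} \<longrightarrow> C1_curve_on M a b \<gamma>))"

text \<open>The speed does not depend on the chart selected. At the finitely many
  breakpoints of a piecewise \<open>C\<^sup>1\<close> curve its value is irrelevant for the length.\<close>

definition speed ::
    "('m, 'e::{real_inner,complete_space}) riem_structure \<Rightarrow> (real \<Rightarrow> 'm) \<Rightarrow> real \<Rightarrow> real" where
  "speed M \<gamma> t =
     (let C = (SOME C. C \<in> atlas M \<and> \<gamma> t \<in> chart_dom C);
          v = vector_derivative (chart_map C \<circ> \<gamma>) (at t within {0..1})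
      in sqrt (chart_metric C (chart_map C (\<gamma> t)) v v))"

definition curve_length ::
    "('m, 'e::{real_inner,complete_space}) riem_structure \<Rightarrow> (real \<Rightarrow> 'm) \<Rightarrow> real" where
  "curve_length M \<gamma> = integral {0..1} (speed M \<gamma>)"

definition riem_dist ::
    "('m, 'e::{real_inner,complete_space}) riem_structure \<Rightarrow> 'm \<Rightarrow> 'm \<Rightarrow> ereal" where
  "riem_dist M a b =
     (INF \<gamma>\<in>{\<gamma>. piecewise_C1_curve M \<gamma> \<and> \<gamma> 0 = a \<and> \<gamma> 1 = b}. ereal (curve_length M \<gamma>))"

definition riem_complete ::
    "('m, 'e::{real_inner,complete_space}) riem_structure \<Rightarrow> bool" where
  "riem_complete M \<longleftrightarrow>
     (\<forall>X::nat \<Rightarrow> 'm. range X \<subseteq> points M \<and>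
        (\<forall>\<epsilon>>0. \<exists>N. \<forall>m\<ge>N. \<forall>n\<ge>N. riem_dist M (X m) (X n) < ereal \<epsilon>) \<longrightarrow>
        (\<exists>a\<in>points M. (\<lambda>n. riem_dist M (X n) a) \<longlonglongrightarrow> 0))"


subsection \<open>Geodesics\<close>

text \<open>The covariant acceleration of a curve with coordinate position \<open>u\<close>, velocity \<open>v\<close> and
  acceleration \<open>a\<close> in the chart \<open>C\<close>, paired with \<open>w\<close>. By the Koszul formula the Christoffel symbols
  \<open>\<Gamma>\<close> of the Levi-Civita connection satisfy
  \<open>2 g\<^sub>u (\<Gamma>\<^sub>u v v) w = 2 (D g\<^sub>u v) v w - (D g\<^sub>u w) v v\<close>, so that the value below is
  \<open>g\<^sub>u (a + \<Gamma>\<^sub>u v v) w\<close>.\<close>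

definition covariant_acceleration ::
    "('m, 'e::{real_inner,complete_space}) riem_chart \<Rightarrow> 'e \<Rightarrow> 'e \<Rightarrow> 'e \<Rightarrow> 'e \<Rightarrow> real" where
  "covariant_acceleration C u v a w =
     chart_metric C u a w
     + dir_deriv (\<lambda>u. chart_metric C u v w) u v
     - dir_deriv (\<lambda>u. chart_metric C u v v) u w / 2"

text \<open>As the covariant acceleration is a tangent vector, its vanishing at time \<open>t\<close> may be tested
  in any one chart around \<open>\<gamma> t\<close>.\<close>

definition geodesic ::
    "('m, 'e::{real_inner,complete_space}) riem_structure \<Rightarrow> (real \<Rightarrow> 'm) \<Rightarrow> bool" where
  "geodesic M \<gamma> \<longleftrightarrow>
     (\<forall>t\<in>{0..1}. \<exists>C\<in>atlas M. \<exists>\<delta>>0. \<exists>v a.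
        (\<forall>s\<in>{0..1}. \<bar>s - t\<bar> < \<delta> \<longrightarrow> \<gamma> s \<in> chart_dom C \<and>
           ((chart_map C \<circ> \<gamma>) has_vector_derivative v s) (at s within {0..1})) \<and>
        (v has_vector_derivative a) (at t within {0..1}) \<and>
        (\<forall>w\<in>chart_space C. covariant_acceleration C (chart_map C (\<gamma> t)) (v t) a w = 0))"

definition minimizing_geodesic ::
    "('m, 'e::{real_inner,complete_space}) riem_structure \<Rightarrow> 'm \<Rightarrow> 'm \<Rightarrow> (real \<Rightarrow> 'm) \<Rightarrow> bool" where
  "minimizing_geodesic M a b \<gamma> \<longleftrightarrow>
     geodesic M \<gamma> \<and> \<gamma> 0 = a \<and> \<gamma> 1 = b \<and> ereal (curve_length M \<gamma>) = riem_dist M a b"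

definition hopf_rinow ::
    "('m, 'e::{real_inner,complete_space}) riem_structure \<Rightarrow> bool" where
  "hopf_rinow M \<longleftrightarrow> (\<forall>a\<in>points M. \<forall>b\<in>points M. \<exists>\<gamma>. minimizing_geodesic M a b \<gamma>)"


subsection \<open>Riemannian submersions from submanifolds of a Hilbert space\<close>

definition tangent_space :: "'a::real_inner set \<Rightarrow> 'a \<Rightarrow> 'a set" where
  "tangent_space S x =
     {\<xi>. \<exists>c::real \<Rightarrow> 'a. c C1_differentiable_on {-1<..<1} \<and> c ` {-1<..<1} \<subseteq> S \<and>
          c 0 = x \<and> (c has_vector_derivative \<xi>) (at 0)}"

text \<open>The orthogonal complement in the tangent space of the kernel of a linear map \<open>A\<close> on it.\<close>

definition horizontal_space :: "'a::real_inner set \<Rightarrow> 'a \<Rightarrow> ('a \<Rightarrow> 'b::zero) \<Rightarrow> 'a set" where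
  "horizontal_space S x A =
     {\<xi> \<in> tangent_space S x. \<forall>\<kappa>\<in>tangent_space S x. A \<kappa> = 0 \<longrightarrow> \<xi> \<bullet> \<kappa> = 0}"

text \<open>\<open>S\<close> carries the metric induced from the ambient space. Smoothness of \<open>f\<close> on \<open>S\<close> means
  that its coordinate expressions extend locally to smooth maps \<open>G\<close> of the ambient space; the
  differential of \<open>f\<close> is the restriction of that of \<open>G\<close> to the tangent space.\<close>

definition riemannian_submersion_on ::
    "'a::{real_inner,complete_space} set \<Rightarrow> ('m, 'e::{real_inner,complete_space}) riem_structure
      \<Rightarrow> ('a \<Rightarrow> 'm) \<Rightarrow> bool" where
  "riemannian_submersion_on S M f \<longleftrightarrow>
     f ` S = points M \<and>
     (\<forall>x\<in>S. \<forall>C\<in>atlas M. f x \<in> chart_dom C \<longrightarrow>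
        (\<exists>Q G. open Q \<and> x \<in> Q \<and> f ` (S \<inter> Q) \<subseteq> chart_dom C \<and>
           smooth_on UNIV Q G \<and> (\<forall>z\<in>S \<inter> Q. G z = chart_map C (f z)) \<and>
           dir_deriv G x ` tangent_space S x = chart_space C \<and>
           (\<forall>\<xi>\<in>horizontal_space S x (dir_deriv G x). \<forall>\<eta>\<in>horizontal_space S x (dir_deriv G x).
              chart_metric C (chart_map C (f x)) (dir_deriv G x \<xi>) (dir_deriv G x \<eta>) = \<xi> \<bullet> \<eta>)))"


section \<open>The Stiefel manifold\<close>

text \<open>The Hilbert space of linear maps \<open>\<real>\<^sup>p \<rightarrow> H\<close> is identified with \<open>H\<^sup>p\<close>: the tuple \<open>x\<close>
  stands for the linear map \<open>lin x\<close> sending the \<open>i\<close>-th standard basis vector to \<open>x $ i\<close>. The lemmas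
  show that this is a linear bijection onto the linear maps and that the inner product of
  the library on \<open>H\<^sup>p\<close> is the trace inner product.\<close>

definition lin :: "'h::real_inner ^ 'p \<Rightarrow> real ^ 'p \<Rightarrow> 'h" where
  "lin x v = (\<Sum>i\<in>UNIV. (v $ i) *\<^sub>R (x $ i))"

text \<open>The matrix of \<open>x\<^sup>t \<circ> y\<close>.\<close>

definition tcomp :: "'h::real_inner ^ 'p \<Rightarrow> 'h ^ 'p \<Rightarrow> real ^ 'p ^ 'p" where
  "tcomp x y = matrix (adjoint (lin x) \<circ> lin y)"

text \<open>The composition \<open>x \<circ> A\<close> with an endomorphism \<open>A\<close> of \<open>\<real>\<^sup>p\<close>.\<close>

definition rcomp :: "'h::real_inner ^ 'p \<Rightarrow> real ^ 'p ^ 'p \<Rightarrow> 'h ^ 'p" where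
  "rcomp x A = (\<chi> j. lin x (A *v axis j 1))"

lemma linear_lin: "linear (lin x)"
  unfolding lin_def
  by (rule linearI) (simp_all add: scaleR_left.add scaleR_add_left sum.distrib scaleR_right.sum)

lemma lin_axis [simp]: "lin x (axis i 1) = x $ i"
proof -
  have "lin x (axis i 1) = (\<Sum>k\<in>UNIV. if k = i then x $ k else 0)"
    unfolding lin_def by (rule sum.cong) (auto simp: axis_def)
  then show ?thesis by simp
qed

lemma lin_add: "lin (x + y) v = lin x v + lin y v"
  by (simp add: lin_def scaleR_add_right sum.distrib)

lemma lin_scaleR: "lin (r *\<^sub>R x) v = r *\<^sub>R lin x v"
  by (simp add: lin_def scaleR_right.sum mult.commute)

lemma linear_axis_eqI:
  fixes f g :: "real ^ 'p \<Rightarrow> 'h::real_inner"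
  assumes "linear f" "linear g" "\<And>i. f (axis i 1) = g (axis i 1)"
  shows "f = g"
proof
  fix v :: "real ^ 'p"
  have v: "v = (\<Sum>i\<in>UNIV. (v $ i) *\<^sub>R axis i 1)"
    by (metis (no_types, lifting) ext basis_expansion scalar_mult_eq_scaleR)
  have "f v = (\<Sum>i\<in>UNIV. (v $ i) *\<^sub>R f (axis i 1))"
    by (subst v) (simp add: linear_sum[OF assms(1)] linear_scale[OF assms(1)])
  also have "\<dots> = g v"
    by (subst (2) v) (simp add: linear_sum[OF assms(2)] linear_scale[OF assms(2)] assms(3))
  finally show "f v = g v" .
qed

lemma bij_betw_lin: "bij_betw lin UNIV {f :: real ^ 'p \<Rightarrow> 'h::real_inner. linear f}"
  unfolding bij_betw_def
proof
  show "inj (lin :: 'h ^ 'p \<Rightarrow> _)"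
    by (rule injI) (metis lin_axis vec_eq_iff)
  show "range lin = {f :: real ^ 'p \<Rightarrow> 'h. linear f}"
  proof (intro equalityI subsetI)
    fix f :: "real ^ 'p \<Rightarrow> 'h"
    assume "f \<in> {f. linear f}"
    then have "lin (\<chi> i. f (axis i 1)) = f"
      by (intro linear_axis_eqI linear_lin) simp_all
    then show "f \<in> range lin" by (metis rangeI)
  qed (auto simp: linear_lin)
qed

lemma adjoint_lin: "adjoint (lin x) = (\<lambda>y. \<chi> i. x $ i \<bullet> y)"
  by (rule adjoint_unique)
     (simp add: lin_def inner_sum_left inner_vec_def)

lemma inner_lin: "lin x v \<bullet> y = v \<bullet> adjoint (lin x) y"
  by (simp add: adjoint_lin inner_vec_def lin_def inner_sum_left)

lemma tcomp_nth: "tcomp x y $ i $ j = x $ i \<bullet> y $ j"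
  by (simp add: tcomp_def matrix_def adjoint_lin)

lemma inner_eq_trace: "x \<bullet> y = trace (matrix (adjoint (lin x) \<circ> lin y))"
  unfolding tcomp_def[symmetric] by (simp add: trace_def tcomp_nth inner_vec_def)

lemma lin_rcomp: "lin (rcomp x A) = lin x \<circ> (\<lambda>v. A *v v)"
  by (rule linear_axis_eqI)
     (simp_all add: linear_lin rcomp_def linear_compose matrix_vector_mul_linear)

definition stiefel :: "('h::real_inner ^ 'p) set" where
  "stiefel = {x. adjoint (lin x) \<circ> lin x = id}"


section \<open>The Grassmann manifold\<close>

text \<open>The points of the Grassmann manifold are the orbits of \<open>O(p)\<close> in the Stiefel manifold.\<close>

definition orbit :: "'h::real_inner ^ 'p \<Rightarrow> ('h ^ 'p) set" where
  "orbit x = {rcomp x (transpose A) | A. orthogonal_matrix A}"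

text \<open>The chart around the orbit of \<open>x\<close> describes subspaces as graphs over the range of \<open>x\<close>: it is
  inverse to the map sending \<open>y\<close> with \<open>x\<^sup>t \<circ> y = 0\<close> to the range of \<open>x + y\<close>. If this is
  the range of \<open>z\<close>, then \<open>x + y = z \<circ> (x\<^sup>t \<circ> z)\<^sup>-\<^sup>1\<close>, and this expression depends only on the orbit of \<open>z\<close>.\<close>

definition graph_coord :: "'h::real_inner ^ 'p \<Rightarrow> 'h ^ 'p \<Rightarrow> 'h ^ 'p" where
  "graph_coord x z = rcomp z (matrix_inv (tcomp x z)) - x"

text \<open>The metric making the projection a Riemannian submersion: the inner product of
  two tangent vectors is the inner product of their horizontal lifts, at any point \<open>z\<close> of the fibre.\<close>

definition grassmann_metric ::
    "'h::real_inner ^ 'p \<Rightarrow> 'h ^ 'p \<Rightarrow> 'h ^ 'p \<Rightarrow> 'h ^ 'p \<Rightarrow> real" where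
  "grassmann_metric x u v w =
     (THE r. \<exists>z\<in>stiefel. invertible (tcomp x z) \<and> graph_coord x z = u \<and>
        (\<exists>\<xi>\<in>horizontal_space stiefel z (dir_deriv (graph_coord x) z).
         \<exists>\<eta>\<in>horizontal_space stiefel z (dir_deriv (graph_coord x) z).
           dir_deriv (graph_coord x) z \<xi> = v \<and> dir_deriv (graph_coord x) z \<eta> = w \<and> r = \<xi> \<bullet> \<eta>))"

definition grassmann_chart ::
    "'h::real_inner ^ 'p \<Rightarrow> (('h ^ 'p) set, 'h ^ 'p) riem_chart" where
  "grassmann_chart x =
     \<lparr> chart_dom = orbit ` {z \<in> stiefel. invertible (tcomp x z)},
       chart_space = {y. tcomp x y = 0},
       chart_map = (\<lambda>W. graph_coord x (SOME z. z \<in> W)),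
       chart_metric = grassmann_metric x \<rparr>"

definition grassmann :: "(('h::real_inner ^ 'p) set, 'h ^ 'p) riem_structure" where
  "grassmann = \<lparr> points = orbit ` stiefel, atlas = grassmann_chart ` stiefel \<rparr>"

text \<open>The points of the Grassmann manifold correspond to the \<open>p\<close>-dimensional subspaces of \<open>H\<close>
  via the ranges of frames.\<close>

lemma stiefel_iff: "x \<in> stiefel \<longleftrightarrow> (\<forall>i j. x $ i \<bullet> x $ j = (if i = j then 1 else 0))"
proof
  assume x: "x \<in> stiefel"
  have "tcomp x x = mat 1"
    using x by (simp add: stiefel_def tcomp_def matrix_id_mat_1)
  then have "tcomp x x $ i $ j = mat 1 $ i $ j" for i j by simp
  then show "\<forall>i j. x $ i \<bullet> x $ j = (if i = j then 1 else 0)"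
    by (simp add: tcomp_nth mat_def)
next
  assume *: "\<forall>i j. x $ i \<bullet> x $ j = (if i = j then 1 else 0)"
  have "x $ i \<bullet> lin x v = v $ i" for i v
    by (simp add: lin_def inner_sum_right * if_distrib cong: if_cong)
  then show "x \<in> stiefel"
    by (simp add: stiefel_def adjoint_lin fun_eq_iff vec_eq_iff)
qed

lemma lin_adjoint_id:
  assumes "x \<in> stiefel" shows "adjoint (lin x) (lin x v) = v"
  using assms by (simp add: stiefel_def fun_eq_iff)

lemma range_lin: "range (lin x) = span (range (\<lambda>i. x $ i))"
proof
  show "range (lin x) \<subseteq> span (range (\<lambda>i. x $ i))"
    by (auto simp: lin_def intro!: span_sum intro: span_scale span_base rangeI)
  have "x $ i \<in> range (lin x)" for i
    by (metis lin_axis rangeI)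
  then show "span (range (\<lambda>i. x $ i)) \<subseteq> range (lin x)"
    by (intro span_minimal) (auto intro: linear_subspace_image linear_lin)
qed

lemma orbit_eq_iff:
  fixes x y :: "'h::real_inner ^ 'p"
  assumes x: "x \<in> stiefel" and y: "y \<in> stiefel"
  shows "orbit x = orbit y \<longleftrightarrow> range (lin x) = range (lin y)"
proof
  have self: "z \<in> orbit z" for z :: "'h ^ 'p"
    unfolding orbit_def
    by (rule CollectI, rule exI[of _ "mat 1"])
       (simp add: orthogonal_matrix_id rcomp_def vec_eq_iff transpose_mat)
  have rng: "range (lin w) = range (lin z)" if wz: "w \<in> orbit z" for w z :: "'h ^ 'p"
  proof -
    obtain A :: "real^'p^'p" where A: "orthogonal_matrix A" "w = rcomp z (transpose A)"
      using wz by (auto simp: orbit_def)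
    have "surj (\<lambda>v. transpose A *v v)"
    proof (rule surjI)
      show "transpose A *v (A *v v) = v" for v
        using A(1) by (simp add: orthogonal_matrix_def matrix_vector_mul_assoc)
    qed
    then show ?thesis
      by (simp only: A(2) lin_rcomp image_comp[symmetric])
  qed
  show "range (lin x) = range (lin y)" if "orbit x = orbit y"
    using self[of x] rng[of x y] that by simp
  have sub: "orbit z \<subseteq> orbit w"
    if z: "z \<in> stiefel" and w: "w \<in> stiefel" and eq: "range (lin z) = range (lin w)"
    for z w :: "'h ^ 'p"
  proof
    fix t assume t: "t \<in> orbit z"
    have tw: "range (lin t) = range (lin w)" using rng[OF t] eq by simp
    obtain A :: "real^'p^'p" where A: "orthogonal_matrix A" "t = rcomp z (transpose A)"
      using t by (auto simp: orbit_def)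
    have ts: "t $ i \<bullet> t $ j = (if i = j then 1 else 0)" for i j
    proof -
      have ip: "lin z a \<bullet> lin z b = a \<bullet> b" for a b
        by (simp add: inner_lin lin_adjoint_id[OF z])
      have "t $ i \<bullet> t $ j = (transpose A *v axis i 1) \<bullet> (transpose A *v axis j 1)"
        by (simp add: A(2) rcomp_def ip)
      also have "\<dots> = (axis i 1 :: real^'p) \<bullet> axis j 1"
        using A(1) by (metis orthogonal_matrix_def dot_lmul_matrix matrix_vector_mul_assoc
            matrix_vector_mul_lid transpose_matrix_vector)
      finally show ?thesis by (simp add: inner_axis_axis)
    qed
    define B where "B = tcomp t w"
    have t_eq: "lin w (adjoint (lin w) (t $ i)) = t $ i" for i
    proof -
      have "t $ i \<in> range (lin w)" using tw by (metis lin_axis rangeI)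
      then show ?thesis using lin_adjoint_id[OF w] by auto
    qed
    have col: "transpose B *v axis i 1 = adjoint (lin w) (t $ i)" for i
      by (simp add: vec_eq_iff B_def matrix_vector_mul_component transpose_def tcomp_nth
          adjoint_lin inner_axis inner_axis' inner_commute)
    have "rcomp w (transpose B) = t"
      unfolding rcomp_def col by (simp add: vec_eq_iff t_eq)
    moreover have "orthogonal_matrix B"
    proof -
      have "B ** transpose B = mat 1"
      proof -
        have "(B ** transpose B) $ i $ j = t $ i \<bullet> lin w (adjoint (lin w) (t $ j))" for i j
          by (simp add: matrix_matrix_mult_def B_def transpose_def tcomp_nth lin_def adjoint_lin
              inner_sum_right inner_commute mult.commute)
        then show ?thesis by (simp add: vec_eq_iff t_eq ts mat_def)
      qed
      then show ?thesis
        by (metis orthogonal_matrix_def matrix_left_right_inverse)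
    qed
    ultimately show "t \<in> orbit w" by (auto simp: orbit_def)
  qed
  show "orbit x = orbit y" if "range (lin x) = range (lin y)"
    using sub[of x y] sub[of y x] that x y by auto
qed

lemma range_lin_stiefel:
  "(\<lambda>x. range (lin x)) ` (stiefel :: ('h::real_inner ^ 'p) set) =
     {W. subspace W \<and> dim W = CARD('p)}"
proof (intro equalityI subsetI)
  fix W assume "W \<in> (\<lambda>x. range (lin x)) ` (stiefel :: ('h ^ 'p) set)"
  then obtain x :: "'h ^ 'p" where x: "x \<in> stiefel" "W = range (lin x)" by auto
  have inj: "inj (\<lambda>i. x $ i)"
    by (rule injI) (use x(1) in \<open>metis stiefel_iff zero_neq_one\<close>)
  have "independent (range (\<lambda>i. x $ i))"
  proof (rule pairwise_orthogonal_independent)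
    show "pairwise orthogonal (range (\<lambda>i. x $ i))"
      using x(1) by (auto simp: pairwise_def orthogonal_def stiefel_iff)
    show "0 \<notin> range (\<lambda>i. x $ i)"
      using x(1) by (metis imageE inner_zero_left stiefel_iff zero_neq_one)
  qed
  then have "dim W = CARD('p)"
    by (simp add: x(2) range_lin dim_eq_card_independent card_image[OF inj])
  then show "W \<in> {W. subspace W \<and> dim W = CARD('p)}"
    by (simp add: x(2) range_lin)
next
  fix W :: "'h set" assume "W \<in> {W. subspace W \<and> dim W = CARD('p)}"
  then have W: "subspace W" "dim W = CARD('p)" by auto
  obtain B where B: "B \<subseteq> W" "independent B" "W \<subseteq> span B" "card B = dim W"
    using basis_exists by metis
  have finB: "finite B" using B(4) W(2) by (metis card.infinite zero_less_card_finite less_irrefl)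
  obtain C where C: "finite C" "card C \<le> card B" "span C = span B" "pairwise orthogonal C"
    using basis_orthogonal[OF finB] by metis
  have spanB: "span B = W" using B W(1) by (metis span_subspace)
  have "card C = CARD('p)"
    using C B(4) W(2) spanB by (metis dim_span dim_le_card le_antisym span_superset)
  moreover have "0 \<notin> C"
  proof
    assume "0 \<in> C"
    then have "card (C - {0}) < card C" using C(1) by (meson card_Diff1_less)
    moreover have "dim W \<le> card (C - {0})"
      by (rule dim_le_card) (use C(1,3) spanB in \<open>auto simp: span_delete_0 intro: span_base\<close>)
    ultimately show False using \<open>card C = CARD('p)\<close> W(2) by simp
  qed
  moreover obtain f where f: "bij_betw f (UNIV :: 'p set) C"
    using C(1) \<open>card C = CARD('p)\<close> by (metis finite_same_card_bij finite)
  define x :: "'h ^ 'p" where "x = (\<chi> i. f i /\<^sub>R norm (f i))"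
  have fC: "f i \<in> C" for i using f by (auto simp: bij_betw_def)
  have f0: "f i \<noteq> 0" for i using fC[of i] \<open>0 \<notin> C\<close> by metis
  have "x $ i \<bullet> x $ j = (if i = j then 1 else 0)" for i j
  proof (cases "i = j")
    case True
    then show ?thesis using f0[of j] by (simp add: x_def dot_square_norm power2_eq_square)
  next
    case False
    then have "f i \<noteq> f j" using f by (auto simp: bij_betw_def inj_def)
    then show ?thesis using False C(4) fC by (auto simp: x_def pairwise_def orthogonal_def)
  qed
  then have "x \<in> stiefel" by (simp add: stiefel_iff)
  moreover have "range (lin x) = W"
  proof -
    have "span (range (\<lambda>i. x $ i)) = span C"
    proof (rule span_eq[THEN iffD2], intro conjI subsetI)
      fix v assume "v \<in> range (\<lambda>i. x $ i)"
      then show "v \<in> span C" using fC by (auto simp: x_def intro: span_scale span_base)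
    next
      fix v assume "v \<in> C"
      then obtain i where "v = f i" using f by (auto simp: bij_betw_def)
      then have "v = norm (f i) *\<^sub>R x $ i" using f0 by (simp add: x_def)
      then show "v \<in> span (range (\<lambda>i. x $ i))" by (metis span_base span_scale rangeI)
    qed
    then show ?thesis by (simp add: range_lin C(3) spanB)
  qed
  ultimately show "W \<in> (\<lambda>x. range (lin x)) ` (stiefel :: ('h ^ 'p) set)" by auto
qed

end

theory Submission
  imports Defs
begin

text \<open>The charts, the tangent spaces of the Stiefel manifold and the horizontal lifts are explicit, and the
  metric in a graph chart is the rational expression
  \<open>tr ((v\<^sup>t w - v\<^sup>t u S u\<^sup>t w) S)\<close> with \<open>S = (1 + u\<^sup>t u)\<^sup>-\<^sup>1\<close>, which is even in \<open>u\<close>.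

  Any two points have orthonormal frames \<open>z\<close>, \<open>w\<close> with \<open>z\<^sup>t w\<close> diagonal and nonnegative, with entries
  \<open>cos \<theta>\<^sub>i\<close>. Rotating each \<open>z\<^sub>i\<close> to \<open>w\<^sub>i\<close> in their common plane is horizontal, of length \<open>\<bar>\<theta>\<bar>\<close>, and a
  geodesic by evenness of the metric in the chart centred at any of its points. Conversely, the
  horizontal lift from \<open>z\<close> of an arbitrary curve ends in a frame \<open>w A\<close> with \<open>A\<close> orthogonal, and its
  \<open>i\<close>-th column travels at least the angle between \<open>z\<^sub>i\<close> and \<open>(w A)\<^sub>i\<close>, whose cosine
  \<open>A\<^sub>i\<^sub>i cos \<theta>\<^sub>i\<close> is at most \<open>cos \<theta>\<^sub>i\<close>; so the curve has length at least \<open>\<bar>\<theta>\<bar>\<close>.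

  The resulting formula for the distance makes it comparable to the distance of suitably
  chosen frames, so that completeness follows from that of the Hilbert space of frames.\<close>

section \<open>Calculus of smooth families of multilinear maps\<close>

text \<open>In infinite dimension closed bounded sets need not be compact, and completeness alone
  does not produce minimizing geodesics. What helps here is that the relative position of two
  p-dimensional subspaces is recorded by the p x p matrix of mixed inner products of two frames. Its
  diagonal form is a singular value decomposition, obtained by maximising over the compact group
  O(p) x O(p) and without any compactness in \<open>'h\<close>. The lower bound concerns arbitrary
  piecewise C1 curves. It is measured on the columns of the lifted frame, as p curves on the unit
  sphere, whose angles are collected in a vector: its Euclidean norm obeys the triangle inequality
  when curves are concatenated. Horizontality of the lift is what makes the speed of the curve equal
  to the Euclidean speed of the frame. Evenness means that all first derivatives of the metric
  vanish at the centre of a chart, so that no Christoffel symbol is ever computed.\<close>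

definition multi_deriv ::
    "('a::real_normed_vector \<Rightarrow> 'a list \<Rightarrow> 'b::real_normed_vector) \<Rightarrow> 'a \<Rightarrow> 'a list \<Rightarrow> 'b" where
  "multi_deriv T u vs = dir_deriv (\<lambda>u. T u (tl vs)) u (hd vs)"

text \<open>The Frechet remainder estimate in the operator norm of \<open>k\<close>-linear maps: one
  \<delta> serves all argument lists. Linearity and boundedness of \<open>T'\<close> are a separate
  condition, because in \<open>Ck_multi\<close> they come with the next order.\<close>

definition has_multi_deriv_on ::
    "'a::real_normed_vector set \<Rightarrow> nat \<Rightarrow> ('a \<Rightarrow> 'a list \<Rightarrow> 'b::real_normed_vector)
      \<Rightarrow> ('a \<Rightarrow> 'a list \<Rightarrow> 'b) \<Rightarrow> bool" where
  "has_multi_deriv_on Q k T T' \<longleftrightarrow>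
     (\<forall>u\<in>Q. \<forall>\<epsilon>>0. \<exists>\<delta>>0. \<forall>h. u + h \<in> Q \<and> norm h < \<delta> \<longrightarrow>
        (\<forall>vs. length vs = k \<longrightarrow>
           norm (T (u + h) vs - T u vs - T' u (h # vs)) \<le> \<epsilon> * norm h * prod_list (map norm vs)))"

text \<open>Smoothness is split into finite orders because the product and quotient rules are proved by induction
  on the order of differentiability.\<close>

fun Ck_multi ::
    "'a::real_normed_vector set \<Rightarrow> nat \<Rightarrow> nat \<Rightarrow> ('a \<Rightarrow> 'a list \<Rightarrow> 'b::real_normed_vector) \<Rightarrow> bool" where
  "Ck_multi Q 0 k T = (\<forall>u\<in>Q. bounded_multilinear_on UNIV k (T u))"
| "Ck_multi Q (Suc N) k T =
     ((\<forall>u\<in>Q. bounded_multilinear_on UNIV k (T u)) \<and> has_multi_deriv_on Q k T (multi_deriv T) \<and>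
      Ck_multi Q N (Suc k) (multi_deriv T))"

lemma Ck_multi_bounded_multilinear:
  "Ck_multi Q N k T \<Longrightarrow> u \<in> Q \<Longrightarrow> bounded_multilinear_on UNIV k (T u)"
  by (cases N) auto

lemma prod_list_norm_nonneg: "0 \<le> prod_list (map norm vs)"
  by (induction vs) auto

text \<open>Splitting the argument list as \<open>xs @ a # ys\<close> instead of updating an entry
  makes the conditions compatible with concatenation, which is how the arguments of a product are
  distributed later.\<close>

lemma bounded_multilinear_onI:
  fixes T :: "'a::real_normed_vector list \<Rightarrow> 'b::real_normed_vector"
  assumes add: "\<And>xs ys a b. Suc (length xs + length ys) = k \<Longrightarrow>
      T (xs @ (a + b) # ys) = T (xs @ a # ys) + T (xs @ b # ys)"
    and scale: "\<And>xs ys a r. Suc (length xs + length ys) = k \<Longrightarrow>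
      T (xs @ (r *\<^sub>R a) # ys) = r *\<^sub>R T (xs @ a # ys)"
    and bound: "\<And>vs. length vs = k \<Longrightarrow> norm (T vs) \<le> K * prod_list (map norm vs)"
  shows "bounded_multilinear_on UNIV k T"
  unfolding bounded_multilinear_on_def
proof (intro conjI allI impI)
  fix vs :: "'a list" and i and a b :: 'a and r :: real
  assume *: "set vs \<subseteq> UNIV \<and> length vs = k \<and> i < k \<and> a \<in> UNIV \<and> b \<in> UNIV"
  then have l: "Suc (length (take i vs) + length (drop (Suc i) vs)) = k" by auto
  have u: "vs[i := c] = take i vs @ c # drop (Suc i) vs" for c
    using * by (simp add: upd_conv_take_nth_drop)
  show "T (vs[i := a + b]) = T (vs[i := a]) + T (vs[i := b])" unfolding u by (rule add[OF l])
  show "T (vs[i := r *\<^sub>R a]) = r *\<^sub>R T (vs[i := a])" unfolding u by (rule scale[OF l])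
next
  show "\<exists>K. \<forall>vs. set vs \<subseteq> UNIV \<and> length vs = k \<longrightarrow> norm (T vs) \<le> K * prod_list (map norm vs)"
    using bound by blast
qed

lemma bounded_multilinear_on_add:
  assumes "bounded_multilinear_on UNIV k T" "Suc (length xs + length ys) = k"
  shows "T (xs @ (a + b) # ys) = T (xs @ a # ys) + T (xs @ b # ys)"
proof -
  have "(xs @ a # ys)[length xs := c] = xs @ c # ys" for c by simp
  moreover have "length (xs @ a # ys) = k" "length xs < k" using assms(2) by auto
  ultimately show ?thesis
    using assms(1) unfolding bounded_multilinear_on_def by (metis UNIV_I subset_UNIV)
qed

lemma bounded_multilinear_on_scale:
  assumes "bounded_multilinear_on UNIV k T" "Suc (length xs + length ys) = k"
  shows "T (xs @ (r *\<^sub>R a) # ys) = r *\<^sub>R T (xs @ a # ys)"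
proof -
  have "(xs @ a # ys)[length xs := c] = xs @ c # ys" for c by simp
  moreover have "length (xs @ a # ys) = k" "length xs < k" using assms(2) by auto
  ultimately show ?thesis
    using assms(1) unfolding bounded_multilinear_on_def by (metis UNIV_I subset_UNIV)
qed

lemma bounded_multilinear_on_bound:
  assumes "bounded_multilinear_on UNIV k T"
  obtains K where "K \<ge> 0" "\<And>vs. length vs = k \<Longrightarrow> norm (T vs) \<le> K * prod_list (map norm vs)"
proof -
  obtain K where K: "\<And>vs. length vs = k \<Longrightarrow> norm (T vs) \<le> K * prod_list (map norm vs)"
    using assms unfolding bounded_multilinear_on_def by auto
  have "norm (T vs) \<le> \<bar>K\<bar> * prod_list (map norm vs)" if "length vs = k" for vs
    using K[OF that] prod_list_norm_nonneg[of vs] by (meson abs_ge_self mult_right_mono order_trans)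
  then show ?thesis using that[of "\<bar>K\<bar>"] by auto
qed

lemma bounded_multilinear_on_cong:
  assumes "bounded_multilinear_on UNIV k T" "\<And>vs. length vs = k \<Longrightarrow> T' vs = T vs"
  shows "bounded_multilinear_on E k T'"
  using assms(1) unfolding bounded_multilinear_on_def
  by (auto simp: assms(2))

text \<open>Homogeneity in the first slot turns the uniform remainder estimate along
  \<open>s *\<^sub>R h\<close> into an ordinary vector derivative in \<open>s\<close>.\<close>

lemma has_multi_deriv_on_line:
  assumes Q: "open Q" "u \<in> Q" and d: "has_multi_deriv_on Q k T T'"
    and m: "bounded_multilinear_on UNIV (Suc k) (T' u)" and l: "length ws = k"
  shows "((\<lambda>s::real. T (u + s *\<^sub>R h) ws) has_vector_derivative T' u (h # ws)) (at 0)"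
proof -
  obtain r where r: "r > 0" "\<And>y. norm (y - u) < r \<Longrightarrow> y \<in> Q"
    using Q by (metis open_contains_ball dist_commute dist_norm mem_ball subset_iff)
  define P where "P = prod_list (map norm ws)"
  have P: "P \<ge> 0" by (simp add: P_def prod_list_norm_nonneg)
  show ?thesis
    unfolding has_vector_derivative_def has_derivative_at_alt
  proof (intro conjI allI impI)
    show "bounded_linear (\<lambda>x. x *\<^sub>R T' u (h # ws))" by (rule bounded_linear_scaleR_left)
    fix e :: real assume e: "e > 0"
    \<comment> \<open>The remainder along the line carries the factor \<open>norm h * P\<close>;
      dividing by \<open>c\<close> absorbs it, and the summand 1 keeps \<open>c\<close> positive
      when that factor vanishes.\<close>
    define c where "c = norm h * P + 1"
    have c: "c > 0" using P by (simp add: c_def add_nonneg_pos)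
    obtain \<delta> where \<delta>: "\<delta> > 0" "\<And>h. u + h \<in> Q \<Longrightarrow> norm h < \<delta> \<Longrightarrow>
        norm (T (u + h) ws - T u ws - T' u (h # ws)) \<le> e / c * norm h * P"
      using d Q(2) e c l unfolding has_multi_deriv_on_def P_def
      by (metis divide_pos_pos)
    define \<eta> where "\<eta> = min r \<delta> / (norm h + 1)"
    have "\<eta> > 0" using r \<delta>(1) by (simp add: \<eta>_def add_nonneg_pos)
    moreover have "norm (T (u + y *\<^sub>R h) ws - T (u + 0 *\<^sub>R h) ws - (y - 0) *\<^sub>R T' u (h # ws)) \<le> e * norm (y - 0)"
      if y: "norm (y - 0) < \<eta>" for y
    proof -
      have "\<bar>y\<bar> * (norm h + 1) < min r \<delta>"
        using y by (simp add: \<eta>_def pos_less_divide_eq add_nonneg_pos)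
      then have n: "norm (y *\<^sub>R h) < min r \<delta>"
        by (simp add: algebra_simps)
           (smt (verit) abs_ge_zero)
      have s: "T' u ((y *\<^sub>R h) # ws) = y *\<^sub>R T' u (h # ws)"
        using bounded_multilinear_on_scale[OF m, of "[]" ws y h] l by simp
      have "norm (T (u + y *\<^sub>R h) ws - T u ws - T' u ((y *\<^sub>R h) # ws)) \<le> e / c * norm (y *\<^sub>R h) * P"
        using n r(2)[of "u + y *\<^sub>R h"] by (intro \<delta>(2)) auto
      also have "\<dots> = e * \<bar>y\<bar> * ((norm h * P) / c)" by simp
      also have "\<dots> \<le> e * \<bar>y\<bar> * 1"
        using e c by (intro mult_left_mono) (auto simp: c_def)
      finally show ?thesis by (simp add: s)
    qed
    ultimately show "\<exists>d>0. \<forall>y. norm (y - 0) < d \<longrightarrow>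
        norm (T (u + y *\<^sub>R h) ws - T (u + 0 *\<^sub>R h) ws - (y - 0) *\<^sub>R T' u (h # ws)) \<le> e * norm (y - 0)"
      by blast
  qed
qed

text \<open>Uniqueness of the derivative. \<open>multi_deriv\<close> is a total function given by
  directional derivatives, hence can be iterated without choosing anything; it agrees with any
  closed expression \<open>T'\<close> that satisfies the Frechet estimate.\<close>

lemma multi_deriv_eqI:
  assumes Q: "open Q" "u \<in> Q" and d: "has_multi_deriv_on Q k T T'"
    and m: "bounded_multilinear_on UNIV (Suc k) (T' u)" and l: "length vs = Suc k"
  shows "multi_deriv T u vs = T' u vs"
proof -
  obtain h ws where vs: "vs = h # ws" "length ws = k" using l by (cases vs) auto
  show ?thesis using has_multi_deriv_on_line[OF Q d m vs(2)]
    by (simp add: multi_deriv_def dir_deriv_def vs(1) vector_derivative_at)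
qed

lemma has_multi_deriv_on_cong:
  assumes "has_multi_deriv_on Q k T T'" "\<And>u vs. u \<in> Q \<Longrightarrow> length vs = k \<Longrightarrow> T2 u vs = T u vs"
  shows "has_multi_deriv_on Q k T2 T'"
  using assms unfolding has_multi_deriv_on_def by simp

text \<open>Agreement is assumed only on \<open>Q\<close> and on lists of the right length; since
  \<open>Q\<close> is open, the line derivatives agree there as well, and the induction continues
  with them.\<close>

lemma Ck_multi_cong:
  assumes "open Q"
  shows "Ck_multi Q N k T \<Longrightarrow> (\<And>u vs. u \<in> Q \<Longrightarrow> length vs = k \<Longrightarrow> T2 u vs = T u vs) \<Longrightarrow> Ck_multi Q N k T2"
proof (induction N arbitrary: k T T2)
  case 0
  then show ?case by (auto intro: bounded_multilinear_on_cong)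
next
  case (Suc N)
  have d: "has_multi_deriv_on Q k T2 (multi_deriv T)"
    using Suc.prems by (auto intro: has_multi_deriv_on_cong)
  have eq: "multi_deriv T2 u vs = multi_deriv T u vs" if "u \<in> Q" "length vs = Suc k" for u vs
    using that Suc.prems(1) by (intro multi_deriv_eqI[OF assms _ d]) (auto intro: Ck_multi_bounded_multilinear)
  have "has_multi_deriv_on Q k T2 (multi_deriv T2)"
    using d eq unfolding has_multi_deriv_on_def by simp
  moreover have "Ck_multi Q N (Suc k) (multi_deriv T2)"
    using Suc.prems(1) by (intro Suc.IH[OF _ eq]) auto
  ultimately show ?case using Suc.prems by (auto intro: bounded_multilinear_on_cong)
qed

text \<open>The rules below produce the derivative as an explicit expression; the comparison with
  \<open>multi_deriv\<close> is made here once and for all.\<close>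

lemma Ck_multi_SucI:
  assumes "open Q" "\<And>u. u \<in> Q \<Longrightarrow> bounded_multilinear_on UNIV k (T u)"
    and d: "has_multi_deriv_on Q k T T'" and "Ck_multi Q N (Suc k) T'"
  shows "Ck_multi Q (Suc N) k T"
proof -
  have eq: "multi_deriv T u vs = T' u vs" if "u \<in> Q" "length vs = Suc k" for u vs
    using that assms by (intro multi_deriv_eqI[OF _ _ d]) (auto intro: Ck_multi_bounded_multilinear)
  then have "Ck_multi Q N (Suc k) (multi_deriv T)"
    using assms by (intro Ck_multi_cong[OF assms(1) assms(4)])
  moreover have "has_multi_deriv_on Q k T (multi_deriv T)"
    using d eq unfolding has_multi_deriv_on_def by simp
  ultimately show ?thesis using assms by simp
qed

lemma Ck_multi_Suc: "Ck_multi Q (Suc N) k T \<Longrightarrow> Ck_multi Q N k T"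
  by (induction N arbitrary: k T) auto

lemma Ck_multi_funpow:
  "Ck_multi Q (N + j) k T \<Longrightarrow> Ck_multi Q N (k + j) ((multi_deriv ^^ j) T)"
proof (induction j arbitrary: N)
  case (Suc j)
  have "Ck_multi Q (Suc N) (k + j) ((multi_deriv ^^ j) T)" using Suc.prems by (intro Suc.IH) simp
  then show ?case by simp
qed simp

definition smooth_multi ::
    "'a::real_normed_vector set \<Rightarrow> nat \<Rightarrow> ('a \<Rightarrow> 'a list \<Rightarrow> 'b::real_normed_vector) \<Rightarrow> bool" where
  "smooth_multi Q k T \<longleftrightarrow> open Q \<and> (\<forall>N. Ck_multi Q N k T)"

text \<open>One function has to encode the derivatives of all orders: the order is read off from the
  length of the argument list. Estimates on an open set of the whole space restrict to
  \<open>S\<close> relative to \<open>E\<close>, where they concern fewer increments and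
  arguments.\<close>

lemma smooth_multilinear_onI:
  assumes sm: "smooth_multi Q k T" and S: "S \<subseteq> Q"
    and eq: "\<And>u vs. u \<in> S \<Longrightarrow> set vs \<subseteq> E \<Longrightarrow> length vs = k \<Longrightarrow> T' u vs = T u vs"
  shows "smooth_multilinear_on E S k T'"
  unfolding smooth_multilinear_on_def
proof (rule exI[of _ "\<lambda>u vs. (multi_deriv ^^ (length vs - k)) T u vs"], intro conjI ballI allI impI)
  fix u vs assume "u \<in> S" "set vs \<subseteq> E \<and> length vs = k"
  then show "(multi_deriv ^^ (length vs - k)) T u vs = T' u vs" using eq by simp
next
  fix n u assume n: "k \<le> n" and u: "u \<in> S"
  have C: "Ck_multi Q (Suc 0) n ((multi_deriv ^^ (n - k)) T)"
    using sm Ck_multi_funpow[of Q "Suc 0" "n - k" k T] n unfolding smooth_multi_def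
    by (simp only: le_add_diff_inverse)
  show "bounded_multilinear_on E n ((\<lambda>vs. (multi_deriv ^^ (length vs - k)) T u vs))"
    using u S by (intro bounded_multilinear_on_cong[OF Ck_multi_bounded_multilinear[OF C]]) auto
  have eq: "(multi_deriv ^^ (Suc n - k)) T = multi_deriv ((multi_deriv ^^ (n - k)) T)"
    using n by (simp add: Suc_diff_le)
  fix \<epsilon> :: real assume "\<epsilon> > 0"
  then obtain \<delta> where \<delta>: "\<delta> > 0" "\<And>h vs. u + h \<in> Q \<Longrightarrow> norm h < \<delta> \<Longrightarrow> length vs = n \<Longrightarrow>
      norm ((multi_deriv ^^ (n - k)) T (u + h) vs - (multi_deriv ^^ (n - k)) T u vs
        - (multi_deriv ^^ (Suc n - k)) T u (h # vs)) \<le> \<epsilon> * norm h * prod_list (map norm vs)"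
    using C u S unfolding eq has_multi_deriv_on_def Ck_multi.simps by (meson subsetD)
  show "\<exists>\<delta>>0. \<forall>h\<in>E. u + h \<in> S \<and> norm h < \<delta> \<longrightarrow> (\<forall>vs. set vs \<subseteq> E \<and> length vs = n \<longrightarrow>
      norm ((multi_deriv ^^ (length vs - k)) T (u + h) vs - (multi_deriv ^^ (length vs - k)) T u vs
        - (multi_deriv ^^ (length (h # vs) - k)) T u (h # vs)) \<le> \<epsilon> * norm h * prod_list (map norm vs))"
    using \<delta> S by (intro exI[of _ \<delta>]) auto
qed

lemma smooth_multi_differentiable_line:
  assumes "smooth_multi Q k T" "u \<in> Q" "length ws = k"
  shows "\<exists>d. ((\<lambda>s::real. T (u + s *\<^sub>R h) ws) has_vector_derivative d) (at 0)"
proof -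
  have "open Q" "Ck_multi Q (Suc 0) k T" using assms(1) by (simp_all add: smooth_multi_def del: Ck_multi.simps)
  then show ?thesis
    using has_multi_deriv_on_line[of Q u k T "multi_deriv T" ws h] assms(2,3) by auto
qed

lemma smooth_multi_cong:
  assumes "smooth_multi Q k T" "\<And>u vs. u \<in> Q \<Longrightarrow> length vs = k \<Longrightarrow> T2 u vs = T u vs"
  shows "smooth_multi Q k T2"
  using assms unfolding smooth_multi_def by (blast intro: Ck_multi_cong)

section \<open>Constants, sums and products of smooth families\<close>

lemma bounded_multilinear_on_zero: "bounded_multilinear_on UNIV k (\<lambda>_. 0)"
  by (rule bounded_multilinear_onI[where K = 0]) auto

lemma Ck_multi_zero: "open Q \<Longrightarrow> Ck_multi Q N k (\<lambda>_ _. 0)"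
proof (induction N arbitrary: k)
  case (Suc N)
  show ?case
    using Suc.prems prod_list_norm_nonneg
    by (intro Ck_multi_SucI[where T' = "\<lambda>_ _. 0"] Suc bounded_multilinear_on_zero)
       (auto simp: has_multi_deriv_on_def intro!: exI[of _ 1] mult_nonneg_nonneg)
qed (simp add: bounded_multilinear_on_zero)

lemma smooth_multi_const:
  assumes "open Q" "bounded_multilinear_on UNIV k T"
  shows "smooth_multi Q k (\<lambda>_. T)"
proof -
  have "Ck_multi Q N k (\<lambda>_. T)" for N
  proof (cases N)
    case (Suc M)
    show ?thesis unfolding Suc
      using assms prod_list_norm_nonneg
      by (intro Ck_multi_SucI[where T' = "\<lambda>_ _. 0"] Ck_multi_zero)
         (auto simp: has_multi_deriv_on_def intro!: exI[of _ 1] mult_nonneg_nonneg)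
  qed (use assms in simp)
  then show ?thesis using assms by (simp add: smooth_multi_def)
qed

lemma bounded_multilinear_on_plus:
  assumes "bounded_multilinear_on UNIV k S" "bounded_multilinear_on UNIV k T"
  shows "bounded_multilinear_on UNIV k (\<lambda>vs. S vs + T vs)"
proof -
  obtain K where K: "\<And>vs. length vs = k \<Longrightarrow> norm (S vs) \<le> K * prod_list (map norm vs)"
    using bounded_multilinear_on_bound[OF assms(1)] by metis
  obtain L where L: "\<And>vs. length vs = k \<Longrightarrow> norm (T vs) \<le> L * prod_list (map norm vs)"
    using bounded_multilinear_on_bound[OF assms(2)] by metis
  show ?thesis
  proof (rule bounded_multilinear_onI[where K = "K + L"])
    fix vs :: "'a list" assume "length vs = k"
    then show "norm (S vs + T vs) \<le> (K + L) * prod_list (map norm vs)"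
      using K[of vs] L[of vs] norm_triangle_ineq[of "S vs" "T vs"] by (simp add: distrib_right)
  qed (simp_all add: bounded_multilinear_on_add[OF assms(1)] bounded_multilinear_on_add[OF assms(2)]
      bounded_multilinear_on_scale[OF assms(1)] bounded_multilinear_on_scale[OF assms(2)] scaleR_add_right)
qed

lemma has_multi_deriv_on_add:
  assumes S: "has_multi_deriv_on Q k S S'" and T: "has_multi_deriv_on Q k T T'"
  shows "has_multi_deriv_on Q k (\<lambda>u vs. S u vs + T u vs) (\<lambda>u vs. S' u vs + T' u vs)"
  unfolding has_multi_deriv_on_def
proof (intro ballI allI impI)
  fix u and \<epsilon> :: real assume u: "u \<in> Q" and "0 < \<epsilon>"
  then have e: "\<epsilon> / 2 > 0" by simp
  obtain \<delta>1 where 1: "\<delta>1 > 0" "\<And>h vs. u + h \<in> Q \<Longrightarrow> norm h < \<delta>1 \<Longrightarrow> length vs = k \<Longrightarrow>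
      norm (S (u + h) vs - S u vs - S' u (h # vs)) \<le> \<epsilon> / 2 * norm h * prod_list (map norm vs)"
    using S u e unfolding has_multi_deriv_on_def by meson
  obtain \<delta>2 where 2: "\<delta>2 > 0" "\<And>h vs. u + h \<in> Q \<Longrightarrow> norm h < \<delta>2 \<Longrightarrow> length vs = k \<Longrightarrow>
      norm (T (u + h) vs - T u vs - T' u (h # vs)) \<le> \<epsilon> / 2 * norm h * prod_list (map norm vs)"
    using T u e unfolding has_multi_deriv_on_def by meson
  have "norm (S (u + h) vs + T (u + h) vs - (S u vs + T u vs) - (S' u (h # vs) + T' u (h # vs)))
      \<le> \<epsilon> * norm h * prod_list (map norm vs)"
    if "u + h \<in> Q" "norm h < min \<delta>1 \<delta>2" "length vs = k" for h vs
  proof -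
    have "norm (S (u + h) vs + T (u + h) vs - (S u vs + T u vs) - (S' u (h # vs) + T' u (h # vs)))
      \<le> norm (S (u + h) vs - S u vs - S' u (h # vs)) + norm (T (u + h) vs - T u vs - T' u (h # vs))"
      by (rule order_trans[OF _ norm_triangle_ineq]) (simp add: algebra_simps)
    also have "\<dots> \<le> \<epsilon> / 2 * norm h * prod_list (map norm vs) + \<epsilon> / 2 * norm h * prod_list (map norm vs)"
      using 1(2)[of h vs] 2(2)[of h vs] that by (intro add_mono) auto
    finally show ?thesis by simp
  qed
  then show "\<exists>\<delta>>0. \<forall>h. u + h \<in> Q \<and> norm h < \<delta> \<longrightarrow> (\<forall>vs. length vs = k \<longrightarrow>
      norm (S (u + h) vs + T (u + h) vs - (S u vs + T u vs) - (S' u (h # vs) + T' u (h # vs)))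
      \<le> \<epsilon> * norm h * prod_list (map norm vs))"
    using 1(1) 2(1) by (intro exI[of _ "min \<delta>1 \<delta>2"]) auto
qed

lemma Ck_multi_add:
  assumes "open Q"
  shows "Ck_multi Q N k S \<Longrightarrow> Ck_multi Q N k T \<Longrightarrow> Ck_multi Q N k (\<lambda>u vs. S u vs + T u vs)"
proof (induction N arbitrary: k S T)
  case (Suc N)
  show ?case
    using Suc.prems by (intro Ck_multi_SucI[OF assms _ has_multi_deriv_on_add Suc.IH])
      (auto intro: bounded_multilinear_on_plus)
qed (auto intro: bounded_multilinear_on_plus)

lemma smooth_multi_add:
  "smooth_multi Q k S \<Longrightarrow> smooth_multi Q k T \<Longrightarrow> smooth_multi Q k (\<lambda>u vs. S u vs + T u vs)"
  unfolding smooth_multi_def by (blast intro: Ck_multi_add)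

lemma smooth_multi_sum:
  assumes "open Q" "\<And>i. i \<in> I \<Longrightarrow> smooth_multi Q k (T i)"
  shows "smooth_multi Q k (\<lambda>u vs. \<Sum>i\<in>I. T i u vs)"
  using assms(2)
proof (induction I rule: infinite_finite_induct)
  case (insert i I)
  then show ?case by (simp add: smooth_multi_add)
qed (use assms in \<open>simp_all add: smooth_multi_def Ck_multi_zero\<close>)

text \<open>The arguments of a product of two families are dealt out to the factors by a list of
  booleans.\<close>

definition sel :: "bool list \<Rightarrow> 'a list \<Rightarrow> 'a list" where
  "sel bs vs = map snd (filter fst (zip bs vs))"

lemma sel_simps [simp]:
  "sel [] vs = []" "sel (b # bs) (v # vs) = (if b then v # sel bs vs else sel bs vs)"
  by (simp_all add: sel_def)

lemma sel_append:
  "length bs1 = length xs \<Longrightarrow> sel (bs1 @ bs2) (xs @ ys) = sel bs1 xs @ sel bs2 ys"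
  by (simp add: sel_def)

lemma length_sel: "length bs = length vs \<Longrightarrow> length (sel bs vs) = length (filter (\<lambda>b. b) bs)"
  by (induction bs vs rule: list_induct2) auto

lemma prod_list_sel:
  "length bs = length vs \<Longrightarrow>
   prod_list (map norm (sel bs vs)) * prod_list (map norm (sel (map Not bs) vs)) = prod_list (map norm vs)"
  by (induction bs vs rule: list_induct2) auto

lemma split_at:
  assumes "length bs = Suc (length xs + length ys)"
  obtains bs1 b bs2 where "bs = bs1 @ b # bs2" "length bs1 = length xs" "length bs2 = length ys"
proof
  show "bs = take (length xs) bs @ bs ! length xs # drop (Suc (length xs)) bs"
    using assms by (simp add: id_take_nth_drop)
qed (use assms in auto)

context bounded_bilinear
begin

definition shuffle :: "bool list \<Rightarrow> ('u \<Rightarrow> 'v list \<Rightarrow> 'a) \<Rightarrow> ('u \<Rightarrow> 'v list \<Rightarrow> 'b) \<Rightarrow> 'u \<Rightarrow> 'v list \<Rightarrow> 'c" where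
  "shuffle bs S T u vs = prod (S u (sel bs vs)) (T u (sel (map Not bs) vs))"

lemma bounded_multilinear_on_shuffle:
  fixes S :: "'u \<Rightarrow> 'v::real_normed_vector list \<Rightarrow> 'a" and T :: "'u \<Rightarrow> 'v list \<Rightarrow> 'b"
  assumes S: "bounded_multilinear_on UNIV (length (filter (\<lambda>b. b) bs)) (S u)"
    and T: "bounded_multilinear_on UNIV (length (filter Not bs)) (T u)"
  shows "bounded_multilinear_on UNIV (length bs) (shuffle bs S T u)"
proof -
  have mN: "length (filter (\<lambda>b. b) (map Not xs)) = length (filter Not xs)" for xs
    by (induction xs) auto
  obtain K where K: "K \<ge> 0" "\<And>vs. length vs = length (filter (\<lambda>b. b) bs) \<Longrightarrow> norm (S u vs) \<le> K * prod_list (map norm vs)"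
    using bounded_multilinear_on_bound[OF S] by metis
  obtain L where L: "L \<ge> 0" "\<And>vs. length vs = length (filter Not bs) \<Longrightarrow> norm (T u vs) \<le> L * prod_list (map norm vs)"
    using bounded_multilinear_on_bound[OF T] by metis
  obtain C where C: "C > 0" "\<And>a b. norm (prod a b) \<le> norm a * norm b * C" using pos_bounded by blast
  show ?thesis
  proof (rule bounded_multilinear_onI[where K = "K * L * C"])
    fix vs :: "'v list" assume l: "length vs = length bs"
    have "norm (shuffle bs S T u vs) \<le> norm (S u (sel bs vs)) * norm (T u (sel (map Not bs) vs)) * C"
      unfolding shuffle_def by (rule C(2))
    also have "\<dots> \<le> (K * prod_list (map norm (sel bs vs))) * (L * prod_list (map norm (sel (map Not bs) vs))) * C"
      using l C(1) K(1) by (intro mult_right_mono mult_mono K(2) L(2))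
        (auto simp: length_sel mN o_def prod_list_norm_nonneg)
    also have "\<dots> = K * L * C * prod_list (map norm vs)"
      using l by (simp flip: prod_list_sel[of bs vs])
    finally show "norm (shuffle bs S T u vs) \<le> K * L * C * prod_list (map norm vs)" .
  next
    fix xs ys :: "'v list" and a b :: 'v and r :: real
    assume "Suc (length xs + length ys) = length bs"
    then obtain bs1 c bs2 where bs: "bs = bs1 @ c # bs2" "length bs1 = length xs" "length bs2 = length ys"
      using split_at by metis
    show "shuffle bs S T u (xs @ (a + b) # ys) = shuffle bs S T u (xs @ a # ys) + shuffle bs S T u (xs @ b # ys)"
    proof (cases c)
      case True
      show ?thesis
        using bs True bounded_multilinear_on_add[OF S, of "sel bs1 xs" "sel bs2 ys" a b]
        by (simp add: shuffle_def sel_append length_sel add_left)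
    next
      case False
      show ?thesis
        using bs False bounded_multilinear_on_add[OF T, of "sel (map Not bs1) xs" "sel (map Not bs2) ys" a b]
        by (simp add: shuffle_def sel_append length_sel add_right mN o_def)
    qed
    show "shuffle bs S T u (xs @ (r *\<^sub>R a) # ys) = r *\<^sub>R shuffle bs S T u (xs @ a # ys)"
    proof (cases c)
      case True
      show ?thesis
        using bs True bounded_multilinear_on_scale[OF S, of "sel bs1 xs" "sel bs2 ys" r a]
        by (simp add: shuffle_def sel_append length_sel scaleR_left)
    next
      case False
      show ?thesis
        using bs False bounded_multilinear_on_scale[OF T, of "sel (map Not bs1) xs" "sel (map Not bs2) ys" r a]
        by (simp add: shuffle_def sel_append length_sel scaleR_right mN o_def)
    qed
  qed
qed

text \<open>Leibniz rule: the new direction stands at the head of the list and goes to either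
  factor, which prepends \<open>True\<close> or \<open>False\<close> to \<open>bs\<close>. The
  derivative of a shuffle is thus a sum of two shuffles.\<close>

lemma has_multi_deriv_on_shuffle:
  fixes S :: "'v::real_normed_vector \<Rightarrow> 'v list \<Rightarrow> 'a" and T :: "'v \<Rightarrow> 'v list \<Rightarrow> 'b"
  assumes S: "has_multi_deriv_on Q (length (filter (\<lambda>b. b) bs)) S S'"
    and T: "has_multi_deriv_on Q (length (filter Not bs)) T T'"
    and mS: "\<And>u. u \<in> Q \<Longrightarrow> bounded_multilinear_on UNIV (length (filter (\<lambda>b. b) bs)) (S u)"
    and mT: "\<And>u. u \<in> Q \<Longrightarrow> bounded_multilinear_on UNIV (length (filter Not bs)) (T u)"
    and mS': "\<And>u. u \<in> Q \<Longrightarrow> bounded_multilinear_on UNIV (Suc (length (filter (\<lambda>b. b) bs))) (S' u)"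
    and mT': "\<And>u. u \<in> Q \<Longrightarrow> bounded_multilinear_on UNIV (Suc (length (filter Not bs))) (T' u)"
  shows "has_multi_deriv_on Q (length bs) (shuffle bs S T)
           (\<lambda>u vs. shuffle (True # bs) S' T u vs + shuffle (False # bs) S T' u vs)"
  unfolding has_multi_deriv_on_def
proof (intro ballI allI impI)
  let ?k = "length (filter (\<lambda>b. b) bs)" and ?l = "length (filter Not bs)"
  let ?\<pi> = "\<lambda>vs. prod_list (map norm vs)"
  fix u and \<epsilon> :: real assume u: "u \<in> Q" and \<epsilon>: "0 < \<epsilon>"
  obtain C where C: "C > 0" "\<And>a b. norm (prod a b) \<le> norm a * norm b * C" using pos_bounded by blast
  obtain K where K: "K \<ge> 0" "\<And>vs. length vs = ?k \<Longrightarrow> norm (S u vs) \<le> K * ?\<pi> vs"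
    using bounded_multilinear_on_bound[OF mS[OF u]] by metis
  obtain L where L: "L \<ge> 0" "\<And>vs. length vs = ?l \<Longrightarrow> norm (T u vs) \<le> L * ?\<pi> vs"
    using bounded_multilinear_on_bound[OF mT[OF u]] by metis
  obtain K' where K': "K' \<ge> 0" "\<And>vs. length vs = Suc ?k \<Longrightarrow> norm (S' u vs) \<le> K' * ?\<pi> vs"
    using bounded_multilinear_on_bound[OF mS'[OF u]] by metis
  obtain L' where L': "L' \<ge> 0" "\<And>vs. length vs = Suc ?l \<Longrightarrow> norm (T' u vs) \<le> L' * ?\<pi> vs"
    using bounded_multilinear_on_bound[OF mT'[OF u]] by metis
  \<comment> \<open>\<open>D\<close> adds up the bounds of the three error terms below:
    \<open>L + L' + 1\<close> for \<open>T\<close> at the displaced point, \<open>K\<close> for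
    \<open>S u\<close>, and \<open>K' * (L' + 1)\<close> for the increment of \<open>T\<close>
    paired with the derivative of \<open>S\<close>.\<close>
  define D where "D = L + L' + 1 + K + K' * (L' + 1)"
  have D: "D > 0" using K L K' L' by (simp add: D_def add_nonneg_pos add_pos_nonneg)
  \<comment> \<open>The bound \<open>e \<le> 1\<close>, together with \<open>norm h < e\<close>,
    makes the increment of \<open>T\<close> itself of order \<open>e\<close>.\<close>
  define e where "e = min 1 (\<epsilon> / (C * D))"
  have e: "0 < e" "e \<le> 1" "C * D * e \<le> \<epsilon>"
    using \<epsilon> C D by (auto simp: e_def min_def field_simps)
  obtain \<delta>1 where d1: "\<delta>1 > 0" "\<And>h vs. u + h \<in> Q \<Longrightarrow> norm h < \<delta>1 \<Longrightarrow> length vs = ?k \<Longrightarrow>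
      norm (S (u + h) vs - S u vs - S' u (h # vs)) \<le> e * norm h * ?\<pi> vs"
    using S u e(1) unfolding has_multi_deriv_on_def by meson
  obtain \<delta>2 where d2: "\<delta>2 > 0" "\<And>h vs. u + h \<in> Q \<Longrightarrow> norm h < \<delta>2 \<Longrightarrow> length vs = ?l \<Longrightarrow>
      norm (T (u + h) vs - T u vs - T' u (h # vs)) \<le> e * norm h * ?\<pi> vs"
    using T u e(1) unfolding has_multi_deriv_on_def by meson
  have mN: "length (filter (\<lambda>b. b) (map Not xs)) = length (filter Not xs)" for xs
    by (induction xs) auto
  have "norm (shuffle bs S T (u + h) vs - shuffle bs S T u vs
      - (shuffle (True # bs) S' T u (h # vs) + shuffle (False # bs) S T' u (h # vs)))
      \<le> \<epsilon> * norm h * ?\<pi> vs"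
    if h: "u + h \<in> Q" "norm h < min e (min \<delta>1 \<delta>2)" and l: "length vs = length bs" for h vs
  proof -
    define ws where "ws = sel bs vs"
    define zs where "zs = sel (map Not bs) vs"
    have lw: "length ws = ?k" "length zs = ?l" using l by (auto simp: ws_def zs_def length_sel mN o_def)
    have n: "?\<pi> ws \<ge> 0" "?\<pi> zs \<ge> 0" "norm h \<ge> 0" by (auto simp: prod_list_norm_nonneg)
    have \<pi>: "?\<pi> ws * ?\<pi> zs = ?\<pi> vs" using prod_list_sel[of bs vs] l by (simp add: ws_def zs_def)
    define r where "r = S (u + h) ws - S u ws - S' u (h # ws)"
    define q where "q = T (u + h) zs - T u zs - T' u (h # zs)"
    have r: "norm r \<le> e * norm h * ?\<pi> ws" unfolding r_def using d1(2)[of h ws] h lw by simp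
    have q: "norm q \<le> e * norm h * ?\<pi> zs" unfolding q_def using d2(2)[of h zs] h lw by simp
    have T'h: "norm (T' u (h # zs)) \<le> L' * norm h * ?\<pi> zs" using L'(2)[of "h # zs"] lw by (simp add: mult.assoc)
    have S'h: "norm (S' u (h # ws)) \<le> K' * norm h * ?\<pi> ws" using K'(2)[of "h # ws"] lw by (simp add: mult.assoc)
    have Td: "norm (T (u + h) zs - T u zs) \<le> (L' + 1) * e * ?\<pi> zs"
    proof -
      have "norm (T (u + h) zs - T u zs) \<le> norm q + norm (T' u (h # zs))"
        unfolding q_def by (rule order_trans[OF _ norm_triangle_ineq]) simp
      also have "\<dots> \<le> (e + L') * norm h * ?\<pi> zs" using q T'h by (simp add: algebra_simps)
      also have "\<dots> \<le> (1 + L') * e * ?\<pi> zs"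
        using e h n L' by (intro mult_right_mono mult_mono) auto
      finally show ?thesis by (simp add: add.commute)
    qed
    have Tn: "norm (T (u + h) zs) \<le> (L + L' + 1) * ?\<pi> zs"
    proof -
      have "norm (T (u + h) zs) \<le> norm (T (u + h) zs - T u zs) + norm (T u zs)"
        by (rule order_trans[OF _ norm_triangle_ineq]) simp
      also have "\<dots> \<le> (L' + 1) * e * ?\<pi> zs + L * ?\<pi> zs" using Td L(2)[of zs] lw by (intro add_mono) auto
      also have "\<dots> \<le> (L' + 1) * 1 * ?\<pi> zs + L * ?\<pi> zs"
        using e n L' by (intro add_mono mult_right_mono mult_left_mono) auto
      finally show ?thesis by (simp add: algebra_simps)
    qed
    have "shuffle bs S T (u + h) vs - shuffle bs S T u vs
      - (shuffle (True # bs) S' T u (h # vs) + shuffle (False # bs) S T' u (h # vs))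
      = prod r (T (u + h) zs) + prod (S u ws) q + prod (S' u (h # ws)) (T (u + h) zs - T u zs)"
      by (simp add: shuffle_def r_def q_def flip: ws_def zs_def)
         (simp add: diff_left diff_right add_left add_right)
    also have "norm \<dots> \<le> norm (prod r (T (u + h) zs)) + norm (prod (S u ws) q)
        + norm (prod (S' u (h # ws)) (T (u + h) zs - T u zs))"
      by (meson norm_triangle_ineq add_right_mono order_trans)
    also have "\<dots> \<le> (e * norm h * ?\<pi> ws) * ((L + L' + 1) * ?\<pi> zs) * C + (K * ?\<pi> ws) * (e * norm h * ?\<pi> zs) * C
        + (K' * norm h * ?\<pi> ws) * ((L' + 1) * e * ?\<pi> zs) * C"
      using C(1) e n K K' L L' q r Tn Td S'h lw
      by (intro add_mono order_trans[OF C(2)] mult_right_mono mult_mono K(2)) auto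
    also have "\<dots> = (C * D * e) * (norm h * (?\<pi> ws * ?\<pi> zs))" by (simp add: D_def algebra_simps)
    also have "\<dots> \<le> \<epsilon> * (norm h * (?\<pi> ws * ?\<pi> zs))" using n by (intro mult_right_mono e) auto
    finally show ?thesis by (simp add: \<pi> mult.assoc)
  qed
  then show "\<exists>\<delta>>0. \<forall>h. u + h \<in> Q \<and> norm h < \<delta> \<longrightarrow> (\<forall>vs. length vs = length bs \<longrightarrow>
      norm (shuffle bs S T (u + h) vs - shuffle bs S T u vs
        - (shuffle (True # bs) S' T u (h # vs) + shuffle (False # bs) S T' u (h # vs)))
      \<le> \<epsilon> * norm h * ?\<pi> vs)"
    using d1(1) d2(1) e(1) by (intro exI[of _ "min e (min \<delta>1 \<delta>2)"]) auto
qed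

text \<open>The induction runs over all lists \<open>bs\<close> and all factors at once, because the
  derivative consists of shuffles for longer lists, with one factor replaced by its
  derivative.\<close>

lemma Ck_multi_shuffle:
  fixes S :: "'v::real_normed_vector \<Rightarrow> 'v list \<Rightarrow> 'a" and T :: "'v \<Rightarrow> 'v list \<Rightarrow> 'b"
  assumes "open Q"
  shows "Ck_multi Q N (length (filter (\<lambda>b. b) bs)) S \<Longrightarrow> Ck_multi Q N (length (filter Not bs)) T \<Longrightarrow>
    Ck_multi Q N (length bs) (shuffle bs S T)"
proof (induction N arbitrary: bs S T)
  case 0
  show ?case unfolding Ck_multi.simps
    by (intro ballI bounded_multilinear_on_shuffle Ck_multi_bounded_multilinear[OF 0(1)]
        Ck_multi_bounded_multilinear[OF 0(2)])
next
  case (Suc N)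
  have 1: "Ck_multi Q N (length (filter (\<lambda>b. b) bs)) S" "Ck_multi Q N (length (filter Not bs)) T"
    by (rule Ck_multi_Suc[OF Suc.prems(1)], rule Ck_multi_Suc[OF Suc.prems(2)])
  have 2: "has_multi_deriv_on Q (length (filter (\<lambda>b. b) bs)) S (multi_deriv S)"
    "has_multi_deriv_on Q (length (filter Not bs)) T (multi_deriv T)"
    "Ck_multi Q N (Suc (length (filter (\<lambda>b. b) bs))) (multi_deriv S)"
    "Ck_multi Q N (Suc (length (filter Not bs))) (multi_deriv T)"
    using Suc.prems unfolding Ck_multi.simps by blast+
  show ?case
  proof (rule Ck_multi_SucI[OF assms _ has_multi_deriv_on_shuffle[OF 2(1,2)]])
    show "Ck_multi Q N (Suc (length bs))
        (\<lambda>u vs. shuffle (True # bs) (multi_deriv S) T u vs + shuffle (False # bs) S (multi_deriv T) u vs)"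
      using Suc.IH[of "True # bs" "multi_deriv S" T] Suc.IH[of "False # bs" S "multi_deriv T"] 1 2
      by (intro Ck_multi_add[OF assms]) auto
  qed (use 1 2 in \<open>blast intro: Ck_multi_bounded_multilinear bounded_multilinear_on_shuffle\<close>)+
qed

lemma smooth_multi_shuffle:
  fixes S :: "'v::real_normed_vector \<Rightarrow> 'v list \<Rightarrow> 'a" and T :: "'v \<Rightarrow> 'v list \<Rightarrow> 'b"
  assumes "smooth_multi Q (length (filter (\<lambda>b. b) bs)) S" "smooth_multi Q (length (filter Not bs)) T"
  shows "smooth_multi Q (length bs) (shuffle bs S T)"
  using assms Ck_multi_shuffle[of Q _ bs S T] by (auto simp: smooth_multi_def)

end

section \<open>Smooth functions as families without arguments\<close>

lemma bounded_multilinear_on_1: "bounded_linear f \<Longrightarrow> bounded_multilinear_on UNIV 1 (\<lambda>vs. f (vs ! 0))"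
proof -
  assume f: "bounded_linear f"
  then interpret bounded_linear f .
  obtain K where "\<And>x. norm (f x) \<le> norm x * K" using bounded by blast
  then show ?thesis
    by (intro bounded_multilinear_onI[where K = K])
       (auto simp: add scaleR length_Suc_conv mult.commute)
qed

abbreviation smooth_fun :: "'a::real_normed_vector set \<Rightarrow> ('a \<Rightarrow> 'b::real_normed_vector) \<Rightarrow> bool" where
  "smooth_fun Q f \<equiv> smooth_multi Q 0 (\<lambda>u _. f u)"

lemma bounded_multilinear_on_0: "bounded_multilinear_on UNIV 0 (\<lambda>_. c)"
  by (rule bounded_multilinear_onI[where K = "norm c"]) auto

lemma smooth_fun_const: "open Q \<Longrightarrow> smooth_fun Q (\<lambda>_. c)"
  by (rule smooth_multi_const[OF _ bounded_multilinear_on_0])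

text \<open>Bridge to the library: for families without arguments the remainder estimate is the
  usual Frechet derivative, whose bounded linearity is the multilinearity condition for one
  argument.\<close>

lemma has_multi_deriv_on_0_iff:
  assumes "open Q"
  shows "(\<forall>u\<in>Q. bounded_multilinear_on UNIV 1 (T' u)) \<and> has_multi_deriv_on Q 0 (\<lambda>u _. f u) T' \<longleftrightarrow>
    (\<forall>u\<in>Q. bounded_multilinear_on UNIV 1 (T' u) \<and> (f has_derivative (\<lambda>h. T' u [h])) (at u))"
proof -
  have bl: "bounded_linear (\<lambda>h. T' u [h])" if m: "bounded_multilinear_on UNIV 1 (T' u)" for u
  proof -
    obtain K where K: "\<And>vs. length vs = 1 \<Longrightarrow> norm (T' u vs) \<le> K * prod_list (map norm vs)"
      using bounded_multilinear_on_bound[OF m] by metis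
    show ?thesis
      using bounded_multilinear_on_add[OF m, of "[]" "[]"] bounded_multilinear_on_scale[OF m, of "[]" "[]"]
        K[of "[x]" for x]
      by (intro bounded_linear_intro[where K = K]) (auto simp: mult.commute)
  qed
  have eq: "(f has_derivative (\<lambda>h. T' u [h])) (at u) \<longleftrightarrow>
     (\<forall>\<epsilon>>0. \<exists>\<delta>>0. \<forall>h. u + h \<in> Q \<and> norm h < \<delta> \<longrightarrow> norm (f (u + h) - f u - T' u [h]) \<le> \<epsilon> * norm h)"
    (is "_ \<longleftrightarrow> (\<forall>\<epsilon>>0. ?P \<epsilon>)")
    if u: "u \<in> Q" and m: "bounded_multilinear_on UNIV 1 (T' u)" for u
  proof -
    have "(f has_derivative (\<lambda>h. T' u [h])) (at u) \<longleftrightarrow> (f has_derivative (\<lambda>h. T' u [h])) (at u within Q)"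
      using u assms by (metis at_within_open)
    also have "\<dots> \<longleftrightarrow> (\<forall>\<epsilon>>0. \<exists>\<delta>>0. \<forall>y\<in>Q. norm (y - u) < \<delta> \<longrightarrow>
        norm (f y - f u - T' u [y - u]) \<le> \<epsilon> * norm (y - u))"
      by (simp add: has_derivative_within_alt bl[OF m])
    also have "\<dots> \<longleftrightarrow> (\<forall>\<epsilon>>0. ?P \<epsilon>)"
    proof -
      have "(\<forall>y\<in>Q. norm (y - u) < \<delta> \<longrightarrow> norm (f y - f u - T' u [y - u]) \<le> \<epsilon> * norm (y - u)) \<longleftrightarrow>
        (\<forall>h. u + h \<in> Q \<and> norm h < \<delta> \<longrightarrow> norm (f (u + h) - f u - T' u [h]) \<le> \<epsilon> * norm h)" for \<delta> \<epsilon>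
        by (metis add_diff_cancel_left' diff_add_cancel add.commute)
      then show ?thesis by simp
    qed
    finally show ?thesis .
  qed
  show ?thesis unfolding has_multi_deriv_on_def using eq by auto
qed

lemma smooth_fun_has_derivative:
  assumes f: "smooth_fun Q f" and u: "u \<in> Q"
  shows "(f has_derivative dir_deriv f u) (at u)"
proof -
  have "Ck_multi Q (Suc 0) 0 (\<lambda>u _. f u)" using f by (simp add: smooth_multi_def del: Ck_multi.simps)
  then have "(f has_derivative (\<lambda>h. multi_deriv (\<lambda>u _. f u) u [h])) (at u)"
    using has_multi_deriv_on_0_iff[of Q "multi_deriv (\<lambda>u _. f u)" f] f u by (simp add: smooth_multi_def)
  then show ?thesis by (simp add: multi_deriv_def)
qed

lemma dir_deriv_eqI:
  assumes "(f has_derivative f') (at u)"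
  shows "dir_deriv f u v = f' v"
proof -
  have "((\<lambda>s::real. u + s *\<^sub>R v) has_derivative (\<lambda>s. s *\<^sub>R v)) (at 0)"
    by (auto intro!: derivative_eq_intros)
  then have "((\<lambda>s::real. f (u + s *\<^sub>R v)) has_derivative (\<lambda>s. f' (s *\<^sub>R v))) (at 0)"
    using has_derivative_compose[of "\<lambda>s::real. u + s *\<^sub>R v" _ 0 UNIV f f'] assms by simp
  then show ?thesis
    using has_derivative_linear[OF assms]
    by (simp add: dir_deriv_def vector_derivative_at has_vector_derivative_def linear_scale)
qed

lemma smooth_fun_linear:
  assumes "open Q" "bounded_linear f"
  shows "smooth_fun Q f"
proof -
  have m: "bounded_multilinear_on UNIV 1 (\<lambda>vs. f (vs ! 0))" by (rule bounded_multilinear_on_1[OF assms(2)])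
  have "Ck_multi Q N 0 (\<lambda>u _. f u)" for N
  proof (cases N)
    case (Suc M)
    have "has_multi_deriv_on Q 0 (\<lambda>u _. f u) (\<lambda>u vs. f (vs ! 0))"
      using has_multi_deriv_on_0_iff[OF assms(1), of "\<lambda>u vs. f (vs ! 0)" f] m
      by (simp add: bounded_linear_imp_has_derivative[OF assms(2)])
    moreover have "Ck_multi Q M (Suc 0) (\<lambda>u vs. f (vs ! 0))"
      using smooth_multi_const[OF assms(1) m] by (simp add: smooth_multi_def)
    ultimately show ?thesis unfolding Suc
      by (intro Ck_multi_SucI[OF assms(1) bounded_multilinear_on_0])
  qed (simp add: bounded_multilinear_on_0)
  then show ?thesis using assms by (simp add: smooth_multi_def)
qed

lemma (in bounded_bilinear) smooth_fun_prod:
  "smooth_fun Q f \<Longrightarrow> smooth_fun Q g \<Longrightarrow> smooth_fun Q (\<lambda>u. prod (f u) (g u))"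
  using smooth_multi_shuffle[of Q "[]" "\<lambda>u _. f u" "\<lambda>u _. g u"] by (simp add: shuffle_def[abs_def])

lemma sel_replicate:
  "length vs = k \<Longrightarrow> sel (replicate k True) vs = vs"
  by (induction vs arbitrary: k) auto

text \<open>Composition with \<open>g\<close> is a product with the constant 1 under the bilinear
  map sending \<open>r\<close> and \<open>x\<close> to \<open>r *\<^sub>R g x\<close>, where all
  arguments go to the second factor; this replaces a chain rule.\<close>

lemma smooth_multi_comp_linear:
  assumes "smooth_multi Q k T" "bounded_linear g"
  shows "smooth_multi Q k (\<lambda>u vs. g (T u vs))"
proof -
  interpret g: bounded_linear g by fact
  have Q: "open Q" using assms by (simp add: smooth_multi_def)
  interpret b: bounded_bilinear "\<lambda>(r::real) x. r *\<^sub>R g x"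
    by (rule bounded_bilinear.comp[OF bounded_bilinear_scaleR bounded_linear_ident assms(2)])
  have "smooth_multi Q k (b.shuffle (replicate k False) (\<lambda>_ _. 1) T)"
    using b.smooth_multi_shuffle[of Q "replicate k False" "\<lambda>_ _. 1" T] smooth_fun_const[OF Q, of "1::real"] assms(1)
    by simp
  then show ?thesis
    by (rule smooth_multi_cong) (simp add: b.shuffle_def sel_replicate)
qed

lemmas smooth_fun_comp_linear = smooth_multi_comp_linear[where k = 0]

lemma smooth_fun_prod_set:
  fixes f :: "'i \<Rightarrow> 'a::real_normed_vector \<Rightarrow> real"
  assumes "open Q" "\<And>i. i \<in> I \<Longrightarrow> smooth_fun Q (f i)"
  shows "smooth_fun Q (\<lambda>u. \<Prod>i\<in>I. f i u)"
  using assms(2)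
proof (induction I rule: infinite_finite_induct)
  case (insert i I)
  then show ?case by (simp add: bounded_bilinear.smooth_fun_prod[OF bounded_bilinear_mult])
qed (use assms smooth_fun_const in simp_all)

text \<open>The derivative of 1/f is a product of -1, two factors 1/f and the derivative of f. One
  more order of differentiability for 1/f thus follows from the order already reached, by the
  product rule.\<close>

lemma smooth_fun_inverse:
  fixes f :: "'a::real_normed_vector \<Rightarrow> real"
  assumes f: "smooth_fun Q f" and nz: "\<And>u. u \<in> Q \<Longrightarrow> f u \<noteq> 0"
  shows "smooth_fun Q (\<lambda>u. inverse (f u))"
proof -
  interpret m: bounded_bilinear "(*) :: real \<Rightarrow> real \<Rightarrow> real" by (rule bounded_bilinear_mult)
  have Q: "open Q" using f by (simp add: smooth_multi_def)
  have fN: "Ck_multi Q N 0 (\<lambda>u _. f u)" "Ck_multi Q N (Suc 0) (multi_deriv (\<lambda>u _. f u))" for N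
  proof -
    have "Ck_multi Q (Suc N) 0 (\<lambda>u _. f u)" using f unfolding smooth_multi_def by blast
    then show "Ck_multi Q N 0 (\<lambda>u _. f u)" "Ck_multi Q N (Suc 0) (multi_deriv (\<lambda>u _. f u))"
      by (auto intro: Ck_multi_Suc)
  qed
  have "Ck_multi Q N 0 (\<lambda>u _. inverse (f u))" for N
  proof (induction N)
    case (Suc N)
    define R where "R = (\<lambda>(u::'a) (_::'a list). inverse (f u))"
    \<comment> \<open>The single argument goes to the derivative of \<open>f\<close>; all other
      factors take none.\<close>
    define T' where "T' = m.shuffle [False] (m.shuffle [] (\<lambda>u _. - 1) (m.shuffle [] R R)) (multi_deriv (\<lambda>u _. f u))"
    have "Ck_multi Q N 0 (m.shuffle [] (\<lambda>u _. - 1) (m.shuffle [] R R))"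
      using m.Ck_multi_shuffle[OF Q, of N "[]"] Suc smooth_fun_const[OF Q, of "-1::real"]
      by (simp add: smooth_multi_def R_def)
    then have T': "Ck_multi Q N (Suc 0) T'"
      unfolding T'_def using m.Ck_multi_shuffle[OF Q, of N "[False]"] fN by simp
    have T'_eq: "T' u [h] = - (inverse (f u) * dir_deriv f u h * inverse (f u))" for u h
      by (simp add: T'_def m.shuffle_def R_def multi_deriv_def)
    have "has_multi_deriv_on Q 0 (\<lambda>u _. inverse (f u)) T'"
      using has_multi_deriv_on_0_iff[OF Q, of T' "\<lambda>u. inverse (f u)"] T' nz
        Deriv.has_derivative_inverse[OF _ smooth_fun_has_derivative[OF f]]
      by (auto simp: T'_eq intro: Ck_multi_bounded_multilinear)
    then show ?case by (rule Ck_multi_SucI[OF Q bounded_multilinear_on_0 _ T'])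
  qed (simp add: bounded_multilinear_on_0)
  then show ?thesis using Q by (simp add: smooth_multi_def)
qed

section \<open>Frames and matrices\<close>

lemma matrix_inv_mult:
  fixes A :: "real^'n^'n"
  assumes "invertible A"
  shows "A ** matrix_inv A = mat 1" "matrix_inv A ** A = mat 1"
  using someI_ex[OF assms[unfolded invertible_def]] by (simp_all add: matrix_inv_def)

lemma matrix_inv_unique:
  fixes A B :: "real^'n^'n"
  assumes "A ** B = mat 1"
  shows "matrix_inv A = B"
proof -
  have "invertible A" using assms by (auto simp: invertible_right_inverse)
  then show ?thesis using assms matrix_inv_mult(2)[of A]
    by (metis matrix_mul_assoc matrix_mul_lid matrix_mul_rid)
qed

lemma invertible_matrix_inv:
  fixes A :: "real^'n^'n"
  shows "invertible A \<Longrightarrow> invertible (matrix_inv A)"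
  using matrix_inv_mult invertible_def by blast

lemma bounded_bilinear_matrix_mult: "bounded_bilinear ((**) :: real^'n^'m \<Rightarrow> real^'k^'n \<Rightarrow> real^'k^'m)"
  unfolding bilinear_conv_bounded_bilinear[symmetric] bilinear_def
proof (intro conjI allI linearI)
  fix A A' :: "real^'n^'m" and B :: "real^'k^'n" and r :: real
  show "(A + A') ** B = A ** B + A' ** B"
    by (simp add: matrix_matrix_mult_def vec_eq_iff distrib_right sum.distrib)
qed (simp_all add: matrix_add_ldistrib matrix_scalar_ac scalar_matrix_assoc)

interpretation matrix_mult: bounded_bilinear "(**) :: real^'n^'m \<Rightarrow> real^'k^'n \<Rightarrow> real^'k^'m"
  by (rule bounded_bilinear_matrix_mult)

lemma norm_vec_le_sum: "norm x \<le> (\<Sum>i\<in>UNIV. norm (x $ i))"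
  by (simp add: norm_vec_def L2_set_le_sum)

lemma rcomp_nth: "rcomp x A $ j = (\<Sum>i\<in>UNIV. A $ i $ j *\<^sub>R x $ i)"
  by (simp add: rcomp_def lin_def matrix_vector_mult_basis column_def)

lemma rcomp_rcomp: "rcomp (rcomp x A) B = rcomp x (A ** B)"
  by (simp add: rcomp_def[of "rcomp x A"] lin_rcomp matrix_vector_mul_assoc)
     (simp add: rcomp_def)

lemma rcomp_mat_1 [simp]: "rcomp x (mat 1) = x"
  by (simp add: rcomp_def)

lemma bounded_bilinear_rcomp: "bounded_bilinear (rcomp :: 'h::real_inner^'p \<Rightarrow> real^'p^'p \<Rightarrow> 'h^'p)"
proof
  fix a a' :: "'h^'p" and b b' :: "real^'p^'p" and r :: real
  show "rcomp (a + a') b = rcomp a b + rcomp a' b"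
    by (simp add: rcomp_nth vec_eq_iff scaleR_add_right sum.distrib)
  show "rcomp a (b + b') = rcomp a b + rcomp a b'"
    by (simp add: rcomp_nth vec_eq_iff scaleR_add_left sum.distrib)
  show "rcomp (r *\<^sub>R a) b = r *\<^sub>R rcomp a b"
    by (simp add: rcomp_nth vec_eq_iff scaleR_sum_right mult.commute)
  show "rcomp a (r *\<^sub>R b) = r *\<^sub>R rcomp a b"
    by (simp add: rcomp_nth vec_eq_iff scaleR_sum_right)
  show "\<exists>K. \<forall>a b. norm (rcomp (a :: 'h^'p) b) \<le> norm a * norm b * K"
  proof (intro exI allI)
    fix a :: "'h^'p" and b :: "real^'p^'p"
    have "norm (rcomp a b) \<le> (\<Sum>j\<in>(UNIV :: 'p set). \<Sum>i\<in>(UNIV :: 'p set). norm a * norm b)"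
    proof (intro order_trans[OF norm_vec_le_sum] sum_mono)
      fix j
      have "norm (rcomp a b $ j) \<le> (\<Sum>i\<in>UNIV. norm (b $ i $ j *\<^sub>R a $ i))"
        unfolding rcomp_nth by (rule norm_sum)
      also have "\<dots> \<le> (\<Sum>i\<in>(UNIV :: 'p set). norm a * norm b)"
      proof (rule sum_mono)
        fix i
        have "norm (b $ i $ j) \<le> norm b"
          by (meson Finite_Cartesian_Product.norm_nth_le order_trans)
        then show "norm (b $ i $ j *\<^sub>R a $ i) \<le> norm a * norm b"
          by (simp add: mult.commute Finite_Cartesian_Product.norm_nth_le mult_mono)
      qed
      finally show "norm (rcomp a b $ j) \<le> (\<Sum>i\<in>(UNIV :: 'p set). norm a * norm b)" .
    qed
    then show "norm (rcomp a b) \<le> norm a * norm b * (real CARD('p) * real CARD('p))"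
      by (simp add: ac_simps)
  qed
qed

interpretation rcomp: bounded_bilinear "rcomp :: 'h::real_inner^'p \<Rightarrow> real^'p^'p \<Rightarrow> 'h^'p"
  by (rule bounded_bilinear_rcomp)

lemma bounded_bilinear_tcomp: "bounded_bilinear (tcomp :: 'h::real_inner^'p \<Rightarrow> 'h^'p \<Rightarrow> real^'p^'p)"
proof
  fix a a' b b' :: "'h^'p" and r :: real
  show "tcomp (a + a') b = tcomp a b + tcomp a' b"
    by (simp add: tcomp_nth vec_eq_iff inner_add_left)
  show "tcomp a (b + b') = tcomp a b + tcomp a b'"
    by (simp add: tcomp_nth vec_eq_iff inner_add_right)
  show "tcomp (r *\<^sub>R a) b = r *\<^sub>R tcomp a b"
    by (simp add: tcomp_nth vec_eq_iff)
  show "tcomp a (r *\<^sub>R b) = r *\<^sub>R tcomp a b"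
    by (simp add: tcomp_nth vec_eq_iff)
  show "\<exists>K. \<forall>a b. norm (tcomp (a :: 'h^'p) b) \<le> norm a * norm b * K"
  proof (intro exI allI)
    fix a b :: "'h^'p"
    have "norm (tcomp a b) \<le> (\<Sum>i\<in>(UNIV :: 'p set). \<Sum>j\<in>(UNIV :: 'p set). norm a * norm b)"
    proof (intro order_trans[OF norm_vec_le_sum] sum_mono)
      fix i j :: 'p
      have "\<bar>a $ i \<bullet> b $ j\<bar> \<le> norm (a $ i) * norm (b $ j)" by (rule Cauchy_Schwarz_ineq2)
      also have "\<dots> \<le> norm a * norm b"
        by (intro mult_mono) (auto simp: Finite_Cartesian_Product.norm_nth_le)
      finally show "norm (tcomp a b $ i $ j) \<le> norm a * norm b" by (simp add: tcomp_nth)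
    qed
    then show "norm (tcomp a b) \<le> norm a * norm b * (real CARD('p) * real CARD('p))"
      by (simp add: ac_simps)
  qed
qed

interpretation tcomp: bounded_bilinear "tcomp :: 'h::real_inner^'p \<Rightarrow> 'h^'p \<Rightarrow> real^'p^'p"
  by (rule bounded_bilinear_tcomp)

lemma transpose_tcomp: "transpose (tcomp x y) = tcomp y x"
  by (simp add: vec_eq_iff transpose_def tcomp_nth inner_commute)

lemma tcomp_rcomp_right: "tcomp x (rcomp y A) = tcomp x y ** A"
  by (simp add: vec_eq_iff tcomp_nth rcomp_nth matrix_matrix_mult_def inner_sum_right mult.commute)

lemma tcomp_rcomp_left: "tcomp (rcomp x A) y = transpose A ** tcomp x y"
  by (metis matrix_transpose_mul tcomp_rcomp_right transpose_tcomp)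

lemma inner_rcomp: "rcomp x A \<bullet> y = A \<bullet> tcomp x y"
proof -
  have "rcomp x A \<bullet> y = (\<Sum>j\<in>UNIV. \<Sum>i\<in>UNIV. A $ i $ j * (x $ i \<bullet> y $ j))"
    by (simp add: inner_vec_def rcomp_nth inner_sum_left)
  also have "\<dots> = A \<bullet> tcomp x y"
    by (subst sum.swap) (simp add: inner_vec_def tcomp_nth)
  finally show ?thesis .
qed

lemma inner_eq_trace_tcomp: "x \<bullet> y = trace (tcomp x y)"
  by (simp add: trace_def tcomp_nth inner_vec_def)

lemma stiefel_tcomp: "x \<in> stiefel \<longleftrightarrow> tcomp x x = mat 1"
  by (simp add: stiefel_iff vec_eq_iff tcomp_nth mat_def)

lemma rcomp_stiefel:
  assumes "orthogonal_matrix A" "x \<in> stiefel"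
  shows "rcomp x A \<in> stiefel"
  using assms by (simp add: stiefel_tcomp tcomp_rcomp_left tcomp_rcomp_right orthogonal_matrix_def
      flip: matrix_mul_assoc)

lemma mem_orbit: "w \<in> orbit z \<longleftrightarrow> (\<exists>A. orthogonal_matrix A \<and> w = rcomp z A)"
proof -
  have "(\<exists>A. orthogonal_matrix A \<and> w = rcomp z A) \<longleftrightarrow> (\<exists>A. orthogonal_matrix A \<and> w = rcomp z (transpose A))"
    by (metis orthogonal_matrix_transpose transpose_transpose)
  then show ?thesis unfolding orbit_def by auto
qed

lemma mem_orbit_self: "z \<in> orbit z"
  unfolding mem_orbit by (rule exI[of _ "mat 1"]) (simp add: orthogonal_matrix_id)

lemma orbit_rcomp:
  fixes z :: "'h::real_inner^'p"
  assumes "orthogonal_matrix A"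
  shows "orbit (rcomp z A) = orbit z"
proof -
  have "orbit (rcomp z A) \<subseteq> orbit z" if "orthogonal_matrix A" for z :: "'h^'p" and A
    unfolding mem_orbit rcomp_rcomp subset_iff using orthogonal_matrix_mul[OF that] by blast
  moreover have "z = rcomp (rcomp z A) (transpose A)"
    using assms by (simp add: rcomp_rcomp orthogonal_matrix_def)
  ultimately show ?thesis
    using assms by (metis orthogonal_matrix_transpose subset_antisym)
qed

lemma orbit_eqE:
  assumes "orbit w = orbit z"
  obtains A where "orthogonal_matrix A" "w = rcomp z A"
  using assms mem_orbit mem_orbit_self by metis

lemma range_lin_subset: "range (lin (rcomp z A)) \<subseteq> range (lin z)"
  by (auto simp: lin_rcomp)

text \<open>Orbits of frames are determined by their ranges, and an invertible change of frame
  preserves the range; that \<open>A\<close> is orthogonal is then automatic.\<close>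

lemma orbit_eqI:
  assumes "z \<in> stiefel" "w \<in> stiefel" "w = rcomp z A" "invertible A"
  shows "orbit w = orbit z"
proof -
  have "z = rcomp w (matrix_inv A)" using assms by (simp add: rcomp_rcomp matrix_inv_mult)
  then have "range (lin w) = range (lin z)" using range_lin_subset assms(3) by (metis subset_antisym)
  then show ?thesis using orbit_eq_iff assms by blast
qed

section \<open>Smoothness of determinants and matrix inverses\<close>

lemma bounded_linear_axis: "bounded_linear (axis i :: 'b::real_normed_vector \<Rightarrow> 'b ^ 'n)"
proof (rule bounded_linear_intro[where K = 1])
  show "norm (axis i x :: 'b ^ 'n) \<le> norm x * 1" for x
    by (rule order_trans[OF norm_vec_le_sum]) (simp add: axis_def if_distrib[of norm] cong: if_cong)
qed (auto simp: axis_def vec_eq_iff)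

lemma vec_eq_sum_axis: "x = (\<Sum>i\<in>UNIV. axis i (x $ i))"
  for x :: "'b::real_normed_vector ^ 'n"
  by (simp add: vec_eq_iff axis_def if_distrib cong: if_cong)

lemma has_vector_derivative_vecI:
  fixes f :: "real \<Rightarrow> 'b::real_normed_vector ^ 'n"
  assumes "\<And>i. ((\<lambda>s. f s $ i) has_vector_derivative f' $ i) F"
  shows "(f has_vector_derivative f') F"
proof -
  have "((\<lambda>s. \<Sum>i\<in>UNIV. axis i (f s $ i)) has_vector_derivative (\<Sum>i\<in>UNIV. axis i (f' $ i))) F"
    by (intro has_vector_derivative_sum bounded_linear.has_vector_derivative[OF bounded_linear_axis] assms)
  then show ?thesis by (simp flip: vec_eq_sum_axis)
qed

lemma smooth_fun_vecI:
  fixes f :: "'a::real_normed_vector \<Rightarrow> 'b::real_normed_vector ^ 'n"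
  assumes "open Q" "\<And>i. smooth_fun Q (\<lambda>u. f u $ i)"
  shows "smooth_fun Q f"
proof -
  have "smooth_fun Q (\<lambda>u. \<Sum>i\<in>UNIV. axis i (f u $ i))"
    by (rule smooth_multi_sum[OF assms(1)]) (rule smooth_fun_comp_linear[OF assms(2) bounded_linear_axis])
  then show ?thesis by (simp flip: vec_eq_sum_axis)
qed

lemma smooth_fun_vec_nth:
  fixes f :: "'a::real_normed_vector \<Rightarrow> 'b::real_normed_vector ^ 'n"
  shows "smooth_fun Q f \<Longrightarrow> smooth_fun Q (\<lambda>u. f u $ i)"
  by (erule smooth_fun_comp_linear) (rule bounded_linear_vec_nth)

lemma smooth_fun_det:
  fixes f :: "'a::real_normed_vector \<Rightarrow> real ^ 'n ^ 'n"
  assumes Q: "open Q" and f: "\<And>i j. smooth_fun Q (\<lambda>u. f u $ i $ j)"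
  shows "smooth_fun Q (\<lambda>u. det (f u))"
  unfolding det_def
  by (intro smooth_multi_sum Q bounded_bilinear.smooth_fun_prod[OF bounded_bilinear_mult]
      smooth_fun_const smooth_fun_prod_set f)

text \<open>Cramer's rule writes each entry of the inverse as a quotient of determinants, that is,
  of polynomials in the entries; this reduces the inverse of a matrix to the inverse of a real
  function.\<close>

lemma smooth_fun_matrix_inv:
  fixes f :: "'a::real_normed_vector \<Rightarrow> real ^ 'n ^ 'n"
  assumes f: "smooth_fun Q f" and inv: "\<And>u. u \<in> Q \<Longrightarrow> invertible (f u)"
  shows "smooth_fun Q (\<lambda>u. matrix_inv (f u))"
proof -
  have Q: "open Q" using f by (simp add: smooth_multi_def)
  have fij: "smooth_fun Q (\<lambda>u. f u $ i $ j)" for i j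
    by (intro smooth_fun_vec_nth f)
  define c where "c = (\<lambda>u k j. det (\<chi> i l. if l = k then axis j 1 $ i else f u $ i $ l) * inverse (det (f u)))"
  have eq: "matrix_inv (f u) $ k $ j = c u k j" if u: "u \<in> Q" for u k j
  proof -
    have d: "det (f u) \<noteq> 0" using inv[OF u] invertible_det_nz by blast
    have "f u *v (matrix_inv (f u) *v axis j 1) = axis j 1"
      by (simp add: matrix_vector_mul_assoc matrix_inv_mult inv[OF u])
    then have "(matrix_inv (f u) *v axis j 1) $ k = c u k j"
      unfolding cramer[OF d] c_def by (simp add: divide_inverse)
    then show ?thesis by (simp add: matrix_vector_mult_basis column_def)
  qed
  have "smooth_fun Q (\<lambda>u. c u k j)" for k j
    unfolding c_def
  proof (intro bounded_bilinear.smooth_fun_prod[OF bounded_bilinear_mult] smooth_fun_det smooth_fun_inverse Q)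
    show "smooth_fun Q (\<lambda>u. (\<chi> i l. if l = k then axis j 1 $ i else f u $ i $ l) $ i $ l)" for i l
      using fij smooth_fun_const[OF Q] by (cases "l = k") auto
  qed (use fij inv invertible_det_nz in blast)+
  then have "smooth_fun Q (\<lambda>u. matrix_inv (f u) $ k $ j)" for k j
    by (rule smooth_multi_cong) (simp add: eq)
  then show ?thesis by (intro smooth_fun_vecI Q)
qed

lemma continuous_on_det: "continuous_on UNIV (det :: real^'n^'n \<Rightarrow> real)"
proof -
  have "smooth_fun UNIV (det :: real^'n^'n \<Rightarrow> real)"
    by (intro smooth_fun_det open_UNIV smooth_fun_vec_nth smooth_fun_linear bounded_linear_ident)
  then have "isCont (det :: real^'n^'n \<Rightarrow> real) x" for x
    using has_derivative_continuous[OF smooth_fun_has_derivative] by auto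
  then show ?thesis by (simp add: continuous_at_imp_continuous_on)
qed

lemma open_invertible: "open {A :: real^'n^'n. invertible A}"
  using open_vimage[OF open_delete[OF open_UNIV, of 0] continuous_on_det]
  by (simp add: invertible_det_nz vimage_def)

text \<open>Smoothness yields some derivative; differentiating the identity
  \<open>X ** matrix_inv X = mat 1\<close>, valid on the open set of invertible matrices, forces its
  value.\<close>

lemma has_derivative_matrix_inv:
  fixes A :: "real^'n^'n"
  assumes A: "invertible A"
  shows "(matrix_inv has_derivative (\<lambda>H. - (matrix_inv A ** H ** matrix_inv A))) (at A)"
proof -
  let ?Q = "{A :: real^'n^'n. invertible A}"
  let ?D = "dir_deriv matrix_inv A :: real^'n^'n \<Rightarrow> _"
  have "smooth_fun ?Q (matrix_inv :: real^'n^'n \<Rightarrow> _)"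
    by (rule smooth_fun_matrix_inv[OF smooth_fun_linear]) (auto simp: open_invertible bounded_linear_ident)
  then have D: "(matrix_inv has_derivative ?D) (at A)"
    using A by (intro smooth_fun_has_derivative) auto
  have "((\<lambda>X. X ** matrix_inv X) has_derivative (\<lambda>H. A ** ?D H + H ** matrix_inv A)) (at A)"
    by (rule matrix_mult.FDERIV[OF has_derivative_ident D])
  moreover have "((\<lambda>X. X ** matrix_inv X) has_derivative (\<lambda>H. 0)) (at A)"
    by (rule has_derivative_transform_within_open[OF has_derivative_const[of "mat 1"] open_invertible])
       (use A in \<open>auto simp: matrix_inv_mult\<close>)
  ultimately have "(\<lambda>H. A ** ?D H + H ** matrix_inv A) = (\<lambda>H. 0)"
    by (rule has_derivative_unique)
  then have *: "A ** ?D H + H ** matrix_inv A = 0" for H by metis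
  have "?D H = - (matrix_inv A ** H ** matrix_inv A)" for H
  proof -
    have "matrix_inv A ** (A ** ?D H) = - (matrix_inv A ** (H ** matrix_inv A))"
      using *[of H] by (simp add: eq_neg_iff_add_eq_0 flip: matrix_add_ldistrib)
    then show ?thesis by (simp add: matrix_mul_assoc matrix_inv_mult[OF A])
  qed
  then have "?D = (\<lambda>H. - (matrix_inv A ** H ** matrix_inv A))" by blast
  then show ?thesis using D by simp
qed

section \<open>The tangent spaces of the Stiefel manifold\<close>

text \<open>For orthonormal \<open>a\<close> and \<open>b\<close>, \<open>plane_rot\<close> is the
  infinitesimal rotation J of their plane acting on each column, and \<open>plane_proj\<close> is
  the orthogonal projection P onto that plane, equal to minus the square of J. The rotation by the
  angle t is 1 + (cos t - 1) P + (sin t) J.\<close>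

definition plane_rot :: "'h::real_inner \<Rightarrow> 'h \<Rightarrow> 'h^'p \<Rightarrow> 'h^'p" where
  "plane_rot a b z = (\<chi> j. (a \<bullet> z $ j) *\<^sub>R b - (b \<bullet> z $ j) *\<^sub>R a)"

definition plane_proj :: "'h::real_inner \<Rightarrow> 'h \<Rightarrow> 'h^'p \<Rightarrow> 'h^'p" where
  "plane_proj a b z = (\<chi> j. (a \<bullet> z $ j) *\<^sub>R a + (b \<bullet> z $ j) *\<^sub>R b)"

lemma bounded_linear_rank1:
  fixes a b :: "'h::real_inner"
  shows "bounded_linear (\<lambda>z :: 'h^'p. \<chi> j. (a \<bullet> z $ j) *\<^sub>R b)"
proof (rule bounded_linear_intro[where K = "real CARD('p) * (norm a * norm b)"])
  fix z :: "'h^'p"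
  have "norm (\<chi> j. (a \<bullet> z $ j) *\<^sub>R b) \<le> (\<Sum>j\<in>(UNIV :: 'p set). norm a * norm z * norm b)"
  proof (intro order_trans[OF norm_vec_le_sum] sum_mono)
    fix j
    have "\<bar>a \<bullet> z $ j\<bar> \<le> norm a * norm (z $ j)" by (rule Cauchy_Schwarz_ineq2)
    also have "\<dots> \<le> norm a * norm z" by (intro mult_left_mono) (auto simp: Finite_Cartesian_Product.norm_nth_le)
    finally show "norm ((\<chi> j. (a \<bullet> z $ j) *\<^sub>R b) $ j) \<le> norm a * norm z * norm b"
      by (simp add: mult_right_mono)
  qed
  then show "norm (\<chi> j. (a \<bullet> z $ j) *\<^sub>R b) \<le> norm z * (real CARD('p) * (norm a * norm b))"
    by (simp add: ac_simps)
qed (auto simp: vec_eq_iff inner_add_right scaleR_add_left)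

lemma bounded_linear_plane_rot: "bounded_linear (plane_rot a b)"
proof -
  have *: "plane_rot a b = (\<lambda>z. (\<chi> j. (a \<bullet> z $ j) *\<^sub>R b) - (\<chi> j. (b \<bullet> z $ j) *\<^sub>R a))"
    by (auto simp: plane_rot_def vec_eq_iff)
  then show ?thesis unfolding * by (intro bounded_linear_sub bounded_linear_rank1)
qed

lemma bounded_linear_plane_proj: "bounded_linear (plane_proj a b)"
proof -
  have *: "plane_proj a b = (\<lambda>z. (\<chi> j. (a \<bullet> z $ j) *\<^sub>R a) + (\<chi> j. (b \<bullet> z $ j) *\<^sub>R b))"
    by (auto simp: plane_proj_def vec_eq_iff)
  then show ?thesis unfolding * by (intro bounded_linear_add bounded_linear_rank1)
qed

lemma rotation_stiefel:
  fixes z :: "'h::real_inner^'p"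
  assumes z: "z \<in> stiefel" and ab: "norm a = 1" "norm b = 1" "a \<bullet> b = 0"
  shows "z + (cos t - 1) *\<^sub>R plane_proj a b z + sin t *\<^sub>R plane_rot a b z \<in> stiefel"
proof -
  have 1: "a \<bullet> a = 1" "b \<bullet> b = 1" "b \<bullet> a = 0"
    using ab by (simp_all add: dot_square_norm inner_commute)
  have "(h + (cos t - 1) *\<^sub>R ((a \<bullet> h) *\<^sub>R a + (b \<bullet> h) *\<^sub>R b) + sin t *\<^sub>R ((a \<bullet> h) *\<^sub>R b - (b \<bullet> h) *\<^sub>R a))
      \<bullet> (k + (cos t - 1) *\<^sub>R ((a \<bullet> k) *\<^sub>R a + (b \<bullet> k) *\<^sub>R b) + sin t *\<^sub>R ((a \<bullet> k) *\<^sub>R b - (b \<bullet> k) *\<^sub>R a)) = h \<bullet> k"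
    for h k
  proof -
    define \<alpha> \<beta> \<alpha>' \<beta>' where "\<alpha> = a \<bullet> h" "\<beta> = b \<bullet> h" "\<alpha>' = a \<bullet> k" "\<beta>' = b \<bullet> k"
    define p q p' q' where "p = (cos t - 1) * \<alpha> - sin t * \<beta>" "q = (cos t - 1) * \<beta> + sin t * \<alpha>"
      "p' = (cos t - 1) * \<alpha>' - sin t * \<beta>'" "q' = (cos t - 1) * \<beta>' + sin t * \<alpha>'"
    note d = \<alpha>_\<beta>_\<alpha>'_\<beta>'_def p_q_p'_q'_def
    have h: "h + (cos t - 1) *\<^sub>R ((a \<bullet> h) *\<^sub>R a + (b \<bullet> h) *\<^sub>R b) + sin t *\<^sub>R ((a \<bullet> h) *\<^sub>R b - (b \<bullet> h) *\<^sub>R a)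
        = h + p *\<^sub>R a + q *\<^sub>R b" by (simp add: d algebra_simps)
    have k: "k + (cos t - 1) *\<^sub>R ((a \<bullet> k) *\<^sub>R a + (b \<bullet> k) *\<^sub>R b) + sin t *\<^sub>R ((a \<bullet> k) *\<^sub>R b - (b \<bullet> k) *\<^sub>R a)
        = k + p' *\<^sub>R a + q' *\<^sub>R b" by (simp add: d algebra_simps)
    have "(h + p *\<^sub>R a + q *\<^sub>R b) \<bullet> (k + p' *\<^sub>R a + q' *\<^sub>R b)
        = h \<bullet> k + (p' * \<alpha> + q' * \<beta> + p * \<alpha>' + q * \<beta>' + p * p' + q * q')"
      using 1 ab(3) by (simp add: inner_add_left inner_add_right d(1-4) inner_commute algebra_simps)
    also have "p' * \<alpha> + q' * \<beta> + p * \<alpha>' + q * \<beta>' + p * p' + q * q' = 0"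
    proof -
      have "p' * \<alpha> + q' * \<beta> + p * \<alpha>' + q * \<beta>' + p * p' + q * q' = ((cos t)\<^sup>2 + (sin t)\<^sup>2 - 1) * (\<alpha> * \<alpha>' + \<beta> * \<beta>')"
        unfolding d(5-8) by algebra
      then show ?thesis by simp
    qed
    finally show ?thesis unfolding h k by simp
  qed
  then show ?thesis using z by (simp add: stiefel_iff plane_proj_def plane_rot_def)
qed

text \<open>Rotating the points of a curve by the angle \<open>r * s\<close> at time
  \<open>s\<close> leaves the point at time 0 alone and adds \<open>r\<close> times the
  infinitesimal rotation to the velocity. In this way tangent vectors can be added although tangency
  is defined by curves.\<close>

lemma tangent_space_rotate:
  fixes z :: "'h::real_inner^'p"
  assumes \<xi>: "\<xi> \<in> tangent_space stiefel z" and ab: "norm a = 1" "norm b = 1" "a \<bullet> b = 0"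
  shows "\<xi> + r *\<^sub>R plane_rot a b z \<in> tangent_space stiefel z"
proof -
  obtain c where c': "c C1_differentiable_on {-1<..<1}" "c ` {-1<..<1} \<subseteq> stiefel"
      "c 0 = z" "(c has_vector_derivative \<xi>) (at 0)"
    using \<xi> unfolding tangent_space_def by blast
  then obtain D where c: "\<And>s. s \<in> {-1<..<1} \<Longrightarrow> (c has_vector_derivative D s) (at s)" "continuous_on {-1<..<1} D"
    "\<And>s. s \<in> {-1<..<1} \<Longrightarrow> c s \<in> stiefel" "c 0 = z" "(c has_vector_derivative \<xi>) (at 0)"
    unfolding C1_differentiable_on_def by blast
  have D0: "D 0 = \<xi>" using c(1)[of 0] c(5) vector_derivative_unique_at by auto
  note P = bounded_linear_plane_proj[of a b] and J = bounded_linear_plane_rot[of a b]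
  let ?c = "\<lambda>s. c s + (cos (r * s) - 1) *\<^sub>R plane_proj a b (c s) + sin (r * s) *\<^sub>R plane_rot a b (c s)"
  let ?D = "\<lambda>s. D s + ((cos (r * s) - 1) *\<^sub>R plane_proj a b (D s) - (r * sin (r * s)) *\<^sub>R plane_proj a b (c s))
     + (sin (r * s) *\<^sub>R plane_rot a b (D s) + (r * cos (r * s)) *\<^sub>R plane_rot a b (c s))"
  have d: "(?c has_vector_derivative ?D s) (at s)" if s: "s \<in> {-1<..<1}" for s
  proof -
    have 1: "((\<lambda>s. cos (r * s) - 1) has_vector_derivative - (r * sin (r * s))) (at s)"
      "((\<lambda>s. sin (r * s)) has_vector_derivative r * cos (r * s)) (at s)"
      by (auto intro!: derivative_eq_intros simp flip: has_real_derivative_iff_has_vector_derivative)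
    have "((\<lambda>s. (cos (r * s) - 1) *\<^sub>R plane_proj a b (c s)) has_vector_derivative
        (cos (r * s) - 1) *\<^sub>R plane_proj a b (D s) + (- (r * sin (r * s))) *\<^sub>R plane_proj a b (c s)) (at s)"
      using bounded_bilinear.has_vector_derivative[OF bounded_bilinear_scaleR 1(1)
          bounded_linear.has_vector_derivative[OF P c(1)[OF s]]] by simp
    moreover have "((\<lambda>s. sin (r * s) *\<^sub>R plane_rot a b (c s)) has_vector_derivative
        sin (r * s) *\<^sub>R plane_rot a b (D s) + (r * cos (r * s)) *\<^sub>R plane_rot a b (c s)) (at s)"
      using bounded_bilinear.has_vector_derivative[OF bounded_bilinear_scaleR 1(2)
          bounded_linear.has_vector_derivative[OF J c(1)[OF s]]] by simp
    ultimately show ?thesis using c(1)[OF s]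
      by (auto intro!: has_vector_derivative_add)
  qed
  have cc: "continuous_on {-1<..<1} c"
    using c(1) by (meson has_vector_derivative_continuous continuous_at_imp_continuous_on)
  have "continuous_on {-1<..<1} ?D"
    by (intro continuous_intros c(2) cc bounded_linear.continuous_on[OF P] bounded_linear.continuous_on[OF J])
  then have "?c C1_differentiable_on {-1<..<1}"
    unfolding C1_differentiable_on_def by (intro exI[of _ ?D] conjI ballI d)
  moreover have "?c ` {-1<..<1} \<subseteq> stiefel" by (intro image_subsetI rotation_stiefel c(3) ab)
  moreover have "?c 0 = z" using c(4) by simp
  moreover have "(?c has_vector_derivative \<xi> + r *\<^sub>R plane_rot a b z) (at 0)"
    using d[of 0] by (simp add: D0 c(4))
  ultimately show ?thesis unfolding tangent_space_def by (intro CollectI exI[of _ ?c] conjI)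
qed

text \<open>Up to a scalar \<open>plane_rot a b\<close> depends only on the oriented plane:
  Gram-Schmidt replaces the pair by an orthonormal one, and in the degenerate case the scalar is
  zero.\<close>

lemma tangent_space_plane_rot:
  fixes z :: "'h::real_inner^'p"
  assumes "\<xi> \<in> tangent_space stiefel z"
  shows "\<xi> + plane_rot a b z \<in> tangent_space stiefel z"
proof -
  define a1 where "a1 = a /\<^sub>R norm a"
  define b0 where "b0 = b - (a1 \<bullet> b) *\<^sub>R a1"
  define b1 where "b1 = b0 /\<^sub>R norm b0"
  have n: "c = norm c *\<^sub>R (c /\<^sub>R norm c)" for c :: 'h
    by (cases "c = 0") auto
  have a: "a = norm a *\<^sub>R a1" and b: "b0 = norm b0 *\<^sub>R b1"
    unfolding a1_def b1_def by (rule n)+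
  have "(a \<bullet> h) *\<^sub>R b - (b \<bullet> h) *\<^sub>R a = norm a *\<^sub>R ((a1 \<bullet> h) *\<^sub>R b0 - (b0 \<bullet> h) *\<^sub>R a1)" for h
  proof -
    have "(a \<bullet> h) *\<^sub>R b - (b \<bullet> h) *\<^sub>R a = (norm a * (a1 \<bullet> h)) *\<^sub>R b - (norm a * (b \<bullet> h)) *\<^sub>R a1"
      using a by (metis inner_scaleR_left mult.commute scaleR_scaleR)
    then show ?thesis by (simp add: b0_def inner_diff_left algebra_simps)
  qed
  also have "norm a *\<^sub>R ((a1 \<bullet> h) *\<^sub>R b0 - (b0 \<bullet> h) *\<^sub>R a1)
      = (norm a * norm b0) *\<^sub>R ((a1 \<bullet> h) *\<^sub>R b1 - (b1 \<bullet> h) *\<^sub>R a1)" for h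
  proof -
    have "(a1 \<bullet> h) *\<^sub>R b0 - (b0 \<bullet> h) *\<^sub>R a1 = (norm b0 * (a1 \<bullet> h)) *\<^sub>R b1 - (norm b0 * (b1 \<bullet> h)) *\<^sub>R a1"
      using b by (metis inner_scaleR_left mult.commute scaleR_scaleR)
    then show ?thesis by (simp only:) (simp add: algebra_simps)
  qed
  finally have eq: "plane_rot a b z = (norm a * norm b0) *\<^sub>R plane_rot a1 b1 z"
    by (simp add: plane_rot_def vec_eq_iff)
  show ?thesis
  proof (cases "a = 0 \<or> b0 = 0")
    case True
    then show ?thesis unfolding eq using assms by auto
  next
    case False
    then have n: "norm a1 = 1" "norm b1 = 1" by (auto simp: a1_def b1_def)
    have "a1 \<bullet> b1 = 0"
      using n(1) by (simp add: b1_def b0_def inner_diff_right dot_square_norm)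
    then show ?thesis unfolding eq using tangent_space_rotate[OF assms n] by simp
  qed
qed

text \<open>One inclusion differentiates \<open>tcomp (c s) (c s) = mat 1\<close>. The other starts
  from the constant curve and adds a suitable infinitesimal rotation for each column.\<close>

lemma tangent_space_stiefel:
  fixes z :: "'h::real_inner^'p"
  assumes z: "z \<in> stiefel"
  shows "tangent_space stiefel z = {\<xi>. tcomp z \<xi> + tcomp \<xi> z = 0}"
proof (intro equalityI subsetI CollectI)
  fix \<xi> assume "\<xi> \<in> tangent_space stiefel z"
  then obtain c where c': "c ` {-1<..<1} \<subseteq> stiefel" and c: "c 0 = z" "(c has_vector_derivative \<xi>) (at 0)"
    unfolding tangent_space_def by blast
  have cs: "c s \<in> stiefel" if "s \<in> {-1<..<1}" for s using c' that by blast
  have "((\<lambda>s. tcomp (c s) (c s)) has_vector_derivative tcomp z \<xi> + tcomp \<xi> z) (at 0)"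
    using tcomp.has_vector_derivative[OF c(2) c(2)] c(1) by simp
  moreover have "((\<lambda>s. tcomp (c s) (c s)) has_vector_derivative 0) (at 0)"
    by (rule has_vector_derivative_transform_within_open[OF has_vector_derivative_const[of "mat 1"], of "{-1<..<1}"])
       (use cs in \<open>auto simp: stiefel_tcomp\<close>)
  ultimately show "tcomp z \<xi> + tcomp \<xi> z = 0" by (rule vector_derivative_unique_at)
next
  fix \<xi> assume "\<xi> \<in> {\<xi>. tcomp z \<xi> + tcomp \<xi> z = 0}"
  then have \<xi>: "tcomp \<xi> z = - tcomp z \<xi>" by (simp add: eq_neg_iff_add_eq_0 add.commute)
  (* \<xi> turns out to be a sum of infinitesimal rotations in the planes of z $ i and \<zeta> $ i *)
  define \<zeta> where "\<zeta> = \<xi> - (1/2) *\<^sub>R rcomp z (tcomp z \<xi>)"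
  have const: "0 \<in> tangent_space stiefel z"
    unfolding tangent_space_def C1_differentiable_on_def
    by (intro CollectI exI[of _ "\<lambda>_. z"] conjI exI[of _ "\<lambda>_. 0"]) (use z in auto)
  have "(\<Sum>i\<in>I. plane_rot (z $ i) (\<zeta> $ i) z) \<in> tangent_space stiefel z" for I :: "'p set"
  proof (induction I rule: infinite_finite_induct)
    case (insert i I)
    then show ?case using tangent_space_plane_rot[OF insert(3), of "z $ i" "\<zeta> $ i"] by (simp add: add.commute)
  qed (use const in auto)
  \<comment> \<open>Applied with the columns of \<xi> itself, the rotations would count the part of
    \<xi> along the range of \<open>z\<close> twice; the coefficient 1/2 in \<zeta> corrects
    this.\<close>
  moreover have "(\<Sum>i\<in>UNIV. plane_rot (z $ i) (\<zeta> $ i) z) = \<xi>"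
  proof -
    have "(\<Sum>i\<in>UNIV. plane_rot (z $ i) (\<zeta> $ i) z) $ j = (\<zeta> - rcomp z (tcomp \<zeta> z)) $ j" for j
      using z by (simp add: plane_rot_def sum_subtractf rcomp_nth tcomp_nth stiefel_iff if_distrib[of "\<lambda>x. x *\<^sub>R _"]
          cong: if_cong)
    then have "(\<Sum>i\<in>UNIV. plane_rot (z $ i) (\<zeta> $ i) z) = \<zeta> - rcomp z (tcomp \<zeta> z)" by (simp add: vec_eq_iff)
    also have "tcomp \<zeta> z = - (1/2) *\<^sub>R tcomp z \<xi>"
    proof -
      have "tcomp \<zeta> z = tcomp \<xi> z - (1/2) *\<^sub>R transpose (tcomp z \<xi>)"
        using z by (simp add: \<zeta>_def tcomp.diff_left tcomp.scaleR_left tcomp_rcomp_left stiefel_tcomp)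
      moreover have "- X - (1/2) *\<^sub>R (- X) = - (1/2) *\<^sub>R X" for X :: "real^'p^'p"
        by (simp add: vec_eq_iff)
      ultimately show ?thesis by (simp add: transpose_tcomp \<xi>)
    qed
    finally show ?thesis by (simp add: \<zeta>_def rcomp.scaleR_right rcomp.minus_right)
  qed
  ultimately show "\<xi> \<in> tangent_space stiefel z" by metis
qed

section \<open>The graph charts and the metric\<close>

lemma open_invertible_tcomp: "open {z. invertible (tcomp x z)}"
  using open_vimage[OF open_invertible linear_continuous_on[OF tcomp.bounded_linear_right[of x]]]
  by (simp add: vimage_def)

lemma smooth_fun_graph_coord:
  assumes f: "smooth_fun Q f" and inv: "\<And>u. u \<in> Q \<Longrightarrow> invertible (tcomp x (f u))"
  shows "smooth_fun Q (\<lambda>u. graph_coord x (f u))"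
proof -
  have Q: "open Q" using f by (simp add: smooth_multi_def)
  have "smooth_fun Q (\<lambda>u. rcomp (f u) (matrix_inv (tcomp x (f u))) + - x)"
    by (intro smooth_multi_add rcomp.smooth_fun_prod f smooth_fun_matrix_inv inv
        tcomp.smooth_fun_prod smooth_fun_const Q)
  then show ?thesis by (simp add: graph_coord_def)
qed

definition graph_deriv :: "'h::real_inner ^ 'p \<Rightarrow> 'h ^ 'p \<Rightarrow> 'h ^ 'p \<Rightarrow> 'h ^ 'p" where
  "graph_deriv x z \<xi> = rcomp \<xi> (matrix_inv (tcomp x z))
     - rcomp z (matrix_inv (tcomp x z) ** tcomp x \<xi> ** matrix_inv (tcomp x z))"

lemma has_derivative_graph_coord:
  assumes "invertible (tcomp x z)"
  shows "(graph_coord x has_derivative graph_deriv x z) (at z)"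
proof -
  have "((\<lambda>z. matrix_inv (tcomp x z)) has_derivative
      (\<lambda>\<xi>. - (matrix_inv (tcomp x z) ** tcomp x \<xi> ** matrix_inv (tcomp x z)))) (at z)"
    by (rule has_derivative_compose[OF bounded_linear_imp_has_derivative[OF tcomp.bounded_linear_right]
          has_derivative_matrix_inv[OF assms]])
  from has_derivative_diff[OF rcomp.FDERIV[OF has_derivative_ident this] has_derivative_const[of x]]
  show ?thesis
    by (simp add: graph_coord_def[abs_def] graph_deriv_def[abs_def] rcomp.minus_right)
qed

lemma dir_deriv_graph_coord:
  "invertible (tcomp x z) \<Longrightarrow> dir_deriv (graph_coord x) z = graph_deriv x z"
  using dir_deriv_eqI[OF has_derivative_graph_coord] by blast

lemma bounded_linear_graph_deriv: "invertible (tcomp x z) \<Longrightarrow> bounded_linear (graph_deriv x z)"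
  using has_derivative_graph_coord has_derivative_bounded_linear by blast

lemma graph_coord_rcomp:
  assumes "invertible (tcomp x z)" "invertible A"
  shows "graph_coord x (rcomp z A) = graph_coord x z"
proof -
  let ?B = "tcomp x z"
  have "(?B ** A) ** (matrix_inv A ** matrix_inv ?B) = ?B ** (A ** matrix_inv A) ** matrix_inv ?B"
    by (simp only: matrix_mul_assoc)
  then have "matrix_inv (?B ** A) = matrix_inv A ** matrix_inv ?B"
    by (intro matrix_inv_unique) (simp add: assms matrix_inv_mult)
  then have "A ** matrix_inv (?B ** A) = matrix_inv ?B"
    by (simp add: matrix_mul_assoc assms matrix_inv_mult)
  then show ?thesis by (simp add: graph_coord_def tcomp_rcomp_right rcomp_rcomp)
qed

lemma rcomp_graph_coord:
  assumes "invertible (tcomp x z)"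
  shows "rcomp (x + graph_coord x z) (tcomp x z) = z"
  using assms by (simp add: graph_coord_def rcomp_rcomp matrix_inv_mult)

lemma tcomp_graph_coord:
  assumes "x \<in> stiefel" "invertible (tcomp x z)"
  shows "tcomp x (graph_coord x z) = 0"
  using assms by (simp add: graph_coord_def tcomp.diff_right tcomp_rcomp_right matrix_inv_mult stiefel_tcomp)

lemma orbit_eq_graph_coord:
  assumes "z \<in> stiefel" "w \<in> stiefel" "invertible (tcomp x z)" "invertible (tcomp x w)"
    and eq: "graph_coord x z = graph_coord x w"
  shows "orbit z = orbit w"
proof (rule orbit_eqI)
  have "rcomp w (matrix_inv (tcomp x w)) = x + graph_coord x z" by (simp add: eq) (simp add: graph_coord_def)
  then show "z = rcomp w (matrix_inv (tcomp x w) ** tcomp x z)"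
    using rcomp_graph_coord[OF assms(3)] by (metis rcomp_rcomp)
qed (use assms in \<open>auto intro: invertible_mult invertible_matrix_inv\<close>)

lemma orthogonal_invertible: "orthogonal_matrix (A :: real^'p^'p) \<Longrightarrow> invertible A"
  by (auto simp: orthogonal_matrix_def invertible_def)

lemma invertible_tcomp_orbit:
  assumes "orbit w = orbit z" "invertible (tcomp x z)"
  shows "invertible (tcomp x w)"
  using assms by (metis invertible_mult orbit_eqE orthogonal_invertible tcomp_rcomp_right)

lemma chart_sel [simp]:
  "chart_space (grassmann_chart x) = {y. tcomp x y = 0}"
  "chart_metric (grassmann_chart x) = grassmann_metric x"
  "points grassmann = orbit ` stiefel" "atlas grassmann = grassmann_chart ` stiefel"
  by (simp_all add: grassmann_chart_def grassmann_def)

lemma orbit_in_chart_dom: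
  assumes "z \<in> stiefel"
  shows "orbit z \<in> chart_dom (grassmann_chart x) \<longleftrightarrow> invertible (tcomp x z)"
  using assms by (auto simp: grassmann_chart_def dest: invertible_tcomp_orbit)

lemma chart_domE:
  assumes "m \<in> chart_dom (grassmann_chart x)"
  obtains z where "z \<in> stiefel" "invertible (tcomp x z)" "m = orbit z"
  using assms by (auto simp: grassmann_chart_def)

lemma chart_map_orbit:
  assumes "invertible (tcomp x z)"
  shows "chart_map (grassmann_chart x) (orbit z) = graph_coord x z"
proof -
  have "(SOME w. w \<in> orbit z) \<in> orbit z" by (rule someI[of _ z]) (rule mem_orbit_self)
  then obtain A where "orthogonal_matrix A" "(SOME w. w \<in> orbit z) = rcomp z A" by (auto simp: mem_orbit)
  then show ?thesis
    using assms by (simp add: grassmann_chart_def graph_coord_rcomp orthogonal_invertible)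
qed

text \<open>The chart maps onto its whole model space: the adjoint of \<open>x\<close> is a left
  inverse of \<open>x + u\<close>, whose range therefore has dimension p, and any orthonormal frame
  \<open>z\<close> of this range works.\<close>

lemma graph_coord_surj:
  fixes x u :: "'h::real_inner^'p"
  assumes x: "x \<in> stiefel" and u: "tcomp x u = 0"
  obtains z where "z \<in> stiefel" "invertible (tcomp x z)" "graph_coord x z = u"
    "z = rcomp (x + u) (tcomp x z)"
proof -
  have xu: "tcomp x (x + u) = mat 1" using x u by (simp add: tcomp.add_right stiefel_tcomp)
  have inv: "adjoint (lin x) (lin (x + u) v) = v" for v
  proof -
    have "linear (adjoint (lin x))"
      by (rule linearI) (simp_all add: adjoint_lin inner_add_right vec_eq_iff)
    then have "tcomp x (x + u) *v v = (adjoint (lin x) \<circ> lin (x + u)) v"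
      by (simp add: tcomp_def linear_compose linear_lin)
    then show ?thesis using xu by simp
  qed
  define W where "W = range (lin (x + u))"
  have sW: "subspace W" unfolding W_def by (simp add: linear_lin linear_subspace_image)
  have "inj (lin (x + u))" using inv by (metis injI)
  then have "dim W = CARD('p)"
    unfolding W_def by (subst dim_image_eq) (auto simp: linear_lin)
  then have "W \<in> (\<lambda>x. range (lin x)) ` (stiefel :: ('h^'p) set)"
    using sW by (simp add: range_lin_stiefel)
  then obtain z :: "'h^'p" where z: "z \<in> stiefel" "range (lin z) = W" by auto
  have "z $ j = rcomp (x + u) (tcomp x z) $ j" for j
  proof -
    have "z $ j \<in> range (lin (x + u))" using z(2) unfolding W_def by (metis lin_axis rangeI)
    then obtain b where b: "z $ j = lin (x + u) b" by auto
    have "adjoint (lin x) (z $ j) = tcomp x z *v axis j 1"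
      by (simp add: adjoint_lin matrix_vector_mult_basis column_def tcomp_nth)
    then show ?thesis using inv[of b] b by (simp add: rcomp_def)
  qed
  then have zB: "z = rcomp (x + u) (tcomp x z)" by (simp add: vec_eq_iff)
  have "tcomp z (x + u) ** tcomp x z = mat 1"
    using z(1) zB by (metis stiefel_tcomp tcomp_rcomp_right)
  then have i: "invertible (tcomp x z)" by (auto simp: invertible_left_inverse)
  have "graph_coord x z = rcomp (rcomp (x + u) (tcomp x z)) (matrix_inv (tcomp x z)) - x"
    using zB by (simp add: graph_coord_def)
  then have "graph_coord x z = u" by (simp add: rcomp_rcomp matrix_inv_mult[OF i])
  with z(1) i zB show ?thesis using that by blast
qed

text \<open>The kernel of \<open>graph_deriv x z\<close> consists of the vectors
  \<open>rcomp z A\<close>. For tangent \<xi> the matrix \<open>A = tcomp z \<xi>\<close> is skew,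
  so \<open>rcomp z A\<close> is itself vertical, and testing a horizontal \<xi> against it gives
  \<open>A \<bullet> A = 0\<close>. The resulting description does not involve \<open>x\<close>: all
  charts have the same horizontal vectors.\<close>

lemma horizontal_space_stiefel:
  fixes z :: "'h::real_inner^'p"
  assumes z: "z \<in> stiefel" and i: "invertible (tcomp x z)"
  shows "horizontal_space stiefel z (graph_deriv x z) = {\<xi>. tcomp z \<xi> = 0}"
proof (intro equalityI subsetI CollectI)
  fix \<xi> assume "\<xi> \<in> horizontal_space stiefel z (graph_deriv x z)"
  then have \<xi>: "tcomp z \<xi> + tcomp \<xi> z = 0"
    and h: "\<And>\<kappa>. tcomp z \<kappa> + tcomp \<kappa> z = 0 \<Longrightarrow> graph_deriv x z \<kappa> = 0 \<Longrightarrow> \<xi> \<bullet> \<kappa> = 0"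
    by (auto simp: horizontal_space_def tangent_space_stiefel[OF z])
  define A where "A = tcomp z \<xi>"
  have A: "A + transpose A = 0" using \<xi> by (simp add: A_def transpose_tcomp)
  have "\<xi> \<bullet> rcomp z A = 0"
  proof (rule h)
    show "tcomp z (rcomp z A) + tcomp (rcomp z A) z = 0"
      using z A by (simp add: tcomp_rcomp_right tcomp_rcomp_left stiefel_tcomp)
    show "graph_deriv x z (rcomp z A) = 0"
      by (simp add: graph_deriv_def tcomp_rcomp_right rcomp_rcomp matrix_mul_assoc matrix_inv_mult[OF i])
  qed
  then have "rcomp z A \<bullet> \<xi> = 0" by (simp add: inner_commute)
  then have "A \<bullet> A = 0" unfolding inner_rcomp by (simp add: A_def)
  then show "tcomp z \<xi> = 0" by (simp add: A_def)
next
  fix \<xi> assume "\<xi> \<in> {\<xi>. tcomp z \<xi> = 0}"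
  then have \<xi>: "tcomp z \<xi> = 0" "tcomp \<xi> z = 0" by (auto simp flip: transpose_tcomp[of z \<xi>] simp: transpose_def vec_eq_iff)
  have "\<xi> \<bullet> \<kappa> = 0" if "graph_deriv x z \<kappa> = 0" for \<kappa>
  proof -
    let ?B = "tcomp x z"
    have "rcomp \<kappa> (matrix_inv ?B) = rcomp z (matrix_inv ?B ** tcomp x \<kappa> ** matrix_inv ?B)"
      using that by (simp add: graph_deriv_def)
    then have "rcomp (rcomp \<kappa> (matrix_inv ?B)) ?B = rcomp (rcomp z (matrix_inv ?B ** tcomp x \<kappa> ** matrix_inv ?B)) ?B"
      by simp
    then have "\<kappa> = rcomp z (matrix_inv ?B ** tcomp x \<kappa>)"
      by (simp add: rcomp_rcomp matrix_inv_mult[OF i] flip: matrix_mul_assoc)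
    then have "\<kappa> \<bullet> \<xi> = 0" by (metis \<xi>(1) inner_rcomp inner_zero_right)
    then show ?thesis by (simp add: inner_commute)
  qed
  then show "\<xi> \<in> horizontal_space stiefel z (graph_deriv x z)"
    using \<xi> by (simp add: horizontal_space_def tangent_space_stiefel[OF z])
qed

text \<open>The vector \<open>v\<close> is projected off the range of \<open>z\<close>, and the
  factor \<open>tcomp x z\<close> undoes the normalisation in \<open>graph_coord\<close>. For
  \<open>z\<close> in the Stiefel manifold with \<open>tcomp x z\<close> invertible, this inverts
  \<open>graph_deriv x z\<close> between the horizontal space and the model space.\<close>

definition horizontal_lift :: "'h::real_inner ^ 'p \<Rightarrow> 'h ^ 'p \<Rightarrow> 'h ^ 'p \<Rightarrow> 'h ^ 'p" where
  "horizontal_lift x z v = rcomp (v - rcomp z (tcomp z v)) (tcomp x z)"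

lemma bounded_linear_horizontal_lift: "bounded_linear (horizontal_lift x z)"
  unfolding horizontal_lift_def
  by (intro bounded_linear_compose[OF rcomp.bounded_linear_left] bounded_linear_sub bounded_linear_ident
      bounded_linear_compose[OF rcomp.bounded_linear_right] tcomp.bounded_linear_right)

lemma tcomp_horizontal_lift:
  "z \<in> stiefel \<Longrightarrow> tcomp z (horizontal_lift x z v) = 0"
  by (simp add: horizontal_lift_def tcomp_rcomp_right tcomp.diff_right stiefel_tcomp)

lemma graph_deriv_horizontal_lift:
  assumes i: "invertible (tcomp x z)" and v: "tcomp x v = 0"
  shows "graph_deriv x z (horizontal_lift x z v) = v"
proof -
  let ?B = "tcomp x z"
  have x: "tcomp x (horizontal_lift x z v) = - (?B ** tcomp z v ** ?B)"
    by (simp add: horizontal_lift_def tcomp_rcomp_right tcomp.diff_right v matrix_mult.minus_left)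
  have "matrix_inv ?B ** (?B ** tcomp z v ** ?B) ** matrix_inv ?B
      = (matrix_inv ?B ** ?B) ** tcomp z v ** (?B ** matrix_inv ?B)"
    by (simp only: matrix_mul_assoc)
  then show ?thesis
    by (simp add: graph_deriv_def x matrix_mult.minus_right matrix_mult.minus_left rcomp.minus_right)
       (simp add: horizontal_lift_def rcomp_rcomp matrix_inv_mult[OF i])
qed

lemma horizontal_lift_graph_deriv:
  assumes z: "z \<in> stiefel" and i: "invertible (tcomp x z)" and \<xi>: "tcomp z \<xi> = 0"
  shows "horizontal_lift x z (graph_deriv x z \<xi>) = \<xi>"
proof -
  let ?B = "tcomp x z"
  define C where "C = matrix_inv ?B ** tcomp x \<xi> ** matrix_inv ?B"
  have "tcomp z (graph_deriv x z \<xi>) = - C"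
    using z by (simp add: graph_deriv_def tcomp.diff_right tcomp_rcomp_right \<xi> stiefel_tcomp C_def)
  then have "graph_deriv x z \<xi> - rcomp z (tcomp z (graph_deriv x z \<xi>)) = rcomp \<xi> (matrix_inv ?B)"
    by (simp add: rcomp.minus_right) (simp add: graph_deriv_def C_def)
  then show ?thesis by (simp add: horizontal_lift_def rcomp_rcomp matrix_inv_mult[OF i])
qed

lemma tcomp_graph_deriv:
  assumes "invertible (tcomp x z)"
  shows "tcomp x (graph_deriv x z \<xi>) = 0"
proof -
  have "tcomp x z ** (matrix_inv (tcomp x z) ** tcomp x \<xi> ** matrix_inv (tcomp x z))
      = (tcomp x z ** matrix_inv (tcomp x z)) ** tcomp x \<xi> ** matrix_inv (tcomp x z)"
    by (simp only: matrix_mul_assoc)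
  then show ?thesis
    using assms by (simp add: graph_deriv_def tcomp.diff_right tcomp_rcomp_right matrix_inv_mult)
qed

section \<open>The metric as a rational expression in the coordinate\<close>

definition gram_inv :: "'h::real_inner ^ 'p \<Rightarrow> real ^ 'p ^ 'p" where
  "gram_inv u = matrix_inv (mat 1 + tcomp u u)"

definition metric_form :: "'h::real_inner ^ 'p \<Rightarrow> 'h ^ 'p \<Rightarrow> 'h ^ 'p \<Rightarrow> real" where
  "metric_form u v w =
     trace ((tcomp v w - tcomp v u ** gram_inv u ** tcomp u w) ** gram_inv u)"

lemma tcomp_graph:
  assumes "x \<in> stiefel" "tcomp x u = 0"
  shows "tcomp (x + u) (x + u) = mat 1 + tcomp u u"
proof -
  have "tcomp u x = 0" using assms(2) transpose_tcomp[of x u] by (simp add: transpose_def vec_eq_iff)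
  then show ?thesis using assms by (simp add: tcomp.add_left tcomp.add_right stiefel_tcomp)
qed

text \<open>Normalising \<open>x + u\<close> to an orthonormal frame factorises the inverse of its
  Gram matrix. \<open>B\<close> is determined only up to an orthogonal factor on the right, which
  cancels in \<open>B ** transpose B\<close>.\<close>

lemma gram_inv_eq:
  assumes x: "x \<in> stiefel" and u: "tcomp x u = 0" and z: "rcomp (x + u) B \<in> stiefel"
  shows "gram_inv u = B ** transpose B" "invertible (mat 1 + tcomp u u)"
proof -
  have "transpose B ** ((mat 1 + tcomp u u) ** B) = mat 1"
    using z by (simp add: stiefel_tcomp tcomp_rcomp_left tcomp_rcomp_right tcomp_graph[OF x u] matrix_mul_assoc)
  then have "(mat 1 + tcomp u u) ** (B ** transpose B) = mat 1"
    by (simp add: matrix_left_right_inverse matrix_mul_assoc)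
  then show "gram_inv u = B ** transpose B" "invertible (mat 1 + tcomp u u)"
    unfolding gram_inv_def invertible_right_inverse by (auto intro: matrix_inv_unique)
qed

lemma invertible_gram:
  assumes "x \<in> stiefel" "tcomp x u = 0"
  shows "invertible (mat 1 + tcomp u u)"
  using graph_coord_surj[OF assms] gram_inv_eq(2)[OF assms] by metis

text \<open>By cyclicity of the trace \<open>B\<close> enters only through
  \<open>B ** transpose B\<close>, the inverse Gram matrix. Hence the inner product of lifts depends
  on \<open>z\<close> only through its coordinate, which is the invariance that the description
  operator in \<open>grassmann_metric\<close> requires.\<close>

lemma inner_horizontal_lift:
  assumes x: "x \<in> stiefel" and z: "z \<in> stiefel" and i: "invertible (tcomp x z)"
    and v: "tcomp x v = 0" and w: "tcomp x w = 0"
  shows "horizontal_lift x z v \<bullet> horizontal_lift x z w = metric_form (graph_coord x z) v w"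
proof -
  define B u where "B = tcomp x z" and "u = graph_coord x z"
  have u: "tcomp x u = 0" unfolding u_def by (rule tcomp_graph_coord[OF x i])
  have zB: "z = rcomp (x + u) B" unfolding u_def B_def by (rule rcomp_graph_coord[OF i, symmetric])
  have G: "gram_inv u = B ** transpose B" using gram_inv_eq(1)[OF x u] z zB by metis
  have zy: "tcomp z y = transpose B ** tcomp u y" if "tcomp x y = 0" for y
    using that by (subst zB) (simp add: tcomp_rcomp_left tcomp.add_left)
  have yz: "tcomp y z = tcomp y u ** B" if "tcomp x y = 0" for y
    using arg_cong[OF zy[OF that], of transpose] by (simp add: matrix_transpose_mul transpose_tcomp)
  define P where "P = (\<lambda>y. y - rcomp z (tcomp z y))"
  have "tcomp (P v) (P w) = tcomp v w - tcomp v z ** tcomp z w"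
    using z by (simp add: P_def tcomp.diff_left tcomp.diff_right tcomp_rcomp_left tcomp_rcomp_right
        stiefel_tcomp transpose_tcomp)
  also have "\<dots> = tcomp v w - tcomp v u ** gram_inv u ** tcomp u w"
    by (simp add: zy[OF w] yz[OF v] G matrix_mul_assoc)
  finally have P: "tcomp (P v) (P w) = tcomp v w - tcomp v u ** gram_inv u ** tcomp u w" .
  have "horizontal_lift x z v \<bullet> horizontal_lift x z w = trace (transpose B ** (tcomp (P v) (P w) ** B))"
    by (simp add: inner_eq_trace_tcomp horizontal_lift_def tcomp_rcomp_left tcomp_rcomp_right P_def B_def
        matrix_mul_assoc)
  also have "\<dots> = trace (tcomp (P v) (P w) ** gram_inv u)"
    by (subst trace_mul_sym) (simp add: G matrix_mul_assoc)
  finally show ?thesis by (simp add: P metric_form_def u_def)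
qed

text \<open>A value is witnessed by the lifts at any frame with coordinate \<open>u\<close>. It is
  unique because horizontal vectors are recovered from their images, so every admissible value is an
  inner product of lifts.\<close>

lemma grassmann_metric_eq:
  assumes x: "x \<in> stiefel" and u: "tcomp x u = 0" and v: "tcomp x v = 0" and w: "tcomp x w = 0"
  shows "grassmann_metric x u v w = metric_form u v w"
  unfolding grassmann_metric_def
proof (rule the_equality)
  obtain z where z: "z \<in> stiefel" "invertible (tcomp x z)" "graph_coord x z = u"
    using graph_coord_surj[OF x u] by metis
  show "\<exists>z\<in>stiefel. invertible (tcomp x z) \<and> graph_coord x z = u \<and>
        (\<exists>\<xi>\<in>horizontal_space stiefel z (dir_deriv (graph_coord x) z).
         \<exists>\<eta>\<in>horizontal_space stiefel z (dir_deriv (graph_coord x) z).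
           dir_deriv (graph_coord x) z \<xi> = v \<and> dir_deriv (graph_coord x) z \<eta> = w \<and> metric_form u v w = \<xi> \<bullet> \<eta>)"
    using z inner_horizontal_lift[OF x z(1,2) v w]
    by (intro bexI[of _ z] conjI bexI[of _ "horizontal_lift x z v"] bexI[of _ "horizontal_lift x z w"])
       (simp_all add: dir_deriv_graph_coord horizontal_space_stiefel tcomp_horizontal_lift
         graph_deriv_horizontal_lift v w)
next
  fix r
  assume "\<exists>z\<in>stiefel. invertible (tcomp x z) \<and> graph_coord x z = u \<and>
        (\<exists>\<xi>\<in>horizontal_space stiefel z (dir_deriv (graph_coord x) z).
         \<exists>\<eta>\<in>horizontal_space stiefel z (dir_deriv (graph_coord x) z).
           dir_deriv (graph_coord x) z \<xi> = v \<and> dir_deriv (graph_coord x) z \<eta> = w \<and> r = \<xi> \<bullet> \<eta>)"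
  then obtain z \<xi> \<eta> where z: "z \<in> stiefel" "invertible (tcomp x z)" "graph_coord x z = u"
    and "\<xi> \<in> horizontal_space stiefel z (dir_deriv (graph_coord x) z)"
      "\<eta> \<in> horizontal_space stiefel z (dir_deriv (graph_coord x) z)"
      "dir_deriv (graph_coord x) z \<xi> = v" "dir_deriv (graph_coord x) z \<eta> = w" "r = \<xi> \<bullet> \<eta>"
    by blast
  then have "tcomp z \<xi> = 0" "tcomp z \<eta> = 0" "graph_deriv x z \<xi> = v" "graph_deriv x z \<eta> = w" "r = \<xi> \<bullet> \<eta>"
    by (simp_all add: dir_deriv_graph_coord horizontal_space_stiefel)
  then show "r = metric_form u v w"
    using inner_horizontal_lift[OF x z(1,2) v w] horizontal_lift_graph_deriv[OF z(1,2)] z(3) by metis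
qed

lemma grassmann_metric_graph_deriv:
  assumes x: "x \<in> stiefel" and z: "z \<in> stiefel" and i: "invertible (tcomp x z)"
    and "tcomp z \<xi> = 0" "tcomp z \<eta> = 0"
  shows "grassmann_metric x (graph_coord x z) (graph_deriv x z \<xi>) (graph_deriv x z \<eta>) = \<xi> \<bullet> \<eta>"
  using assms inner_horizontal_lift[OF x z i tcomp_graph_deriv[OF i] tcomp_graph_deriv[OF i], of \<xi> \<eta>]
  by (simp add: grassmann_metric_eq tcomp_graph_coord tcomp_graph_deriv horizontal_lift_graph_deriv)

lemma smooth_fun_continuous_on: "smooth_fun Q f \<Longrightarrow> continuous_on Q f"
  using has_derivative_continuous[OF smooth_fun_has_derivative]
  by (intro continuous_at_imp_continuous_on) blast

lemma open_invertible_gram: "open {u. invertible (mat 1 + tcomp u u)}"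
proof -
  have "continuous_on UNIV (\<lambda>u. mat 1 + tcomp u u)"
    by (intro continuous_intros tcomp.continuous_on)
  from open_vimage[OF open_invertible this] show ?thesis by (simp add: vimage_def)
qed

lemma smooth_fun_gram_inv: "smooth_fun {u. invertible (mat 1 + tcomp u u)} gram_inv"
  unfolding gram_inv_def
  by (intro smooth_fun_matrix_inv smooth_multi_add smooth_fun_const open_invertible_gram
      tcomp.smooth_fun_prod smooth_fun_linear bounded_linear_ident) simp

lemma bounded_linear_trace: "bounded_linear (trace :: real^'n^'n \<Rightarrow> real)"
  by (intro linear_conv_bounded_linear[THEN iffD1] linearI)
     (simp_all add: trace_def sum.distrib sum_distrib_left)

text \<open>The expression is assembled from products of families. \<open>V\<close> is the constant
  family that returns its argument, \<open>U\<close> and \<open>G'\<close> take no arguments, and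
  each boolean list says which of the two vectors enters which factor.\<close>

lemma smooth_multi_metric_form:
  "smooth_multi {u :: 'h::real_inner^'p. invertible (mat 1 + tcomp u u)} 2 (\<lambda>u vs. metric_form u (vs ! 0) (vs ! 1))"
proof -
  let ?Q = "{u :: 'h^'p. invertible (mat 1 + tcomp u u)}"
  have Q: "open ?Q" by (rule open_invertible_gram)
  have id: "smooth_fun ?Q (\<lambda>u. u)" by (rule smooth_fun_linear[OF Q bounded_linear_ident])
  have G: "smooth_fun ?Q gram_inv" by (rule smooth_fun_gram_inv)
  define V where "V = (\<lambda>(_ :: 'h^'p) (vs :: ('h^'p) list). vs ! 0)"
  define G' where "G' = (\<lambda>u (_ :: ('h^'p) list). gram_inv (u :: 'h^'p))"
  define U where "U = (\<lambda>u (_ :: ('h^'p) list). u :: 'h^'p)"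
  have V: "smooth_multi ?Q 1 V"
    unfolding V_def by (rule smooth_multi_const[OF Q bounded_multilinear_on_1[OF bounded_linear_ident]])
  have G': "smooth_multi ?Q 0 G'" and U: "smooth_multi ?Q 0 U" using G id by (simp_all add: G'_def U_def)
  define vw where "vw = tcomp.shuffle [True, False] V V"
  define vu where "vu = matrix_mult.shuffle [True] (tcomp.shuffle [True] V U) G'"
  define vuw where "vuw = matrix_mult.shuffle [True, False] vu (tcomp.shuffle [False] U V)"
  have "smooth_multi ?Q 2 vw" "smooth_multi ?Q 1 (tcomp.shuffle [True] V U)" "smooth_multi ?Q 1 (tcomp.shuffle [False] U V)"
    using tcomp.smooth_multi_shuffle[of ?Q "[True, False]" V V] tcomp.smooth_multi_shuffle[of ?Q "[True]" V U]
      tcomp.smooth_multi_shuffle[of ?Q "[False]" U V] V U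
    by (simp_all add: vw_def numeral_2_eq_2)
  moreover from this have "smooth_multi ?Q 1 vu"
    using matrix_mult.smooth_multi_shuffle[of ?Q "[True]" "tcomp.shuffle [True] V U" G'] G'
    by (simp add: vu_def)
  ultimately have "smooth_multi ?Q 2 vw" "smooth_multi ?Q 2 vuw"
    using matrix_mult.smooth_multi_shuffle[of ?Q "[True, False]" vu "tcomp.shuffle [False] U V"]
    by (simp_all add: vuw_def numeral_2_eq_2)
  then have "smooth_multi ?Q 2 (\<lambda>u vs. vw u vs + - vuw u vs)"
    by (intro smooth_multi_add smooth_multi_comp_linear[OF _ bounded_linear_minus[OF bounded_linear_ident]])
  then have "smooth_multi ?Q 2 (matrix_mult.shuffle [True, True] (\<lambda>u vs. vw u vs + - vuw u vs) G')"
    using matrix_mult.smooth_multi_shuffle[of ?Q "[True, True]" _ G'] G' by (simp add: numeral_2_eq_2)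
  from smooth_multi_comp_linear[OF this bounded_linear_trace]
  have "smooth_multi ?Q 2 (\<lambda>u vs. trace (matrix_mult.shuffle [True, True] (\<lambda>u vs. vw u vs + - vuw u vs) G' u vs))" .
  then show ?thesis
    by (rule smooth_multi_cong)
       (auto simp: numeral_2_eq_2 length_Suc_conv metric_form_def tcomp.shuffle_def matrix_mult.shuffle_def
         vw_def vuw_def vu_def V_def U_def G'_def)
qed

section \<open>The manifold structure and the submersion\<close>

text \<open>Testing \<open>P\<close> on all frames with coordinate \<open>u\<close> is the same as
  testing it on one, since they lie in one orbit. The images of the whole domain, of an overlap and
  of a separating set are all instances.\<close>

lemma chart_range_eq:
  assumes x: "x \<in> stiefel"
  shows "chart_map (grassmann_chart x) ` (chart_dom (grassmann_chart x) \<inter> {m. P m})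
    = {u. tcomp x u = 0 \<and> (\<forall>z\<in>stiefel. invertible (tcomp x z) \<longrightarrow> graph_coord x z = u \<longrightarrow> P (orbit z))}"
proof (intro equalityI subsetI CollectI)
  fix u assume "u \<in> chart_map (grassmann_chart x) ` (chart_dom (grassmann_chart x) \<inter> {m. P m})"
  then obtain m where m: "m \<in> chart_dom (grassmann_chart x)" "P m" "u = chart_map (grassmann_chart x) m" by blast
  obtain z where z: "z \<in> stiefel" "invertible (tcomp x z)" "m = orbit z" using m(1) by (rule chart_domE)
  have u: "u = graph_coord x z" using m(3) z by (simp add: chart_map_orbit)
  have "P (orbit w)" if "w \<in> stiefel" "invertible (tcomp x w)" "graph_coord x w = u" for w
    using orbit_eq_graph_coord[OF that(1) z(1) that(2) z(2)] that(3) u m(2) z(3) by simp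
  then show "tcomp x u = 0 \<and> (\<forall>z\<in>stiefel. invertible (tcomp x z) \<longrightarrow> graph_coord x z = u \<longrightarrow> P (orbit z))"
    using tcomp_graph_coord[OF x z(2)] u by blast
next
  fix u assume "u \<in> {u. tcomp x u = 0 \<and> (\<forall>z\<in>stiefel. invertible (tcomp x z) \<longrightarrow> graph_coord x z = u \<longrightarrow> P (orbit z))}"
  then have u: "tcomp x u = 0" "\<And>z. z \<in> stiefel \<Longrightarrow> invertible (tcomp x z) \<Longrightarrow> graph_coord x z = u \<Longrightarrow> P (orbit z)"
    by auto
  obtain z where z: "z \<in> stiefel" "invertible (tcomp x z)" "graph_coord x z = u"
    using graph_coord_surj[OF x u(1)] by metis
  then show "u \<in> chart_map (grassmann_chart x) ` (chart_dom (grassmann_chart x) \<inter> {m. P m})"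
    using u(2)[OF z] by (intro image_eqI[of _ _ "orbit z"]) (auto simp: chart_map_orbit orbit_in_chart_dom)
qed

lemma chart_range_grassmann:
  "x \<in> stiefel \<Longrightarrow> chart_range (grassmann_chart x) = {u. tcomp x u = 0}"
  using chart_range_eq[of x "\<lambda>_. True"] by (simp add: chart_range_def)

text \<open>Any frame with coordinate \<open>u\<close> is \<open>x + u\<close> times an invertible
  matrix, so membership in the second domain can be tested on \<open>x + u\<close>, which is affine
  in the coordinate.\<close>

lemma chart_overlap:
  assumes x: "x \<in> stiefel"
  shows "chart_map (grassmann_chart x) ` (chart_dom (grassmann_chart x) \<inter> chart_dom (grassmann_chart x'))
    = {u. tcomp x u = 0} \<inter> {u. invertible (tcomp x' (x + u))}"
proof -
  have "(\<forall>z\<in>stiefel. invertible (tcomp x z) \<longrightarrow> graph_coord x z = u \<longrightarrow> orbit z \<in> chart_dom (grassmann_chart x'))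
    \<longleftrightarrow> invertible (tcomp x' (x + u))" if u: "tcomp x u = 0" for u
  proof -
    obtain z where z: "z \<in> stiefel" "invertible (tcomp x z)" "graph_coord x z = u"
      using graph_coord_surj[OF x u] by metis
    have *: "invertible (tcomp x' w) \<longleftrightarrow> invertible (tcomp x' (x + u))"
      if w: "w \<in> stiefel" "invertible (tcomp x w)" "graph_coord x w = u" for w
    proof -
      have "w = rcomp (x + u) (tcomp x w)" using rcomp_graph_coord[OF w(2)] w(3) by simp
      then have 1: "tcomp x' w = tcomp x' (x + u) ** tcomp x w" by (metis tcomp_rcomp_right)
      have "x + u = rcomp w (matrix_inv (tcomp x w))" using w(3) by (simp add: graph_coord_def algebra_simps)
      then have 2: "tcomp x' (x + u) = tcomp x' w ** matrix_inv (tcomp x w)" by (metis tcomp_rcomp_right)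
      show ?thesis using 1 2 w(2) by (metis invertible_mult invertible_matrix_inv)
    qed
    show ?thesis
    proof
      assume "\<forall>z\<in>stiefel. invertible (tcomp x z) \<longrightarrow> graph_coord x z = u \<longrightarrow> orbit z \<in> chart_dom (grassmann_chart x')"
      then show "invertible (tcomp x' (x + u))" using z *[OF z] by (auto simp: orbit_in_chart_dom)
    next
      assume "invertible (tcomp x' (x + u))"
      then show "\<forall>z\<in>stiefel. invertible (tcomp x z) \<longrightarrow> graph_coord x z = u \<longrightarrow> orbit z \<in> chart_dom (grassmann_chart x')"
        using * by (auto simp: orbit_in_chart_dom)
    qed
  qed
  then show ?thesis
    using chart_range_eq[OF x, of "\<lambda>m. m \<in> chart_dom (grassmann_chart x')"] by auto
qed

lemma inj_on_chart_map: "inj_on (chart_map (grassmann_chart x)) (chart_dom (grassmann_chart x))"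
proof (rule inj_onI)
  fix m m' assume "m \<in> chart_dom (grassmann_chart x)" "m' \<in> chart_dom (grassmann_chart x)"
    and eq: "chart_map (grassmann_chart x) m = chart_map (grassmann_chart x) m'"
  then obtain z z' where "z \<in> stiefel" "invertible (tcomp x z)" "m = orbit z"
    "z' \<in> stiefel" "invertible (tcomp x z')" "m' = orbit z'" by (metis chart_domE)
  then show "m = m'" using eq orbit_eq_graph_coord by (simp add: chart_map_orbit) blast
qed

lemma transition_grassmann:
  assumes x: "x \<in> stiefel" and u: "tcomp x u = 0" and i: "invertible (tcomp x' (x + u))"
  shows "transition (grassmann_chart x) (grassmann_chart x') u = graph_coord x' (x + u)"
proof -
  obtain z where z: "z \<in> stiefel" "invertible (tcomp x z)" "graph_coord x z = u" "z = rcomp (x + u) (tcomp x z)"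
    using graph_coord_surj[OF x u] by metis
  have "inv_into (chart_dom (grassmann_chart x)) (chart_map (grassmann_chart x)) u = orbit z"
    by (rule inv_into_f_eq[OF inj_on_chart_map]) (use z in \<open>auto simp: chart_map_orbit orbit_in_chart_dom\<close>)
  moreover have "tcomp x' z = tcomp x' (x + u) ** tcomp x z" using z(4) by (metis tcomp_rcomp_right)
  ultimately have "transition (grassmann_chart x) (grassmann_chart x') u = graph_coord x' z"
    using z i by (simp add: transition_def chart_map_orbit invertible_mult)
  also have "\<dots> = graph_coord x' (x + u)" by (subst z(4)) (rule graph_coord_rcomp[OF i z(2)])
  finally show ?thesis .
qed

lemma open_transition_dom: "open {u. invertible (tcomp x' (x + u))}"
proof -
  have "continuous_on UNIV (\<lambda>u. tcomp x' (x + u))" by (intro continuous_intros tcomp.continuous_on)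
  from open_vimage[OF open_invertible this] show ?thesis by (simp add: vimage_def)
qed

lemma smooth_on_transition:
  assumes x: "x \<in> stiefel"
  shows "smooth_on {u. tcomp x u = 0} ({u. tcomp x u = 0} \<inter> {u. invertible (tcomp x' (x + u))})
    (transition (grassmann_chart x) (grassmann_chart x'))"
  unfolding smooth_on_def
proof (rule smooth_multilinear_onI)
  let ?Q = "{u. invertible (tcomp x' (x + u))}"
  show "smooth_fun ?Q (\<lambda>u. graph_coord x' (x + u))"
    by (intro smooth_fun_graph_coord smooth_multi_add smooth_fun_const smooth_fun_linear
        open_transition_dom bounded_linear_ident) auto
qed (auto simp: transition_grassmann x)

lemma dir_deriv_transition:
  assumes x: "x \<in> stiefel" and u: "tcomp x u = 0" and i: "invertible (tcomp x' (x + u))" and v: "tcomp x v = 0"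
  shows "dir_deriv (transition (grassmann_chart x) (grassmann_chart x')) u v = graph_deriv x' (x + u) v"
proof -
  have "((\<lambda>u. x + u) has_derivative (\<lambda>h. h)) (at u)"
    by (auto intro!: derivative_eq_intros)
  from has_derivative_compose[OF this has_derivative_graph_coord[OF i]]
  have d: "((\<lambda>u. graph_coord x' (x + u)) has_derivative graph_deriv x' (x + u)) (at u)" .
  have "((\<lambda>s::real. u + s *\<^sub>R v) has_derivative (\<lambda>s. s *\<^sub>R v)) (at 0)"
    by (auto intro!: derivative_eq_intros)
  from has_derivative_compose[OF this, of "\<lambda>u. graph_coord x' (x + u)" "graph_deriv x' (x + u)"] d
  have "((\<lambda>s. graph_coord x' (x + (u + s *\<^sub>R v))) has_vector_derivative graph_deriv x' (x + u) v) (at 0)"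
    by (simp add: has_vector_derivative_def linear_scale[OF has_derivative_linear[OF d]])
  \<comment> \<open>The formula for the transition map is available only inside the model space; a
    line in the direction \<open>v\<close> stays there, and openness keeps a short piece of it in
    the overlap.\<close>
  moreover have "open ((\<lambda>s::real. u + s *\<^sub>R v) -` {u. invertible (tcomp x' (x + u))})"
    by (intro open_vimage open_transition_dom continuous_intros)
  ultimately have "((\<lambda>s. transition (grassmann_chart x) (grassmann_chart x') (u + s *\<^sub>R v))
      has_vector_derivative graph_deriv x' (x + u) v) (at 0)"
    by (rule has_vector_derivative_transform_within_open)
       (use i u v in \<open>auto intro!: transition_grassmann[symmetric] x simp: tcomp.add_right tcomp.scaleR_right\<close>)
  then show ?thesis by (simp add: dir_deriv_def vector_derivative_at)
qed

text \<open>Infinitesimal form of the invariance of \<open>graph_coord\<close> under invertible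
  matrices: multiplying frame and tangent vector by \<open>A\<close> changes nothing, and the
  vertical vector \<open>rcomp y (A ** K)\<close> is killed.\<close>

lemma graph_deriv_rcomp:
  assumes i: "invertible (tcomp x y)" and A: "invertible A"
  shows "graph_deriv x (rcomp y A) (rcomp \<xi> A - rcomp y (A ** K)) = graph_deriv x y \<xi>"
proof -
  let ?B = "tcomp x y"
  have "(?B ** A) ** (matrix_inv A ** matrix_inv ?B) = ?B ** (A ** matrix_inv A) ** matrix_inv ?B"
    by (simp only: matrix_mul_assoc)
  then have inv: "matrix_inv (?B ** A) = matrix_inv A ** matrix_inv ?B"
    by (intro matrix_inv_unique) (simp add: i A matrix_inv_mult)
  have 1: "A ** (matrix_inv A ** C) = C" and 2: "matrix_inv ?B ** (?B ** C) = C"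
    and 3: "matrix_inv A ** (A ** C) = C" for C
    by (simp_all add: matrix_mul_assoc matrix_inv_mult i A)
  show ?thesis
    unfolding graph_deriv_def tcomp_rcomp_right inv tcomp.diff_right rcomp_rcomp rcomp.diff_left
      matrix_mult.diff_left matrix_mult.diff_right rcomp.diff_right
    by (simp add: 1 2 3 flip: matrix_mul_assoc)
qed

text \<open>Both sides are the inner product of the same pair of horizontal vectors at
  \<open>z\<close>: with \<open>B = tcomp x z\<close>, the lift of \<open>v\<close> differs from
  \<open>rcomp v B\<close> by a vertical vector, so its image in the second chart is the transition
  differential of \<open>v\<close>.\<close>

lemma metric_compatible:
  assumes x: "x \<in> stiefel" and x': "x' \<in> stiefel" and z: "z \<in> stiefel"
    and i: "invertible (tcomp x z)" and i': "invertible (tcomp x' z)"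
    and v: "tcomp x v = 0" and w: "tcomp x w = 0"
  shows "grassmann_metric x (graph_coord x z) v w = grassmann_metric x' (graph_coord x' z)
    (graph_deriv x' (x + graph_coord x z) v) (graph_deriv x' (x + graph_coord x z) w)"
proof -
  define B y where "B = tcomp x z" and "y = x + graph_coord x z"
  have zB: "z = rcomp y B" unfolding B_def y_def by (rule rcomp_graph_coord[OF i, symmetric])
  have "y = rcomp z (matrix_inv B)" by (simp add: y_def graph_coord_def B_def)
  then have iy: "invertible (tcomp x' y)" using i i' by (simp add: tcomp_rcomp_right invertible_mult invertible_matrix_inv B_def)
  have "graph_deriv x' z (horizontal_lift x z v) = graph_deriv x' y v" for v
  proof -
    have "horizontal_lift x z v = rcomp v B - rcomp y (B ** (tcomp z v ** B))"
      by (subst horizontal_lift_def) (simp add: rcomp.diff_left rcomp_rcomp flip: B_def, metis rcomp_rcomp zB)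
    then show ?thesis using graph_deriv_rcomp[OF iy] i zB unfolding B_def by metis
  qed
  then show ?thesis
    using grassmann_metric_graph_deriv[OF x' z i' tcomp_horizontal_lift[OF z, of x v] tcomp_horizontal_lift[OF z, of x w]]
      grassmann_metric_eq[OF x tcomp_graph_coord[OF x i] v w] inner_horizontal_lift[OF x z i v w]
    by (simp add: y_def)
qed

text \<open>One column at a time: the reflection in the hyperplane orthogonal to \<open>d\<close>
  takes \<open>U (x $ j)\<close> to \<open>x' $ j\<close>, two vectors of equal length, and fixes
  the columns already matched, which are orthogonal to both. No orthonormal basis of the possibly
  non-separable space is involved.\<close>

lemma reflection_isometry:
  fixes x x' :: "'h::real_inner^'p"
  assumes x: "x \<in> stiefel" and x': "x' \<in> stiefel"
  shows "\<exists>U. linear U \<and> surj U \<and> (\<forall>h k. U h \<bullet> U k = h \<bullet> k) \<and> (\<forall>i\<in>I. U (x $ i) = x' $ i)"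
proof (induction I rule: finite_induct[OF finite])
  case 1
  show ?case by (intro exI[of _ id] conjI linear_id) auto
next
  case (2 j I)
  then obtain U where U: "linear U" "surj U" "\<And>h k. U h \<bullet> U k = h \<bullet> k" "\<And>i. i \<in> I \<Longrightarrow> U (x $ i) = x' $ i"
    by blast
  define d where "d = U (x $ j) - x' $ j"
  define R where "R = (\<lambda>h. h - (2 * (d \<bullet> h) / (d \<bullet> d)) *\<^sub>R d)"
  have linR: "linear R"
    by (rule linearI) (simp_all add: R_def inner_add_right add_divide_distrib algebra_simps)
  have RR: "R (R h) = h" for h
    by (cases "d = 0") (simp_all add: R_def inner_diff_right scaleR_left_distrib[symmetric] flip: scaleR_left_diff_distrib)
  have inR: "R h \<bullet> R k = h \<bullet> k" for h k
    by (cases "d = 0") (simp_all add: R_def inner_diff_right inner_diff_left inner_commute[of h d])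
  have dj: "d \<bullet> U (x $ j) = (d \<bullet> d) / 2"
  proof -
    have "U (x $ j) \<bullet> U (x $ j) = 1" "x' $ j \<bullet> x' $ j = 1" using x x' U(3) by (auto simp: stiefel_iff)
    then show ?thesis by (simp add: d_def inner_diff_left inner_diff_right inner_commute)
  qed
  have "R (U (x $ j)) = x' $ j"
    by (cases "d = 0") (simp_all add: R_def dj, simp_all add: d_def)
  moreover have "R (U (x $ i)) = x' $ i" if i: "i \<in> I" for i
  proof -
    have "i \<noteq> j" using i 2 by auto
    then have "d \<bullet> x' $ i = 0" using x x' U(3)[of "x $ j" "x $ i"] U(4)[OF i] by (simp add: d_def inner_diff_left stiefel_iff)
    then show ?thesis using U(4)[OF i] by (simp add: R_def)
  qed
  moreover have "surj R" using RR by (metis surjI)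
  ultimately show ?case
    using U(3) inR by (intro exI[of _ "R \<circ> U"] conjI linear_compose[OF U(1) linR] comp_surj[OF U(2)]) auto
qed

text \<open>An isometry of the ambient space taking the frame \<open>x\<close> to \<open>x'\<close>,
  applied to each column, preserves the condition that defines the model spaces.\<close>

lemma chart_space_isometry:
  fixes x x' :: "'h::real_inner^'p"
  assumes "x \<in> stiefel" "x' \<in> stiefel"
  shows "\<exists>f. linear f \<and> f ` {y. tcomp x y = 0} = {y. tcomp x' y = 0} \<and> (\<forall>v\<in>{y. tcomp x y = 0}. norm (f v) = norm v)"
proof -
  obtain U where U: "linear U" "surj U" "\<And>h k. U h \<bullet> U k = h \<bullet> k" "\<And>i. U (x $ i) = x' $ i"
    using reflection_isometry[OF assms, of UNIV] by auto
  define f where "f = (\<lambda>y :: 'h^'p. \<chi> i. U (y $ i))"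
  have t: "tcomp x' (f y) = tcomp x y" for y
    by (simp add: vec_eq_iff tcomp_nth f_def U(3) U(4)[symmetric])
  have "linear f"
    by (rule linearI) (simp_all add: f_def vec_eq_iff linear_add[OF U(1)] linear_scale[OF U(1)])
  moreover have "f ` {y. tcomp x y = 0} = {y. tcomp x' y = 0}"
  proof (intro equalityI subsetI)
    fix y assume "y \<in> {y. tcomp x' y = 0}"
    moreover have "f (\<chi> i. inv U (y $ i)) = y" using U(2) by (simp add: f_def vec_eq_iff surj_f_inv_f)
    ultimately show "y \<in> f ` {y. tcomp x y = 0}" using t by (metis image_eqI mem_Collect_eq)
  qed (auto simp: t)
  moreover have "norm (f y) = norm y" for y
    by (simp add: norm_eq_sqrt_inner inner_vec_def f_def U(3))
  ultimately show ?thesis by blast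
qed

section \<open>Separation of points by the overlap of subspaces\<close>

text \<open>Pythagoras for the projection onto the range of \<open>a\<close>. The squared norm of
  \<open>tcomp a b\<close> is the sum of the squared cosines of the principal angles, so the left
  side is the sum of the squared sines.\<close>

lemma norm_residual:
  fixes a b :: "'h::real_inner^'p"
  assumes a: "a \<in> stiefel" and b: "b \<in> stiefel"
  shows "(norm (b - rcomp a (tcomp a b)))\<^sup>2 = real CARD('p) - (norm (tcomp a b))\<^sup>2"
proof -
  let ?T = "tcomp a b"
  have 1: "b \<bullet> b = real CARD('p)" using b by (simp add: inner_eq_trace_tcomp stiefel_tcomp trace_def mat_def)
  have 2: "rcomp a ?T \<bullet> b = ?T \<bullet> ?T" "rcomp a ?T \<bullet> rcomp a ?T = ?T \<bullet> ?T"
    using a by (simp_all add: inner_rcomp tcomp_rcomp_right stiefel_tcomp)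
  show ?thesis
    unfolding power2_norm_eq_inner inner_diff_left inner_diff_right 1 2 inner_commute[of b "rcomp a _"] by simp
qed

lemma norm_transpose: "norm (transpose A) = norm A" for A :: "real^'n^'n"
proof -
  have "transpose A \<bullet> transpose A = A \<bullet> A"
    by (simp add: inner_vec_def transpose_def) (rule sum.swap)
  then show ?thesis by (simp add: norm_eq_sqrt_inner)
qed

text \<open>The norm of \<open>tcomp a b\<close> measures the overlap of the two ranges; it is
  maximal only for equal ranges, where the residual of \<open>b\<close> vanishes.\<close>

lemma norm_tcomp_less:
  fixes a b :: "'h::real_inner^'p"
  assumes a: "a \<in> stiefel" and b: "b \<in> stiefel" and ne: "orbit a \<noteq> orbit b"
  shows "norm (tcomp a b) < norm (tcomp a a)"
proof -
  have "b \<noteq> rcomp a (tcomp a b)"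
  proof
    assume eq: "b = rcomp a (tcomp a b)"
    have "tcomp b a ** tcomp a b = mat 1" using b by (metis eq stiefel_tcomp tcomp_rcomp_right)
    then have "invertible (tcomp a b)" by (auto simp: invertible_left_inverse)
    then show False using orbit_eqI[OF a b eq] ne by simp
  qed
  then have "(norm (b - rcomp a (tcomp a b)))\<^sup>2 > 0" by simp
  moreover have "(norm (tcomp a a))\<^sup>2 = real CARD('p)" using norm_residual[OF a a] a by (simp add: stiefel_tcomp)
  ultimately have "(norm (tcomp a b))\<^sup>2 < (norm (tcomp a a))\<^sup>2" using norm_residual[OF a b] by simp
  then show ?thesis by (rule power2_less_imp_less) simp
qed

lemma norm_tcomp_orbit:
  assumes "orbit w = orbit z"
  shows "norm (tcomp c w) = norm (tcomp c z)"
proof -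
  obtain A where A: "orthogonal_matrix A" "w = rcomp z A" using assms by (rule orbit_eqE)
  have "tcomp w c \<bullet> tcomp w c = rcomp w (tcomp w c) \<bullet> c" by (simp add: inner_rcomp)
  also have "rcomp w (tcomp w c) = rcomp z (A ** transpose A ** tcomp z c)"
    by (simp add: A(2) rcomp_rcomp tcomp_rcomp_left matrix_mul_assoc)
  also have "\<dots> \<bullet> c = tcomp z c \<bullet> tcomp z c" using A(1) by (simp add: orthogonal_matrix_def inner_rcomp)
  finally have "norm (tcomp w c) = norm (tcomp z c)" by (simp add: norm_eq_sqrt_inner)
  then show ?thesis by (metis norm_transpose transpose_tcomp)
qed

text \<open>The subspaces overlapping more with \<open>a\<close> than with \<open>b\<close>;
  exchanging the roles gives a disjoint set, and together they separate two points. In a chart the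
  squared overlap with \<open>c\<close> is \<open>F c u\<close>, continuous in the
  coordinate.\<close>

lemma manifold_open_overlap:
  fixes a b :: "'h::{real_inner,complete_space}^'p"
  shows "manifold_open grassmann {orbit z |z. z \<in> stiefel \<and> norm (tcomp b z) < norm (tcomp a z)}"
  unfolding manifold_open_def
proof (intro conjI ballI)
  let ?V = "{orbit z |z. z \<in> stiefel \<and> norm (tcomp b z) < norm (tcomp a z)}"
  show "?V \<subseteq> points grassmann" by auto
  fix C :: "(('h ^ 'p) set, 'h ^ 'p) riem_chart"
  assume "C \<in> atlas grassmann"
  then obtain x :: "'h^'p" where x: "x \<in> stiefel" and C: "C = grassmann_chart x" by auto
  let ?E = "{u. tcomp x u = 0}"
  define F where "F = (\<lambda>(c::'h^'p) u. trace (tcomp c (x + u) ** gram_inv u ** tcomp (x + u) c))"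
  have F: "(norm (tcomp c z))\<^sup>2 = F c u" if z: "z \<in> stiefel" "invertible (tcomp x z)" "graph_coord x z = u" for c z u
  proof -
    have u: "tcomp x u = 0" using tcomp_graph_coord[OF x z(2)] z(3) by simp
    have zB: "z = rcomp (x + u) (tcomp x z)" using rcomp_graph_coord[OF z(2)] z(3) by simp
    have tr: "A \<bullet> A = trace (A ** transpose A)" for A :: "real^'p^'p"
      by (simp add: trace_def inner_vec_def matrix_matrix_mult_def transpose_def)
    have "tcomp c z = tcomp c (x + u) ** tcomp x z" using zB by (metis tcomp_rcomp_right)
    moreover have "tcomp c (x + u) ** tcomp x z ** transpose (tcomp c (x + u) ** tcomp x z)
        = tcomp c (x + u) ** (tcomp x z ** transpose (tcomp x z)) ** tcomp (x + u) c"
      by (simp only: matrix_transpose_mul transpose_tcomp matrix_mul_assoc)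
    ultimately show ?thesis
      using gram_inv_eq(1)[OF x u, of "tcomp x z"] z(1) zB by (simp add: F_def power2_norm_eq_inner tr)
  qed
  have V: "orbit z \<in> ?V \<longleftrightarrow> norm (tcomp b z) < norm (tcomp a z)" if "z \<in> stiefel" for z
  proof
    assume "orbit z \<in> ?V"
    then obtain w where w: "orbit z = orbit w" "norm (tcomp b w) < norm (tcomp a w)" by blast
    then show "norm (tcomp b z) < norm (tcomp a z)" by (simp only: norm_tcomp_orbit[OF w(1)])
  qed (use that in blast)
  have "chart_map C ` (?V \<inter> chart_dom C)
      = {u. tcomp x u = 0 \<and> (\<forall>z\<in>stiefel. invertible (tcomp x z) \<longrightarrow> graph_coord x z = u \<longrightarrow> orbit z \<in> ?V)}"
    using chart_range_eq[OF x, of "\<lambda>m. m \<in> ?V"] unfolding C by (simp add: Int_commute)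
  also have "\<dots> = ?E \<inter> {u. F b u - F a u < 0}"
  proof -
    have "(\<forall>z\<in>stiefel. invertible (tcomp x z) \<longrightarrow> graph_coord x z = u \<longrightarrow> orbit z \<in> ?V) \<longleftrightarrow> F b u - F a u < 0"
      if u: "tcomp x u = 0" for u
    proof -
      obtain z where z: "z \<in> stiefel" "invertible (tcomp x z)" "graph_coord x z = u"
        using graph_coord_surj[OF x u] by metis
      have "orbit w \<in> ?V \<longleftrightarrow> F b u - F a u < 0"
        if "w \<in> stiefel" "invertible (tcomp x w)" "graph_coord x w = u" for w
        unfolding V[OF that(1)] using F[OF that, of a] F[OF that, of b]
        by (metis diff_less_0_iff_less norm_ge_zero power2_less_imp_less power_strict_mono zero_less_numeral)
      then show ?thesis using z by blast
    qed
    then show ?thesis by blast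
  qed
  finally have eq: "chart_map C ` (?V \<inter> chart_dom C) = ?E \<inter> (\<lambda>u. F b u - F a u) -` {..<0}"
    by (simp add: vimage_def)
  have G: "continuous_on ?E (gram_inv :: 'h^'p \<Rightarrow> _)"
    by (rule continuous_on_subset[OF smooth_fun_continuous_on[OF smooth_fun_gram_inv]])
       (use invertible_gram[OF x] in auto)
  have "continuous_on ?E (\<lambda>u. F b u - F a u)"
    unfolding F_def
    by (intro continuous_on_diff bounded_linear.continuous_on[OF bounded_linear_trace] matrix_mult.continuous_on
        tcomp.continuous_on continuous_on_add continuous_on_const continuous_on_id G)
  from continuous_openin_preimage_gen[OF this open_lessThan]
  show "openin (top_of_set (chart_space C)) (chart_map C ` (?V \<inter> chart_dom C))"
    unfolding eq by (simp add: C)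
qed

section \<open>The manifold axioms, the metric and the submersion\<close>

lemma hilbert_manifold_grassmann:
  "hilbert_manifold (grassmann :: (('h::{real_inner,complete_space} ^ 'p) set, 'h ^ 'p) riem_structure)"
  unfolding hilbert_manifold_def
proof (intro conjI ballI impI)
  let ?M = "grassmann :: (('h ^ 'p) set, 'h ^ 'p) riem_structure"
  show "points ?M = (\<Union>C\<in>atlas ?M. chart_dom C)"
  proof (intro equalityI subsetI)
    fix m assume "m \<in> points ?M"
    then obtain z where z: "z \<in> stiefel" "m = orbit z" by auto
    moreover have "invertible (tcomp z z)" using z by (auto simp: stiefel_tcomp invertible_def intro!: exI[of _ "mat 1"])
    ultimately show "m \<in> (\<Union>C\<in>atlas ?M. chart_dom C)" by (auto simp: orbit_in_chart_dom)
  qed (auto elim: chart_domE)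
next
  fix C :: "(('h ^ 'p) set, 'h ^ 'p) riem_chart"
  assume "C \<in> atlas grassmann"
  then obtain x :: "'h^'p" where x: "x \<in> stiefel" and C: "C = grassmann_chart x" by auto
  show "subspace (chart_space C)"
    by (auto simp: C subspace_def tcomp.add_right tcomp.scaleR_right tcomp.zero_right)
  have "continuous_on UNIV (tcomp x)" by (rule linear_continuous_on[OF tcomp.bounded_linear_right])
  from continuous_closed_vimage[OF closed_singleton[of 0], of "tcomp x"] this
  show "closed (chart_space C)" by (simp add: C vimage_def continuous_on_eq_continuous_at)
  show "inj_on (chart_map C) (chart_dom C)" unfolding C by (rule inj_on_chart_map)
  show "openin (top_of_set (chart_space C)) (chart_range C)" by (simp add: C chart_range_grassmann[OF x])
  fix C' :: "(('h ^ 'p) set, 'h ^ 'p) riem_chart"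
  assume "C' \<in> atlas grassmann"
  then obtain x' :: "'h^'p" where x': "x' \<in> stiefel" and C': "C' = grassmann_chart x'" by auto
  show "\<exists>f. linear f \<and> f ` chart_space C = chart_space C' \<and> (\<forall>v\<in>chart_space C. norm (f v) = norm v)"
    using chart_space_isometry[OF x x'] by (simp add: C C')
  show "openin (top_of_set (chart_space C)) (chart_map C ` (chart_dom C \<inter> chart_dom C'))"
    using openin_open_Int[OF open_transition_dom] by (simp add: C C' chart_overlap[OF x])
  show "smooth_on (chart_space C) (chart_map C ` (chart_dom C \<inter> chart_dom C')) (transition C C')"
    using smooth_on_transition[OF x] by (simp add: C C' chart_overlap[OF x])
next
  fix m m' :: "('h ^ 'p) set"
  assume "m \<in> points grassmann" "m' \<in> points grassmann" and ne: "m \<noteq> m'"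
  then obtain a b :: "'h^'p" where a: "a \<in> stiefel" "m = orbit a" and b: "b \<in> stiefel" "m' = orbit b" by auto
  have sym: "norm (tcomp b a) = norm (tcomp a b)" by (metis norm_transpose transpose_tcomp)
  let ?V = "\<lambda>a b. {orbit z |z. z \<in> (stiefel :: ('h^'p) set) \<and> norm (tcomp b z) < norm (tcomp a z)}"
  have "m \<in> ?V a b" using norm_tcomp_less[OF a(1) b(1)] ne a b sym by auto
  moreover have "m' \<in> ?V b a" using norm_tcomp_less[OF b(1) a(1)] ne a b sym by auto
  moreover have "?V a b \<inter> ?V b a = {}"
  proof (rule equals0I)
    fix n assume "n \<in> ?V a b \<inter> ?V b a"
    then obtain z w where "orbit z = orbit w" "norm (tcomp b z) < norm (tcomp a z)" "norm (tcomp a w) < norm (tcomp b w)"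
      by blast
    then show False using norm_tcomp_orbit[of z w a] norm_tcomp_orbit[of z w b] by linarith
  qed
  ultimately show "\<exists>V W. manifold_open grassmann V \<and> manifold_open grassmann W \<and> m \<in> V \<and> m' \<in> W \<and> V \<inter> W = {}"
    using manifold_open_overlap by blast
qed

lemma riemannian_hilbert_manifold_grassmann:
  "riemannian_hilbert_manifold (grassmann :: (('h::{real_inner,complete_space} ^ 'p) set, 'h ^ 'p) riem_structure)"
  unfolding riemannian_hilbert_manifold_def
proof (intro conjI ballI hilbert_manifold_grassmann)
  fix C :: "(('h ^ 'p) set, 'h ^ 'p) riem_chart"
  assume "C \<in> atlas grassmann"
  then obtain x :: "'h^'p" where x: "x \<in> stiefel" and C: "C = grassmann_chart x" by auto
  note range = chart_range_grassmann[OF x]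
  show "smooth_multilinear_on (chart_space C) (chart_range C) 2 (\<lambda>u vs. chart_metric C u (vs ! 0) (vs ! 1))"
    by (rule smooth_multilinear_onI[OF smooth_multi_metric_form])
       (auto simp: C range invertible_gram[OF x] numeral_2_eq_2 length_Suc_conv grassmann_metric_eq[OF x])
  fix u assume "u \<in> chart_range C"
  then have u: "tcomp x u = 0" by (simp add: C range)
  obtain z where z: "z \<in> stiefel" "invertible (tcomp x z)" "graph_coord x z = u"
    using graph_coord_surj[OF x u] by metis
  let ?L = "horizontal_lift x z"
  have g: "chart_metric C u v w = ?L v \<bullet> ?L w" if "v \<in> chart_space C" "w \<in> chart_space C" for v w
    using that inner_horizontal_lift[OF x z(1,2)] by (simp add: C grassmann_metric_eq[OF x u] z(3))
  obtain K where K: "K > 0" "\<And>v. norm (?L v) \<le> norm v * K"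
    using bounded_linear.pos_bounded[OF bounded_linear_horizontal_lift] by blast
  obtain K' where K': "K' > 0" "\<And>\<xi>. norm (graph_deriv x z \<xi>) \<le> norm \<xi> * K'"
    using bounded_linear.pos_bounded[OF bounded_linear_graph_deriv[OF z(2)]] by blast
  \<comment> \<open>The upper bound is boundedness of the horizontal lift, the lower one boundedness
    of \<open>graph_deriv\<close>, which recovers \<open>v\<close> from its lift.\<close>
  have "1 / K'\<^sup>2 * (norm v)\<^sup>2 \<le> chart_metric C u v v \<and> chart_metric C u v v \<le> K\<^sup>2 * (norm v)\<^sup>2"
    if v: "v \<in> chart_space C" for v
  proof -
    have "norm v \<le> norm (?L v) * K'"
      using K'(2)[of "?L v"] v graph_deriv_horizontal_lift[OF z(2)] by (simp add: C)
    then have "(norm v)\<^sup>2 \<le> (norm (?L v) * K')\<^sup>2" by (intro power_mono) auto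
    moreover have "(norm (?L v))\<^sup>2 \<le> (norm v * K)\<^sup>2" using K by (intro power_mono) auto
    ultimately show ?thesis
      using K'(1) by (simp add: g[OF v v] power2_norm_eq_inner[symmetric] power_mult_distrib divide_le_eq mult.commute)
  qed
  then show "\<exists>a>0. \<exists>b. \<forall>v\<in>chart_space C. a * (norm v)\<^sup>2 \<le> chart_metric C u v v \<and> chart_metric C u v v \<le> b * (norm v)\<^sup>2"
    using K'(1) by (intro exI[of _ "1 / K'\<^sup>2"] conjI exI[of _ "K\<^sup>2"]) auto
  fix v w assume "v \<in> chart_space C" "w \<in> chart_space C"
  then show "chart_metric C u v w = chart_metric C u w v" using g by (simp add: inner_commute)
next
  fix C C' :: "(('h ^ 'p) set, 'h ^ 'p) riem_chart" and m v w
  assume "C \<in> atlas grassmann" "C' \<in> atlas grassmann"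
  then obtain x x' :: "'h^'p" where x: "x \<in> stiefel" and C: "C = grassmann_chart x"
    and x': "x' \<in> stiefel" and C': "C' = grassmann_chart x'" by auto
  assume m: "m \<in> chart_dom C \<inter> chart_dom C'" and "v \<in> chart_space C" "w \<in> chart_space C"
  then have v: "tcomp x v = 0" "tcomp x w = 0" by (auto simp: C)
  obtain z where z: "z \<in> stiefel" "invertible (tcomp x z)" "m = orbit z" using m unfolding C by (metis IntD1 chart_domE)
  have i': "invertible (tcomp x' z)" using m z by (simp add: C' orbit_in_chart_dom)
  have "graph_coord x z \<in> chart_map C ` (chart_dom C \<inter> chart_dom C')"
    using m z by (intro image_eqI[of _ _ m]) (auto simp: C chart_map_orbit)
  then have "invertible (tcomp x' (x + graph_coord x z))" by (simp add: C C' chart_overlap[OF x])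
  then show "chart_metric C (chart_map C m) v w =
          chart_metric C' (chart_map C' m)
            (dir_deriv (transition C C') (chart_map C m) v)
            (dir_deriv (transition C C') (chart_map C m) w)"
    using metric_compatible[OF x x' z(1,2) i' v] dir_deriv_transition[OF x tcomp_graph_coord[OF x z(2)]] v z(2) i'
    by (simp add: C C' z(3) chart_map_orbit)
qed

text \<open>The formula for \<open>graph_coord x\<close> makes sense for all tuples \<open>z\<close>
  with \<open>tcomp x z\<close> invertible, an open set of the ambient space, and so serves as the
  required smooth extension.\<close>

lemma riemannian_submersion_grassmann:
  "riemannian_submersion_on stiefel (grassmann :: (('h::{real_inner,complete_space} ^ 'p) set, 'h ^ 'p) riem_structure) orbit"
  unfolding riemannian_submersion_on_def
proof (intro conjI ballI impI)
  fix z :: "'h^'p" and C :: "(('h ^ 'p) set, 'h ^ 'p) riem_chart"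
  assume z: "z \<in> stiefel" and "C \<in> atlas grassmann" and d: "orbit z \<in> chart_dom C"
  then obtain x :: "'h^'p" where x: "x \<in> stiefel" and C: "C = grassmann_chart x" by auto
  have i: "invertible (tcomp x z)" using d z by (simp add: C orbit_in_chart_dom)
  let ?Q = "{z. invertible (tcomp x z)}"
  have "smooth_on UNIV ?Q (graph_coord x)"
    unfolding smooth_on_def
  proof (rule smooth_multilinear_onI)
    show "smooth_fun ?Q (graph_coord x)"
      by (rule smooth_fun_graph_coord[OF smooth_fun_linear[OF open_invertible_tcomp bounded_linear_ident]]) simp
  qed auto
  moreover have "graph_deriv x z ` tangent_space stiefel z = {y. tcomp x y = 0}"
  proof (intro equalityI subsetI)
    fix v assume v: "v \<in> {y. tcomp x y = 0}"
    have h: "tcomp z (horizontal_lift x z v) = 0" by (rule tcomp_horizontal_lift[OF z])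
    then have "tcomp (horizontal_lift x z v) z = 0"
      using transpose_tcomp[of z "horizontal_lift x z v"] by (simp add: transpose_def vec_eq_iff)
    then have "horizontal_lift x z v \<in> tangent_space stiefel z" using h by (simp add: tangent_space_stiefel[OF z])
    moreover have "v = graph_deriv x z (horizontal_lift x z v)" using v graph_deriv_horizontal_lift[OF i] by simp
    ultimately show "v \<in> graph_deriv x z ` tangent_space stiefel z" by blast
  qed (auto simp: tcomp_graph_deriv[OF i])
  ultimately show "\<exists>Q G. open Q \<and> z \<in> Q \<and> orbit ` (stiefel \<inter> Q) \<subseteq> chart_dom C \<and>
           smooth_on UNIV Q G \<and> (\<forall>z\<in>stiefel \<inter> Q. G z = chart_map C (orbit z)) \<and>
           dir_deriv G z ` tangent_space stiefel z = chart_space C \<and>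
           (\<forall>\<xi>\<in>horizontal_space stiefel z (dir_deriv G z). \<forall>\<eta>\<in>horizontal_space stiefel z (dir_deriv G z).
              chart_metric C (chart_map C (orbit z)) (dir_deriv G z \<xi>) (dir_deriv G z \<eta>) = \<xi> \<bullet> \<eta>)"
    using i
    by (intro exI[of _ ?Q] exI[of _ "graph_coord x"])
       (auto simp: C open_invertible_tcomp orbit_in_chart_dom chart_map_orbit dir_deriv_graph_coord
         horizontal_space_stiefel[OF z i] grassmann_metric_graph_deriv[OF x z i])
qed auto

section \<open>Principal frames and geodesics\<close>

text \<open>For a change of frame written column by column it suffices to see that the new columns
  are orthonormal; orthogonality of the coefficient matrix \<open>T\<close> follows.\<close>

lemma orbit_frame_change:
  fixes z :: "'h::real_inner^'p"
  assumes z: "z \<in> stiefel" and w: "(\<chi> l. lin z (c l)) \<in> stiefel"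
  shows "orbit (\<chi> l. lin z (c l)) = orbit z"
proof -
  define T :: "real^'p^'p" where "T = (\<chi> k l. c l $ k)"
  have "column l T = c l" for l by (simp add: T_def column_def vec_eq_iff)
  then have eq: "(\<chi> l. lin z (c l)) = rcomp z T"
    by (simp add: rcomp_def matrix_vector_mult_basis)
  have "transpose T ** T = mat 1"
    using z w unfolding eq by (simp add: stiefel_tcomp tcomp_rcomp_left tcomp_rcomp_right)
  then show ?thesis unfolding eq by (intro orbit_rcomp) (simp add: orthogonal_matrix)
qed

lemma compact_orthogonal: "compact {A :: real^'n^'n. orthogonal_matrix A}"
proof -
  have "bounded {A :: real^'n^'n. orthogonal_matrix A}"
  proof (rule boundedI)
    fix A :: "real^'n^'n" assume "A \<in> {A. orthogonal_matrix A}"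
    then have "transpose A ** A = mat 1" by (simp add: orthogonal_matrix)
    then have "trace (transpose A ** A) = real CARD('n)" by (simp add: trace_def mat_def)
    moreover have "trace (transpose A ** A) = A \<bullet> A"
      by (simp add: trace_def inner_vec_def matrix_matrix_mult_def transpose_def) (rule sum.swap)
    ultimately show "norm A \<le> sqrt (real CARD('n))" by (simp add: norm_eq_sqrt_inner)
  qed
  moreover have "closed {A :: real^'n^'n. orthogonal_matrix A}"
  proof -
    have "continuous_on UNIV (\<lambda>A :: real^'n^'n. transpose A ** A)"
      by (intro matrix_mult.continuous_on continuous_on_id linear_continuous_on
          linear_conv_bounded_linear[THEN iffD1] linearI) (simp_all add: transpose_def vec_eq_iff)
    from closed_vimage[OF closed_singleton[of "mat 1"] this] show ?thesis
      by (simp add: orthogonal_matrix vimage_def)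
  qed
  ultimately show ?thesis by (simp add: compact_eq_bounded_closed)
qed

lemma cos_sin_max_zero:
  assumes "\<And>t::real. cos t * a + sin t * b \<le> a"
  shows "b = 0"
proof (rule DERIV_local_max[of "\<lambda>t. cos t * a + sin t * b" b 0 1])
  show "((\<lambda>t. cos t * a + sin t * b) has_real_derivative b) (at 0)"
    by (auto intro!: derivative_eq_intros)
qed (use assms in auto)

text \<open>Rotating two vectors of a frame against each other cannot increase a maximal weighted
  trace \<open>\<Sum>i. \<mu> i * (z i \<bullet> w i)\<close>; the first-order conditions for both frames force the mixed products to
  vanish because the weights differ.\<close>

lemma weighted_trace_max:
  fixes z w :: "'h::real_inner^'p"
  assumes z: "z \<in> stiefel" and ij: "i \<noteq> j"
    and max: "\<And>z'. z' \<in> stiefel \<Longrightarrow> orbit z' = orbit z \<Longrightarrow>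
      (\<Sum>k\<in>UNIV. \<mu> k * (z' $ k \<bullet> w $ k)) \<le> (\<Sum>k\<in>UNIV. \<mu> k * (z $ k \<bullet> w $ k))"
  shows "\<mu> j * (z $ i \<bullet> w $ j) = \<mu> i * (z $ j \<bullet> w $ i)"
proof -
  let ?S = "\<lambda>z. \<Sum>k\<in>UNIV. \<mu> k * (z $ k \<bullet> w $ k)"
  have "\<mu> j * (z $ i \<bullet> w $ j) - \<mu> i * (z $ j \<bullet> w $ i) = 0"
  proof (rule cos_sin_max_zero)
    fix t :: real
    define c where "c = (\<lambda>l. if l = i then cos t *\<^sub>R axis i 1 - sin t *\<^sub>R axis j 1
      else if l = j then sin t *\<^sub>R axis i 1 + cos t *\<^sub>R axis j 1 else axis l (1::real) :: real^'p)"
    define z' where "z' = (\<chi> l. lin z (c l))"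
    have z': "z' $ l = (if l = i then cos t *\<^sub>R z $ i - sin t *\<^sub>R z $ j
      else if l = j then sin t *\<^sub>R z $ i + cos t *\<^sub>R z $ j else z $ l)" for l
      by (simp add: z'_def c_def linear_diff[OF linear_lin] linear_add[OF linear_lin] linear_scale[OF linear_lin])
    have sc: "sin t * sin t + cos t * cos t = 1" "cos t * cos t + sin t * sin t = 1"
      using sin_cos_squared_add[of t] by (simp_all add: power2_eq_square)
    then have st: "z' \<in> stiefel"
      using z ij by (auto simp: stiefel_iff z' sc inner_add_left inner_add_right inner_diff_left inner_diff_right)
    have "orbit z' = orbit z" using st unfolding z'_def by (rule orbit_frame_change[OF z])
    then have le: "?S z' \<le> ?S z" by (rule max[OF st])
    have split: "?S y = \<mu> i * (y $ i \<bullet> w $ i) + \<mu> j * (y $ j \<bullet> w $ j)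
        + (\<Sum>k\<in>UNIV - {i, j}. \<mu> k * (y $ k \<bullet> w $ k))" for y
      using sum.subset_diff[of "{i, j}" UNIV "\<lambda>k. \<mu> k * (y $ k \<bullet> w $ k)"] ij by simp
    have rest: "(\<Sum>k\<in>UNIV - {i, j}. \<mu> k * (z' $ k \<bullet> w $ k)) = (\<Sum>k\<in>UNIV - {i, j}. \<mu> k * (z $ k \<bullet> w $ k))"
      by (rule sum.cong) (auto simp: z')
    have "\<mu> i * (z' $ i \<bullet> w $ i) + \<mu> j * (z' $ j \<bullet> w $ j) \<le> \<mu> i * (z $ i \<bullet> w $ i) + \<mu> j * (z $ j \<bullet> w $ j)"
      using le split[of z'] split[of z] rest by linarith
    then show "cos t * (\<mu> i * (z $ i \<bullet> w $ i) + \<mu> j * (z $ j \<bullet> w $ j))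
        + sin t * (\<mu> j * (z $ i \<bullet> w $ j) - \<mu> i * (z $ j \<bullet> w $ i)) \<le> \<mu> i * (z $ i \<bullet> w $ i) + \<mu> j * (z $ j \<bullet> w $ j)"
      using ij by (simp add: z' inner_add_left inner_diff_left algebra_simps)
  qed
  then show ?thesis by simp
qed

text \<open>For orthonormal frames the numbers \<open>z $ i \<bullet> w $ i\<close> are the cosines
  of the principal angles, and finding such frames is a singular value decomposition of the matrix
  of mixed inner products.\<close>

definition principal_pair :: "'h::real_inner^'p \<Rightarrow> 'h^'p \<Rightarrow> bool" where
  "principal_pair z w \<longleftrightarrow> (\<forall>i j. i \<noteq> j \<longrightarrow> z $ i \<bullet> w $ j = 0) \<and> (\<forall>i. 0 \<le> z $ i \<bullet> w $ i)"

text \<open>Compactness of O(p) x O(p) provides a maximum of the weighted trace over all pairs of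
  frames of the two subspaces. The weights are distinct and positive: distinctness makes the mixed
  products vanish, positivity gives the sign of the diagonal.\<close>

lemma principal_frames:
  fixes a b :: "'h::real_inner^'p"
  assumes a: "a \<in> stiefel" and b: "b \<in> stiefel"
  obtains z w where "z \<in> stiefel" "orbit z = orbit a" "w \<in> stiefel" "orbit w = orbit b" "principal_pair z w"
proof -
  obtain f :: "'p \<Rightarrow> nat" where f: "inj f"
    using finite_imp_inj_to_nat_seg[of "UNIV :: 'p set"] by auto
  define \<mu> where "\<mu> = (\<lambda>i. real (Suc (f i)))"
  have \<mu>: "\<mu> i > 0" "i \<noteq> j \<Longrightarrow> \<mu> i \<noteq> \<mu> j" for i j using f by (auto simp: \<mu>_def dest: injD)
  let ?O = "{A :: real^'p^'p. orthogonal_matrix A}"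
  let ?S = "\<lambda>z w :: 'h^'p. \<Sum>k\<in>UNIV. \<mu> k * (z $ k \<bullet> w $ k)"
  have "continuous_on (?O \<times> ?O) (\<lambda>P. ?S (rcomp a (fst P)) (rcomp b (snd P)))"
    by (intro continuous_intros bounded_linear.continuous_on[OF rcomp.bounded_linear_right])
  moreover have "(mat 1, mat 1) \<in> ?O \<times> ?O" by (simp add: orthogonal_matrix_id)
  ultimately obtain P where P: "P \<in> ?O \<times> ?O"
    "\<And>P'. P' \<in> ?O \<times> ?O \<Longrightarrow> ?S (rcomp a (fst P')) (rcomp b (snd P')) \<le> ?S (rcomp a (fst P)) (rcomp b (snd P))"
    using continuous_attains_sup[OF compact_Times[OF compact_orthogonal compact_orthogonal]] by blast
  define z w where "z = rcomp a (fst P)" and "w = rcomp b (snd P)"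
  have PO: "orthogonal_matrix (fst P)" "orthogonal_matrix (snd P)" using P(1) by auto
  have zs: "z \<in> stiefel" "orbit z = orbit a" "w \<in> stiefel" "orbit w = orbit b"
    using PO a b by (auto simp: z_def w_def rcomp_stiefel orbit_rcomp)
  have max: "?S z' w' \<le> ?S z w" if "orbit z' = orbit z" "orbit w' = orbit w" for z' w'
  proof -
    have o: "orbit z' = orbit a" "orbit w' = orbit b" using that zs by auto
    obtain A where A: "orthogonal_matrix A" "z' = rcomp a A" using o(1) by (rule orbit_eqE)
    obtain B where B: "orthogonal_matrix B" "w' = rcomp b B" using o(2) by (rule orbit_eqE)
    show ?thesis using P(2)[of "(A, B)"] A B by (simp add: z_def w_def)
  qed
  have "z $ i \<bullet> w $ j = 0" if ij: "i \<noteq> j" for i j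
  proof -
    have 1: "\<mu> j * (z $ i \<bullet> w $ j) = \<mu> i * (z $ j \<bullet> w $ i)"
      by (rule weighted_trace_max[OF zs(1) ij]) (rule max[OF _ refl])
    have "\<mu> j * (w $ i \<bullet> z $ j) = \<mu> i * (w $ j \<bullet> z $ i)"
    proof (rule weighted_trace_max[OF zs(3) ij])
      fix w' assume "orbit w' = orbit w"
      then have "?S z w' \<le> ?S z w" by (rule max[OF refl])
      then show "(\<Sum>k\<in>UNIV. \<mu> k * (w' $ k \<bullet> z $ k)) \<le> (\<Sum>k\<in>UNIV. \<mu> k * (w $ k \<bullet> z $ k))"
        by (simp add: inner_commute)
    qed
    then have 2: "\<mu> j * (z $ j \<bullet> w $ i) = \<mu> i * (z $ i \<bullet> w $ j)" by (simp add: inner_commute)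
    \<comment> \<open>Combining the two first-order conditions crosswise eliminates
      \<open>z $ j \<bullet> w $ i\<close>.\<close>
    have "\<mu> j * \<mu> j * (z $ i \<bullet> w $ j) = \<mu> i * \<mu> i * (z $ i \<bullet> w $ j)"
      using arg_cong[OF 1, of "(*) (\<mu> j)"] arg_cong[OF 2, of "(*) (\<mu> i)"] by (simp add: algebra_simps)
    then have "(\<mu> j * \<mu> j - \<mu> i * \<mu> i) * (z $ i \<bullet> w $ j) = 0" by (simp add: algebra_simps)
    moreover have "\<mu> j * \<mu> j - \<mu> i * \<mu> i \<noteq> 0"
    proof -
      have "\<mu> j * \<mu> j - \<mu> i * \<mu> i = (\<mu> j - \<mu> i) * (\<mu> j + \<mu> i)" by (simp add: algebra_simps)
      then show ?thesis using \<mu>(1)[of i] \<mu>(1)[of j] \<mu>(2)[OF ij] by auto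
    qed
    ultimately show ?thesis by simp
  qed
  moreover have "0 \<le> z $ i \<bullet> w $ i" for i
  proof -
    \<comment> \<open>Replacing one column by its negative stays in the orbit and changes the sign
      of just one summand.\<close>
    define z' where "z' = (\<chi> l. lin z (if l = i then - axis i 1 else axis l 1))"
    have z': "z' $ l = (if l = i then - z $ i else z $ l)" for l
      by (simp add: z'_def linear_neg[OF linear_lin])
    have "z' \<in> stiefel" using zs(1) by (auto simp: stiefel_iff z')
    then have "orbit z' = orbit z" unfolding z'_def by (rule orbit_frame_change[OF zs(1)])
    then have le: "?S z' w \<le> ?S z w" by (rule max[OF _ refl])
    have split: "?S y w = \<mu> i * (y $ i \<bullet> w $ i) + (\<Sum>k\<in>UNIV - {i}. \<mu> k * (y $ k \<bullet> w $ k))" for y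
      by (simp add: sum.remove)
    have rest: "(\<Sum>k\<in>UNIV - {i}. \<mu> k * (z' $ k \<bullet> w $ k)) = (\<Sum>k\<in>UNIV - {i}. \<mu> k * (z $ k \<bullet> w $ k))"
      by (rule sum.cong) (auto simp: z')
    have "\<mu> i * (z' $ i \<bullet> w $ i) \<le> \<mu> i * (z $ i \<bullet> w $ i)"
      using le split[of z'] split[of z] rest by linarith
    then have "0 \<le> \<mu> i * (z $ i \<bullet> w $ i)" by (simp add: z')
    then show ?thesis using \<mu>(1)[of i] by (simp add: zero_le_mult_iff)
  qed
  ultimately have "principal_pair z w" by (simp add: principal_pair_def)
  with zs show ?thesis by (rule that)
qed

text \<open>In the application \<open>e $ i\<close> is a quotient by \<open>sin (\<theta> $ i)\<close>, hence zero rather than a unit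
  vector if the angle vanishes.\<close>

locale frame_rotation =
  fixes z e :: "'h::{real_inner,complete_space}^'p" and \<theta> :: "real^'p"
  assumes z: "z \<in> stiefel" and ze: "z $ i \<bullet> e $ j = 0" and ee: "i \<noteq> j \<Longrightarrow> e $ i \<bullet> e $ j = 0"
    and e1: "\<theta> $ i \<noteq> 0 \<Longrightarrow> e $ i \<bullet> e $ i = 1"
begin

definition frame :: "real \<Rightarrow> 'h^'p" where
  "frame s = (\<chi> i. cos (s * \<theta> $ i) *\<^sub>R z $ i + sin (s * \<theta> $ i) *\<^sub>R e $ i)"

definition normal :: "real \<Rightarrow> 'h^'p" where
  "normal s = (\<chi> i. cos (s * \<theta> $ i) *\<^sub>R e $ i - sin (s * \<theta> $ i) *\<^sub>R z $ i)"

lemma inner_frame: "frame s $ i \<bullet> frame t $ j = (if i = j then cos ((s - t) * \<theta> $ i) else 0)"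
proof (cases "i = j")
  case True
  have "z $ i \<bullet> z $ i = 1" using z by (simp add: stiefel_iff)
  moreover have "sin (s * \<theta> $ i) * (sin (t * \<theta> $ i) * (e $ i \<bullet> e $ i)) = sin (s * \<theta> $ i) * sin (t * \<theta> $ i)"
    using e1[of i] by (cases "\<theta> $ i = 0") auto
  ultimately show ?thesis
    using True ze by (auto simp: frame_def inner_add_left inner_add_right inner_commute[of "e $ _" "z $ _"] cos_diff left_diff_distrib)
next
  case False
  then show ?thesis
    using z ze ee by (simp add: frame_def inner_add_left inner_add_right inner_commute[of "e $ _" "z $ _"] stiefel_iff)
qed

lemma frame_stiefel: "frame s \<in> stiefel"
  by (auto simp: stiefel_iff inner_frame)

text \<open>Seen from time \<open>t\<close> the motion is again a rotation of the same kind, with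
  \<open>normal t\<close> in the place of \<open>e\<close>. Computations at time \<open>t\<close>
  can therefore be done in the chart centred at \<open>frame t\<close>.\<close>

lemma frame_add: "frame s $ i = cos ((s - t) * \<theta> $ i) *\<^sub>R frame t $ i + sin ((s - t) * \<theta> $ i) *\<^sub>R normal t $ i"
proof -
  have s: "s * \<theta> $ i = (s - t) * \<theta> $ i + t * \<theta> $ i" by (simp add: algebra_simps)
  have "cos (s * \<theta> $ i) = cos ((s - t) * \<theta> $ i) * cos (t * \<theta> $ i) - sin ((s - t) * \<theta> $ i) * sin (t * \<theta> $ i)"
    by (subst s) (rule cos_add)
  moreover have "sin (s * \<theta> $ i) = sin ((s - t) * \<theta> $ i) * cos (t * \<theta> $ i) + cos ((s - t) * \<theta> $ i) * sin (t * \<theta> $ i)"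
    by (subst s) (rule sin_add)
  ultimately show ?thesis
    by (simp add: frame_def normal_def scaleR_add_left scaleR_diff_left scaleR_add_right scaleR_diff_right)
qed

lemma inner_frame_normal: "\<theta> $ j *\<^sub>R (frame s $ i \<bullet> normal s $ j) = 0"
proof (cases "i = j")
  case True
  then show ?thesis
    using z ze e1[of i] by (cases "\<theta> $ i = 0")
      (auto simp: frame_def normal_def inner_add_left inner_diff_right inner_commute[of "e $ _" "z $ _"] stiefel_iff)
next
  case False
  then show ?thesis
    using z ze ee by (simp add: frame_def normal_def inner_add_left inner_diff_right inner_commute[of "e $ _" "z $ _"] stiefel_iff)
qed

lemma norm_normal: "\<theta> $ i \<noteq> 0 \<Longrightarrow> normal s $ i \<bullet> normal s $ i = 1"
  using z ze e1[of i] sin_cos_squared_add[of "s * \<theta> $ i"]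
  by (simp add: normal_def inner_diff_left inner_diff_right inner_commute[of "e $ _" "z $ _"] stiefel_iff power2_eq_square)

definition velocity :: "real \<Rightarrow> 'h^'p" where
  "velocity s = (\<chi> i. \<theta> $ i *\<^sub>R normal s $ i)"

lemma tcomp_velocity: "tcomp (frame s) (velocity s) = 0"
  using inner_frame_normal by (simp add: vec_eq_iff tcomp_nth velocity_def)

lemma norm_velocity: "norm (velocity s) = norm \<theta>"
proof -
  have "velocity s $ i \<bullet> velocity s $ i = \<theta> $ i * \<theta> $ i" for i
    using norm_normal[of i s] by (cases "\<theta> $ i = 0") (simp_all add: velocity_def)
  then show ?thesis by (simp add: norm_eq_sqrt_inner inner_vec_def)
qed

lemma has_vector_derivative_frame: "(frame has_vector_derivative velocity s) (at s within T)"
proof (rule has_vector_derivative_vecI)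
  fix i
  have "((\<lambda>s. cos (s * \<theta> $ i) *\<^sub>R z $ i + sin (s * \<theta> $ i) *\<^sub>R e $ i) has_vector_derivative
      (- (\<theta> $ i * sin (s * \<theta> $ i))) *\<^sub>R z $ i + (\<theta> $ i * cos (s * \<theta> $ i)) *\<^sub>R e $ i) (at s within T)"
    by (intro has_vector_derivative_add has_vector_derivative_scaleR[where g' = 0, simplified] has_vector_derivative_const)
       (auto intro!: derivative_eq_intros)
  then show "((\<lambda>s. frame s $ i) has_vector_derivative velocity s $ i) (at s within T)"
    by (simp add: frame_def velocity_def normal_def algebra_simps)
qed

text \<open>Chosen so that all rotation angles counted from any time \<open>t\<close> stay below pi
  / 2 in absolute value; adding 1 to the norm admits \<theta> = 0.\<close>

definition radius :: real where "radius = pi / 2 / (1 + norm \<theta>)"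

lemma radius_pos: "radius > 0"
  by (simp add: radius_def add_pos_nonneg)

lemma cos_nonzero:
  assumes "\<bar>s - t\<bar> < radius"
  shows "cos ((s - t) * \<theta> $ i) \<noteq> 0"
proof -
  have "\<bar>\<theta> $ i\<bar> \<le> norm \<theta>" using Finite_Cartesian_Product.norm_nth_le[of \<theta> i] by simp
  then have "\<bar>(s - t) * \<theta> $ i\<bar> \<le> \<bar>s - t\<bar> * (1 + norm \<theta>)" by (simp add: abs_mult mult_left_mono)
  also have "\<dots> < pi / 2"
    using assms pos_less_divide_eq[of "1 + norm \<theta>" "\<bar>s - t\<bar>" "pi / 2"]
    unfolding radius_def by (meson add_pos_nonneg norm_ge_zero zero_less_one)
  finally have "cos ((s - t) * \<theta> $ i) > 0" by (intro cos_gt_zero_pi) auto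
  then show ?thesis by simp
qed

text \<open>The matrix of mixed inner products is diagonal with the cosines as entries; dividing the
  columns of \<open>frame s\<close> by them normalises the component along \<open>frame t\<close> to
  1, and what remains is a tangent times the normal vector.\<close>

lemma graph_coord_frame:
  assumes "\<bar>s - t\<bar> < radius"
  shows "invertible (tcomp (frame t) (frame s))"
    "graph_coord (frame t) (frame s) = (\<chi> i. tan ((s - t) * \<theta> $ i) *\<^sub>R normal t $ i)"
proof -
  define D where "D = (\<chi> i j. if i = j then inverse (cos ((s - t) * \<theta> $ i)) else 0 :: real^'p^'p)"
  have sym: "cos ((t - s) * r) = cos ((s - t) * r)" for r
    using cos_minus[of "(s - t) * r"] by (simp add: algebra_simps)
  have T: "tcomp (frame t) (frame s) = (\<chi> i j. if i = j then cos ((s - t) * \<theta> $ i) else 0)"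
    by (auto simp: vec_eq_iff tcomp_nth inner_frame sym)
  have DT: "tcomp (frame t) (frame s) ** D = mat 1"
  proof -
    have "(tcomp (frame t) (frame s) ** D) $ i $ j
        = (\<Sum>k\<in>UNIV. if k = i then cos ((s - t) * \<theta> $ i) * D $ i $ j else 0)" for i j
      unfolding matrix_matrix_mult_def T vec_lambda_beta by (rule sum.cong) auto
    then show ?thesis
      using cos_nonzero[OF assms] by (simp add: vec_eq_iff mat_def D_def)
  qed
  then show "invertible (tcomp (frame t) (frame s))" by (auto simp: invertible_right_inverse)
  have "graph_coord (frame t) (frame s) $ i = inverse (cos ((s - t) * \<theta> $ i)) *\<^sub>R frame s $ i - frame t $ i" for i
    unfolding graph_coord_def matrix_inv_unique[OF DT]
    by (simp add: rcomp_nth D_def if_distrib[of "\<lambda>x. x *\<^sub>R _"] cong: if_cong)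
  also have "\<dots> i = tan ((s - t) * \<theta> $ i) *\<^sub>R normal t $ i" for i
    using cos_nonzero[OF assms, of i] by (subst frame_add[of s i t]) (simp add: scaleR_add_right tan_def divide_inverse mult.commute)
  finally show "graph_coord (frame t) (frame s) = (\<chi> i. tan ((s - t) * \<theta> $ i) *\<^sub>R normal t $ i)"
    by (simp add: vec_eq_iff)
qed

definition curve :: "real \<Rightarrow> ('h^'p) set" where "curve s = orbit (frame s)"

definition coord_velocity :: "real \<Rightarrow> real \<Rightarrow> 'h^'p" where
  "coord_velocity t s = (\<chi> i. (\<theta> $ i * inverse ((cos ((s - t) * \<theta> $ i))\<^sup>2)) *\<^sub>R normal t $ i)"

lemma curve_in_chart:
  assumes "\<bar>s - t\<bar> < radius"
  shows "curve s \<in> chart_dom (grassmann_chart (frame t))"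
    "chart_map (grassmann_chart (frame t)) (curve s) = (\<chi> i. tan ((s - t) * \<theta> $ i) *\<^sub>R normal t $ i)"
  using graph_coord_frame[OF assms] by (simp_all add: curve_def orbit_in_chart_dom frame_stiefel chart_map_orbit)

lemma has_vector_derivative_curve:
  assumes st: "\<bar>s - t\<bar> < radius"
  shows "((chart_map (grassmann_chart (frame t)) \<circ> curve) has_vector_derivative coord_velocity t s) (at s within T)"
proof -
  have "((\<lambda>s. \<chi> i. tan ((s - t) * \<theta> $ i) *\<^sub>R normal t $ i) has_vector_derivative coord_velocity t s) (at s)"
  proof (rule has_vector_derivative_vecI)
    fix i
    have "((\<lambda>s. tan ((s - t) * \<theta> $ i)) has_real_derivative \<theta> $ i * inverse ((cos ((s - t) * \<theta> $ i))\<^sup>2)) (at s)"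
      using cos_nonzero[OF st, of i] by (auto intro!: derivative_eq_intros)
    then show "((\<lambda>s. (\<chi> i. tan ((s - t) * \<theta> $ i) *\<^sub>R normal t $ i) $ i) has_vector_derivative coord_velocity t s $ i) (at s)"
      by (auto simp: coord_velocity_def intro!: has_vector_derivative_scaleR[where g' = 0, simplified])
  qed
  then have "((chart_map (grassmann_chart (frame t)) \<circ> curve) has_vector_derivative coord_velocity t s) (at s)"
    by (rule has_vector_derivative_transform_within_open[of _ _ _ "{t - radius<..<t + radius}"])
       (use st in \<open>auto simp: curve_in_chart\<close>)
  then show ?thesis by (rule has_vector_derivative_at_within)
qed

lemma continuous_on_coord_velocity: "continuous_on {t - radius<..<t + radius} (coord_velocity t)"
  unfolding coord_velocity_def using cos_nonzero[of _ t]
  by (intro continuous_on_vec_lambda continuous_intros) (auto simp: abs_less_iff)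

lemma C1_curve_on_curve: "C1_curve_on grassmann a b curve"
  unfolding C1_curve_on_def
proof
  fix t
  show "\<exists>C\<in>atlas grassmann. \<exists>\<delta>>0. \<exists>v. (\<forall>s\<in>{a..b}. \<bar>s - t\<bar> < \<delta> \<longrightarrow> curve s \<in> chart_dom C \<and>
      ((chart_map C \<circ> curve) has_vector_derivative v s) (at s within {a..b})) \<and>
      continuous_on ({a..b} \<inter> {t - \<delta><..<t + \<delta>}) v"
    using frame_stiefel radius_pos continuous_on_subset[OF continuous_on_coord_velocity[of t], of "{a..b} \<inter> {t - radius<..<t + radius}"]
    by (intro bexI[of _ "grassmann_chart (frame t)"] exI[of _ radius] conjI exI[of _ "coord_velocity t"])
       (auto simp: curve_in_chart has_vector_derivative_curve)
qed

lemma piecewise_C1_curve: "piecewise_C1_curve grassmann curve"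
  unfolding piecewise_C1_curve_def by (intro exI[of _ "{0, 1}"]) (auto simp: C1_curve_on_curve)

text \<open>In the chart centred at \<open>frame t\<close> the curve passes through 0 at time
  \<open>t\<close>, and its second derivative vanishes because that of tan does at 0. What is left
  of the covariant acceleration are first derivatives of the metric at the centre.\<close>

lemma geodesic_curve: "geodesic grassmann curve"
  unfolding geodesic_def
proof
  fix t :: real
  let ?x = "frame t"
  let ?C = "grassmann_chart ?x"
  have "(coord_velocity t has_vector_derivative 0) (at t)"
  proof (rule has_vector_derivative_vecI)
    fix i
    have "((\<lambda>s. \<theta> $ i * inverse ((cos ((s - t) * \<theta> $ i))\<^sup>2)) has_real_derivative 0) (at t)"
      by (auto intro!: derivative_eq_intros)
    then show "((\<lambda>s. coord_velocity t s $ i) has_vector_derivative 0 $ i) (at t)"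
      using has_vector_derivative_scaleR[of _ 0 t UNIV "\<lambda>_. normal t $ i" 0] by (simp add: coord_velocity_def)
  qed
  moreover have "covariant_acceleration ?C (chart_map ?C (curve t)) (coord_velocity t t) 0 w = 0"
    if w: "w \<in> chart_space ?C" for w
  proof -
    note x = frame_stiefel[of t]
    define v where "v = coord_velocity t t"
    have v: "tcomp ?x v = 0" using inner_frame_normal by (simp add: v_def coord_velocity_def vec_eq_iff tcomp_nth)
    have w: "tcomp ?x w = 0" using w by simp
    have u: "chart_map ?C (curve t) = 0" using curve_in_chart(2)[of t t] radius_pos by (simp add: vec_eq_iff)
    have zero: "dir_deriv (\<lambda>u. chart_metric ?C u a b) 0 y = 0"
      if a: "tcomp ?x a = 0" and b: "tcomp ?x b = 0" and y: "tcomp ?x y = 0" for a b y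
    proof -
      have eq: "(\<lambda>s. chart_metric ?C (0 + s *\<^sub>R y) a b) = (\<lambda>s. metric_form (0 + s *\<^sub>R y) a b)"
        using a b y by (simp add: grassmann_metric_eq[OF x] tcomp.scaleR_right)
      obtain d where d: "((\<lambda>s. metric_form (0 + s *\<^sub>R y) a b) has_vector_derivative d) (at 0)"
        using smooth_multi_differentiable_line[OF smooth_multi_metric_form, of 0 "[a, b]" y]
        by (auto simp: tcomp.zero_left intro!: exI[of _ "mat 1"] simp: invertible_def)
      have "((\<lambda>s. metric_form (0 + (- s) *\<^sub>R y) a b) has_vector_derivative - d) (at 0)"
        using vector_diff_chain_at[of uminus "-1" 0 "\<lambda>s. metric_form (0 + s *\<^sub>R y) a b" d] d
        by (simp add: o_def has_vector_derivative_minus has_vector_derivative_id)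
      \<comment> \<open>The coordinate occurs an even number of times in every product, so the signs
        cancel.\<close>
      moreover have even: "metric_form (0 + (- s) *\<^sub>R y) a b = metric_form (0 + s *\<^sub>R y) a b" for s
        by (simp add: metric_form_def gram_inv_def tcomp.minus_left tcomp.minus_right matrix_mult.minus_left matrix_mult.minus_right)
      ultimately have "((\<lambda>s. metric_form (0 + s *\<^sub>R y) a b) has_vector_derivative - d) (at 0)"
        by (simp only: even)
      with d have "d = - d" by (rule vector_derivative_unique_at)
      then have "d = 0" by simp
      then show ?thesis unfolding dir_deriv_def eq using d vector_derivative_at by blast
    qed
    have "chart_metric ?C 0 0 w = 0"
      using w by (simp add: grassmann_metric_eq[OF x] tcomp.zero_right metric_form_def tcomp.zero_left
          matrix_mult.zero_left trace_def)
    then show ?thesis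
      unfolding covariant_acceleration_def u using zero[OF v w v] zero[OF v v w] by (simp add: v_def)
  qed
  ultimately show "\<exists>C\<in>atlas grassmann. \<exists>\<delta>>0. \<exists>v a.
        (\<forall>s\<in>{0..1}. \<bar>s - t\<bar> < \<delta> \<longrightarrow> curve s \<in> chart_dom C \<and>
           ((chart_map C \<circ> curve) has_vector_derivative v s) (at s within {0..1})) \<and>
        (v has_vector_derivative a) (at t within {0..1}) \<and>
        (\<forall>w\<in>chart_space C. covariant_acceleration C (chart_map C (curve t)) (v t) a w = 0)"
    using frame_stiefel radius_pos
    by (intro bexI[of _ ?C] exI[of _ radius] conjI exI[of _ "coord_velocity t"] exI[of _ 0])
       (auto simp: curve_in_chart has_vector_derivative_curve has_vector_derivative_at_within)
qed

end

text \<open>The chart in \<open>speed\<close> is an arbitrary one picked by \<open>SOME\<close>. In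
  it the derivative of the curve is the image of \<zeta> under the chart differential, and the
  metric gives back the norm of the horizontal vector.\<close>

lemma speed_horizontal_lift:
  fixes z :: "real \<Rightarrow> 'h::{real_inner,complete_space}^'p"
  assumes t: "t \<in> {0..1}" and z: "(z has_vector_derivative \<zeta>) (at t within {0..1})"
    and lift: "\<delta> > 0" "\<And>s. s \<in> {0..1} \<Longrightarrow> \<bar>s - t\<bar> < \<delta> \<Longrightarrow> z s \<in> stiefel \<and> \<gamma> s = orbit (z s)"
    and hor: "tcomp (z t) \<zeta> = 0"
  shows "speed grassmann \<gamma> t = norm \<zeta>"
proof -
  define C where "C = (SOME C. C \<in> atlas grassmann \<and> \<gamma> t \<in> chart_dom C)"
  have zt: "z t \<in> stiefel" "\<gamma> t = orbit (z t)" using lift t by auto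
  have "invertible (tcomp (z t) (z t))" using zt by (auto simp: stiefel_tcomp invertible_def intro!: exI[of _ "mat 1"])
  then have "\<exists>C. C \<in> atlas grassmann \<and> \<gamma> t \<in> chart_dom C"
    using zt by (auto simp: orbit_in_chart_dom)
  then have "C \<in> atlas grassmann \<and> \<gamma> t \<in> chart_dom C" unfolding C_def by (rule someI_ex)
  then obtain x where x: "x \<in> stiefel" and C: "C = grassmann_chart x" and i: "invertible (tcomp x (z t))"
    using zt by (auto simp: orbit_in_chart_dom)
  have "(z \<longlongrightarrow> z t) (at t within {0..1})"
    using has_vector_derivative_continuous[OF z] by (simp add: continuous_within)
  then have "\<forall>\<^sub>F s in at t within {0..1}. z s \<in> {y. invertible (tcomp x y)}"
    by (rule topological_tendstoD[OF _ open_invertible_tcomp]) (use i in simp)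
  then obtain d where d: "d > 0" "\<And>s. s \<in> {0..1} \<Longrightarrow> s \<noteq> t \<Longrightarrow> dist s t < d \<Longrightarrow> invertible (tcomp x (z s))"
    unfolding eventually_at by auto
  have "((\<lambda>s. graph_coord x (z s)) has_vector_derivative graph_deriv x (z t) \<zeta>) (at t within {0..1})"
    using has_derivative_compose[OF z[unfolded has_vector_derivative_def] has_derivative_graph_coord[OF i]]
    by (simp add: has_vector_derivative_def linear_scale[OF bounded_linear.linear[OF bounded_linear_graph_deriv[OF i]]])
  then have "((chart_map C \<circ> \<gamma>) has_vector_derivative graph_deriv x (z t) \<zeta>) (at t within {0..1})"
  proof (rule has_vector_derivative_transform_within)
    fix s assume s: "s \<in> {0..1}" "dist s t < min d \<delta>"
    then have "invertible (tcomp x (z s))" using d(2)[of s] i by (cases "s = t") auto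
    then show "graph_coord x (z s) = (chart_map C \<circ> \<gamma>) s"
      using lift(2)[of s] s by (simp add: C chart_map_orbit dist_real_def)
  qed (use d lift t in auto)
  then have "vector_derivative (chart_map C \<circ> \<gamma>) (at t within {0..1}) = graph_deriv x (z t) \<zeta>"
    using vector_derivative_within_cbox[of 0 1 t "chart_map C \<circ> \<gamma>"] t by simp
  then have "speed grassmann \<gamma> t = sqrt (chart_metric C (chart_map C (\<gamma> t)) (graph_deriv x (z t) \<zeta>) (graph_deriv x (z t) \<zeta>))"
    by (simp only: speed_def Let_def C_def[symmetric])
  also have "\<dots> = norm \<zeta>"
    using grassmann_metric_graph_deriv[OF x zt(1) i hor hor] i
    by (simp add: C zt(2) chart_map_orbit norm_eq_sqrt_inner)
  finally show ?thesis .
qed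

lemma (in frame_rotation) curve_length_curve: "curve_length grassmann curve = norm \<theta>"
proof -
  have "speed grassmann curve t = norm \<theta>" if t: "t \<in> {0..1}" for t
    using speed_horizontal_lift[OF t has_vector_derivative_frame zero_less_one _ tcomp_velocity, of curve]
    by (simp add: frame_stiefel curve_def norm_velocity)
  then have "curve_length grassmann curve = integral {0..1::real} (\<lambda>_. norm \<theta>)"
    unfolding curve_length_def by (rule integral_cong)
  then show ?thesis by simp
qed

section \<open>Horizontal lifts and the lower bound for lengths\<close>

text \<open>Banach's fixed point theorem for the integral equation: \<open>K * (d - c) < 1\<close>
  makes the integral operator a contraction on the whole interval, which is enough because lifts are
  only sought on short intervals.\<close>

lemma linear_ode_solution:
  fixes L :: "real \<Rightarrow> 'a::real_normed_vector" and prod :: "'a \<Rightarrow> 'b \<Rightarrow> 'b::banach"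
  assumes bil: "bounded_bilinear prod" and cd: "c \<le> d" and L: "continuous_on {c..d} L"
    and K: "K \<ge> 0" "K * (d - c) < 1" "\<And>s m. s \<in> {c..d} \<Longrightarrow> norm (prod (L s) m) \<le> K * norm m"
  obtains M where "M c = m0"
    "\<And>s. s \<in> {c..d} \<Longrightarrow> (M has_vector_derivative prod (L s) (M s)) (at s within {c..d})"
proof -
  interpret bounded_bilinear prod by (rule bil)
  define J where "J = (\<lambda>f t. m0 + integral {c..t} (\<lambda>s. prod (L s) (f s)))"
  have cont: "continuous_on {c..d} (\<lambda>s. prod (L s) (apply_bcontfun f s))" for f
    by (intro continuous_on L continuous_on_apply_bcontfun)
  have dJ: "(J (apply_bcontfun f) has_vector_derivative prod (L s) (apply_bcontfun f s)) (at s within {c..d})"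
    if "s \<in> {c..d}" for f s
    using has_vector_derivative_add[OF has_vector_derivative_const integral_has_vector_derivative[OF cont that]]
    by (simp add: J_def)
  \<comment> \<open>Clamping the time to the interval extends functions to all reals, so that the
    contraction acts on the complete type of bounded continuous functions.\<close>
  define T where "T = (\<lambda>f. Bcontfun (\<lambda>t. J (apply_bcontfun f) (clamp c d t)))"
  have in_cd: "clamp c d t \<in> {c..d}" for t using clamp_in_interval[of c d t] cd by simp
  have T: "apply_bcontfun (T f) t = J (apply_bcontfun f) (clamp c d t)" for f t
  proof -
    have c: "continuous_on (cbox c d) (J (apply_bcontfun f))"
      unfolding box_real by (rule continuous_on_vector_derivative[OF dJ])
    then have "bounded (J (apply_bcontfun f) ` cbox c d)"
      by (intro compact_imp_bounded compact_continuous_image) auto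
    then have "(\<lambda>t. J (apply_bcontfun f) (clamp c d t)) \<in> bcontfun"
      unfolding bcontfun_def using clamp_continuous_on[OF c] clamp_bounded by blast
    then show ?thesis unfolding T_def by (simp add: Bcontfun_inverse)
  qed
  have "dist (T f) (T g) \<le> K * (d - c) * dist f g" for f g
  proof (rule dist_bound)
    fix t
    let ?t = "clamp c d t"
    have sub: "{c..?t} \<subseteq> {c..d}" using in_cd[of t] by auto
    have int: "(\<lambda>s. prod (L s) (apply_bcontfun h s)) integrable_on {c..?t}" for h
      by (intro integrable_continuous_real continuous_on_subset[OF cont sub])
    have "dist (apply_bcontfun (T f) t) (apply_bcontfun (T g) t)
        = norm (integral {c..?t} (\<lambda>s. prod (L s) (apply_bcontfun f s - apply_bcontfun g s)))"
      using int by (simp add: T J_def dist_norm diff_right integral_diff)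
    also have "\<dots> \<le> (K * dist f g) * (?t - c)"
    proof (rule integral_bound)
      show "continuous_on {c..?t} (\<lambda>s. prod (L s) (apply_bcontfun f s - apply_bcontfun g s))"
        by (intro continuous_on continuous_on_subset[OF L sub] continuous_on_diff continuous_on_apply_bcontfun)
      fix s assume "s \<in> {c..?t}"
      then have "norm (prod (L s) (apply_bcontfun f s - apply_bcontfun g s)) \<le> K * norm (apply_bcontfun f s - apply_bcontfun g s)"
        using sub by (intro K) auto
      also have "\<dots> \<le> K * dist f g" using K(1) dist_bounded[of f s g] by (intro mult_left_mono) (auto simp: dist_norm)
      finally show "norm (prod (L s) (apply_bcontfun f s - apply_bcontfun g s)) \<le> K * dist f g" .
    qed (use in_cd[of t] in auto)
    also have "\<dots> \<le> (K * dist f g) * (d - c)"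
      using in_cd[of t] K(1) by (intro mult_left_mono) auto
    finally show "dist (apply_bcontfun (T f) t) (apply_bcontfun (T g) t) \<le> K * (d - c) * dist f g"
      by (simp add: ac_simps)
  qed
  then obtain f where f: "T f = f"
    using banach_fix_type[of "K * (d - c)" T] K cd by auto
  have fJ: "apply_bcontfun f s = J (apply_bcontfun f) s" if "s \<in> {c..d}" for s
    using T[of f s] that by (simp add: f)
  show ?thesis
  proof
    show "apply_bcontfun f c = m0" using fJ[of c] cd by (simp add: J_def)
    fix s assume s: "s \<in> {c..d}"
    show "(apply_bcontfun f has_vector_derivative prod (L s) (apply_bcontfun f s)) (at s within {c..d})"
      by (rule has_vector_derivative_transform[OF s _ dJ[OF s]]) (rule fJ)
  qed
qed

text \<open>The lift is sought in the form \<open>(x + u) M\<close>; it is horizontal iff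
  \<open>M' = - (1 + u\<^sup>t u)\<^sup>-\<^sup>1 u\<^sup>t u' M\<close>, and then automatically orthonormal.\<close>

lemma horizontal_curve:
  fixes u v :: "real \<Rightarrow> 'h::{real_inner,complete_space}^'p"
  assumes x: "x \<in> stiefel" and cd: "c < d"
    and u: "\<And>s. s \<in> {c..d} \<Longrightarrow> (u has_vector_derivative v s) (at s within {c..d})"
    and Eu: "\<And>s. s \<in> {c..d} \<Longrightarrow> tcomp x (u s) = 0"
    and v: "continuous_on {c..d} v"
    and K: "K \<ge> 0" "K * (d - c) < 1"
      "\<And>s (m :: real^'p^'p). s \<in> {c..d} \<Longrightarrow> norm (- (gram_inv (u s) ** tcomp (u s) (v s)) ** m) \<le> K * norm m"
    and z: "z \<in> stiefel" "invertible (tcomp x z)" "graph_coord x z = u c"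
  obtains Y Y' where "Y c = z"
    "\<And>s. s \<in> {c..d} \<Longrightarrow> Y s \<in> stiefel \<and> invertible (tcomp x (Y s)) \<and> graph_coord x (Y s) = u s"
    "\<And>s. s \<in> {c..d} \<Longrightarrow> (Y has_vector_derivative Y' s) (at s within {c..d}) \<and> tcomp (Y s) (Y' s) = 0
       \<and> norm (Y' s) = sqrt (metric_form (u s) (v s) (v s))"
proof -
  define L where "L = (\<lambda>s. - (gram_inv (u s) ** tcomp (u s) (v s)))"
  have uc: "continuous_on {c..d} u"
    by (rule continuous_on_vector_derivative[OF u])
  have inv: "invertible (mat 1 + tcomp (u s) (u s))" if "s \<in> {c..d}" for s
    by (rule invertible_gram[OF x Eu[OF that]])
  have gc: "continuous_on {c..d} (\<lambda>s. gram_inv (u s))"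
    by (rule continuous_on_compose2[OF smooth_fun_continuous_on[OF smooth_fun_gram_inv] uc]) (use inv in auto)
  have Lc: "continuous_on {c..d} L"
    unfolding L_def by (intro continuous_on_minus matrix_mult.continuous_on gc tcomp.continuous_on uc v)
  have LK: "norm (L s ** m) \<le> K * norm m" if "s \<in> {c..d}" for s and m :: "real^'p^'p"
    unfolding L_def by (rule K(3)[OF that])
  obtain M where M: "M c = tcomp x z"
    "\<And>s. s \<in> {c..d} \<Longrightarrow> (M has_vector_derivative L s ** M s) (at s within {c..d})"
    using linear_ode_solution[OF bounded_bilinear_matrix_mult less_imp_le[OF cd] Lc K(1,2) LK, of "tcomp x z"]
    by blast
  define Y where "Y = (\<lambda>s. rcomp (x + u s) (M s))"
  define Y' where "Y' = (\<lambda>s. rcomp (v s) (M s) + rcomp (x + u s) (L s ** M s))"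
  have Ev: "tcomp x (v s) = 0" if s: "s \<in> {c..d}" for s
  proof -
    have "((\<lambda>s. tcomp x (u s)) has_vector_derivative tcomp x (v s)) (at s within {c..d})"
      by (rule bounded_linear.has_vector_derivative[OF tcomp.bounded_linear_right u[OF s]])
    moreover have "((\<lambda>s. tcomp x (u s)) has_vector_derivative 0) (at s within {c..d})"
      by (rule has_vector_derivative_transform[OF s _ has_vector_derivative_const[of 0]]) (simp add: Eu)
    ultimately show ?thesis
      using vector_derivative_within_cbox[OF cd, of s] s by (metis box_real(2))
  qed
  have dY: "(Y has_vector_derivative Y' s) (at s within {c..d})" if s: "s \<in> {c..d}" for s
    using rcomp.has_vector_derivative[OF has_vector_derivative_add[OF has_vector_derivative_const u[OF s]] M(2)[OF s], of x]
    by (simp add: Y_def Y'_def add.commute)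
  have hor: "tcomp (Y s) (Y' s) = 0" if s: "s \<in> {c..d}" for s
  proof -
    let ?G = "mat 1 + tcomp (u s) (u s)"
    have 1: "tcomp (x + u s) (v s) = tcomp (u s) (v s)" by (simp add: tcomp.add_left Ev[OF s])
    have "?G ** L s = - tcomp (u s) (v s)"
      unfolding L_def matrix_mult.minus_right matrix_mul_assoc gram_inv_def
      by (simp add: matrix_inv_mult[OF inv[OF s]])
    then have "tcomp (x + u s) (Y' s) = tcomp (u s) (v s) ** M s + (- tcomp (u s) (v s)) ** M s"
      unfolding Y'_def tcomp.add_right[of "x + u s" "rcomp (v s) (M s)" "rcomp (x + u s) (L s ** M s)"]
        tcomp_rcomp_right 1 tcomp_graph[OF x Eu[OF s]] matrix_mul_assoc by simp
    then have "tcomp (x + u s) (Y' s) = 0" by (simp add: matrix_mult.minus_left)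
    then show ?thesis by (simp add: Y_def tcomp_rcomp_left matrix_mult.zero_right)
  qed
  \<comment> \<open>Both terms of the product rule vanish for a horizontal velocity, so the Gram
    matrix keeps its initial value: orthonormality is preserved rather than imposed.\<close>
  have YY: "((\<lambda>s. tcomp (Y s) (Y s)) has_vector_derivative 0) (at s within {c..d})" if s: "s \<in> {c..d}" for s
  proof -
    have "tcomp (Y' s) (Y s) = 0" using hor[OF s] transpose_tcomp[of "Y s" "Y' s"] by (simp add: transpose_def vec_eq_iff)
    then show ?thesis using tcomp.has_vector_derivative[OF dY[OF s] dY[OF s]] hor[OF s] by simp
  qed
  obtain k where k: "\<And>s. s \<in> {c..d} \<Longrightarrow> tcomp (Y s) (Y s) = k"
    using has_vector_derivative_zero_constant[OF convex_real_interval(5) YY] by metis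
  have Yc: "Y c = z" using rcomp_graph_coord[OF z(2)] by (simp add: Y_def M(1) z(3))
  then have "k = mat 1" using k[of c] z(1) cd by (simp add: stiefel_tcomp)
  then have Yst: "Y s \<in> stiefel" if "s \<in> {c..d}" for s using k[OF that] by (simp add: stiefel_tcomp)
  have xY: "tcomp x (Y s) = M s" if s: "s \<in> {c..d}" for s
    using x Eu[OF s] by (simp add: Y_def tcomp_rcomp_right tcomp.add_right stiefel_tcomp)
  have Minv: "invertible (M s)" if s: "s \<in> {c..d}" for s
  proof -
    have "tcomp (Y s) (x + u s) ** M s = mat 1" using Yst[OF s] unfolding stiefel_tcomp Y_def tcomp_rcomp_right by simp
    then show ?thesis by (auto simp: invertible_left_inverse)
  qed
  have Ygc: "graph_coord x (Y s) = u s" if s: "s \<in> {c..d}" for s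
    unfolding graph_coord_def xY[OF s] by (simp add: Y_def rcomp_rcomp matrix_inv_mult[OF Minv[OF s]])
  have nY: "norm (Y' s) = sqrt (metric_form (u s) (v s) (v s))" if s: "s \<in> {c..d}" for s
  proof -
    have i: "invertible (tcomp x (Y s))" using Minv[OF s] xY[OF s] by simp
    \<comment> \<open>Since \<open>gram_inv (u s)\<close> equals
      \<open>M s ** transpose (M s)\<close>, the differential equation for \<open>M\<close> says
      precisely that \<open>Y'\<close> is the lift of \<open>v\<close>.\<close>
    have "horizontal_lift x (Y s) (v s) = Y' s"
    proof -
      have G: "gram_inv (u s) = M s ** transpose (M s)"
        by (rule gram_inv_eq(1)[OF x Eu[OF s]]) (use Yst[OF s] in \<open>simp add: Y_def\<close>)
      have "tcomp (Y s) (v s) = transpose (M s) ** tcomp (u s) (v s)"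
        by (simp add: Y_def tcomp_rcomp_left tcomp.add_left Ev[OF s])
      then have "rcomp (Y s) (tcomp (Y s) (v s)) = rcomp (x + u s) (gram_inv (u s) ** tcomp (u s) (v s))"
        by (simp add: Y_def rcomp_rcomp G matrix_mul_assoc)
      then show ?thesis
        by (simp add: horizontal_lift_def xY[OF s] Y'_def L_def rcomp.diff_left rcomp_rcomp matrix_mult.minus_left rcomp.minus_right)
    qed
    then show ?thesis
      using inner_horizontal_lift[OF x Yst[OF s] i Ev[OF s] Ev[OF s]] by (simp add: Ygc[OF s] norm_eq_sqrt_inner)
  qed
  show ?thesis
    by (rule that[of Y Y']) (use Yc Yst Minv xY Ygc dY hor nY in auto)
qed

section \<open>Angles and chords on the unit sphere\<close>

text \<open>The components of \<open>a\<close> and \<open>c\<close> orthogonal to \<open>b\<close>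
  have norms sin \<alpha> and sin \<beta>; by the addition theorem, the Cauchy-Schwarz bound for
  their product says cos (\<alpha> + \<beta>) \<le> a \<bullet> c. If \<alpha> + \<beta> exceeds pi
  there is nothing to show.\<close>

lemma arccos_inner_triangle:
  fixes a b c :: "'h::real_inner"
  assumes n: "norm a = 1" "norm b = 1" "norm c = 1"
  shows "arccos (a \<bullet> c) \<le> arccos (a \<bullet> b) + arccos (b \<bullet> c)"
proof -
  have bnd: "-1 \<le> x \<bullet> y \<and> x \<bullet> y \<le> 1" if "norm x = 1" "norm y = 1" for x y :: 'h
    using Cauchy_Schwarz_ineq2[of x y] that by (auto simp: abs_le_iff)
  define \<alpha> \<beta> where "\<alpha> = arccos (a \<bullet> b)" and "\<beta> = arccos (b \<bullet> c)"
  have \<alpha>: "cos \<alpha> = a \<bullet> b" "0 \<le> \<alpha>" "\<alpha> \<le> pi" and \<beta>: "cos \<beta> = b \<bullet> c" "0 \<le> \<beta>" "\<beta> \<le> pi"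
    using bnd n by (auto simp: \<alpha>_def \<beta>_def cos_arccos arccos_lbound arccos_ubound)
  show ?thesis
  proof (cases "\<alpha> + \<beta> \<le> pi")
    case False
    then show ?thesis using bnd[OF n(1,3)] arccos_ubound[of "a \<bullet> c"] by (simp add: \<alpha>_def \<beta>_def)
  next
    case True
    define a' c' where "a' = a - (a \<bullet> b) *\<^sub>R b" and "c' = c - (b \<bullet> c) *\<^sub>R b"
    have u: "a \<bullet> a = 1" "b \<bullet> b = 1" "c \<bullet> c = 1" using n by (simp_all add: dot_square_norm)
    have "(norm a')\<^sup>2 = 1 - (a \<bullet> b)\<^sup>2" "(norm c')\<^sup>2 = 1 - (b \<bullet> c)\<^sup>2" "a' \<bullet> c' = a \<bullet> c - (a \<bullet> b) * (b \<bullet> c)"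
      unfolding power2_norm_eq_inner a'_def c'_def
      by (simp_all add: inner_diff_left inner_diff_right u inner_commute[of b a] inner_commute[of c b] power2_eq_square)
    moreover have "(sin \<alpha>)\<^sup>2 = 1 - (a \<bullet> b)\<^sup>2" "(sin \<beta>)\<^sup>2 = 1 - (b \<bullet> c)\<^sup>2"
      by (simp_all add: sin_squared_eq \<alpha> \<beta>)
    moreover have "0 \<le> sin \<alpha>" "0 \<le> sin \<beta>" using \<alpha> \<beta> by (auto intro: sin_ge_zero)
    ultimately have "norm a' = sin \<alpha>" "norm c' = sin \<beta>"
      by (metis norm_ge_zero power2_eq_imp_eq)+
    then have "- (sin \<alpha> * sin \<beta>) \<le> a' \<bullet> c'" using Cauchy_Schwarz_ineq2[of a' c'] by (simp add: abs_le_iff)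
    then have "cos (\<alpha> + \<beta>) \<le> a \<bullet> c"
      using \<open>a' \<bullet> c' = _\<close> by (simp add: cos_add \<alpha>(1) \<beta>(1))
    then have "arccos (a \<bullet> c) \<le> arccos (cos (\<alpha> + \<beta>))"
      using bnd[OF n(1,3)] by (intro arccos_le_mono[THEN iffD2]) auto
    also have "\<dots> = \<alpha> + \<beta>" using True \<alpha> \<beta> by (intro arccos_cos) auto
    finally show ?thesis by (simp add: \<alpha>_def \<beta>_def)
  qed
qed

text \<open>The inequality x \<le> tan x, cleared of its denominator so that it persists up to
  pi.\<close>

lemma mult_cos_le_sin:
  assumes "0 \<le> x" "x \<le> pi"
  shows "x * cos x \<le> sin x"
proof -
  have "sin 0 - 0 * cos 0 \<le> sin x - x * cos x"
  proof (rule DERIV_nonneg_imp_nondecreasing[OF assms(1)])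
    fix y assume y: "0 \<le> y" "y \<le> x"
    have "((\<lambda>y. sin y - y * cos y) has_real_derivative y * sin y) (at y)"
      by (auto intro!: derivative_eq_intros)
    moreover have "y * sin y \<ge> 0" using y assms by (intro mult_nonneg_nonneg sin_ge_zero) auto
    ultimately show "\<exists>l. ((\<lambda>y. sin y - y * cos y) has_real_derivative l) (at y) \<and> 0 \<le> l" by blast
  qed
  then show ?thesis by simp
qed

lemma norm_diff_unit_squared:
  fixes a b :: "'h::real_inner"
  assumes "norm a = 1" "norm b = 1"
  shows "(norm (a - b))\<^sup>2 = 2 - 2 * (a \<bullet> b)"
proof -
  have "a \<bullet> a = 1" "b \<bullet> b = 1" using assms by (simp_all add: dot_square_norm)
  then show ?thesis
    by (simp add: power2_norm_eq_inner inner_diff_left inner_diff_right inner_commute[of b a])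
qed

text \<open>For an angle 2 \<phi> the chord is 2 sin \<phi> and the square root is cos \<phi>, so
  this is \<phi> cos \<phi> \<le> sin \<phi>.\<close>

lemma arccos_chord:
  fixes a b :: "'h::real_inner"
  assumes n: "norm a = 1" "norm b = 1"
  shows "arccos (a \<bullet> b) * sqrt (1 - (norm (a - b) / 2)\<^sup>2) \<le> norm (a - b)"
proof -
  have "-1 \<le> a \<bullet> b \<and> a \<bullet> b \<le> 1"
    using Cauchy_Schwarz_ineq2[of a b] n by (auto simp: abs_le_iff)
  then have \<theta>: "cos (arccos (a \<bullet> b)) = a \<bullet> b" "0 \<le> arccos (a \<bullet> b)" "arccos (a \<bullet> b) \<le> pi"
    by (auto simp: arccos_lbound arccos_ubound)
  define \<phi> where "\<phi> = arccos (a \<bullet> b) / 2"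
  have \<phi>: "0 \<le> \<phi>" "\<phi> \<le> pi / 2" "cos (2 * \<phi>) = a \<bullet> b" using \<theta> by (auto simp: \<phi>_def)
  have "(norm (a - b))\<^sup>2 = 2 - 2 * (a \<bullet> b)" by (rule norm_diff_unit_squared[OF n])
  also have "\<dots> = (2 * sin \<phi>)\<^sup>2" unfolding \<phi>(3)[symmetric] cos_double_sin by (simp add: power_mult_distrib)
  finally have sq: "(norm (a - b))\<^sup>2 = (2 * sin \<phi>)\<^sup>2" .
  have "\<phi> \<le> pi" using \<phi>(2) pi_ge_zero by linarith
  then have "0 \<le> 2 * sin \<phi>" using sin_ge_zero[OF \<phi>(1)] by simp
  with sq have r: "norm (a - b) = 2 * sin \<phi>" by (intro power2_eq_imp_eq[OF _ norm_ge_zero])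
  have "cos \<phi> \<ge> 0" using \<phi> by (intro cos_ge_zero) auto
  then have "sqrt (1 - (sin \<phi>)\<^sup>2) = cos \<phi>" by (simp flip: cos_squared_eq)
  then show ?thesis using mult_cos_le_sin[of \<phi>] \<phi> by (simp add: r) (simp add: \<phi>_def)
qed

text \<open>The threshold is the chord at which the cosine of half the angle drops to 1 / (1 +
  \<epsilon>).\<close>

lemma arccos_le_chord:
  fixes a b :: "'h::real_inner"
  assumes n: "norm a = 1" "norm b = 1" and \<epsilon>: "\<epsilon> > 0"
    and small: "norm (a - b) \<le> 2 * sqrt (1 - (inverse (1 + \<epsilon>))\<^sup>2)"
  shows "arccos (a \<bullet> b) \<le> (1 + \<epsilon>) * norm (a - b)"
proof -
  have i: "(inverse (1 + \<epsilon>))\<^sup>2 \<le> 1" using \<epsilon> by (simp add: power_le_one inverse_le_1_iff)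
  have "norm (a - b) / 2 \<le> sqrt (1 - (inverse (1 + \<epsilon>))\<^sup>2)" using small by simp
  then have "(norm (a - b) / 2)\<^sup>2 \<le> (sqrt (1 - (inverse (1 + \<epsilon>))\<^sup>2))\<^sup>2" by (intro power_mono) auto
  then have "(inverse (1 + \<epsilon>))\<^sup>2 \<le> 1 - (norm (a - b) / 2)\<^sup>2" using i by simp
  then have le: "inverse (1 + \<epsilon>) \<le> sqrt (1 - (norm (a - b) / 2)\<^sup>2)" by (rule real_le_rsqrt)
  have "0 \<le> arccos (a \<bullet> b)"
    using Cauchy_Schwarz_ineq2[of a b] n by (intro arccos_lbound) (auto simp: abs_le_iff)
  then have "arccos (a \<bullet> b) * inverse (1 + \<epsilon>) \<le> norm (a - b)"
    using arccos_chord[OF n] mult_left_mono[OF le] by (meson order_trans)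
  then show ?thesis using \<epsilon> by (simp add: field_simps)
qed

text \<open>This property is inherited by concatenations of curves, so it only has to be checked locally, where the
  factor \<open>1 + \<epsilon>\<close> makes it possible to replace angles by chords.\<close>

definition moves_within ::
    "real \<Rightarrow> (real \<Rightarrow> ('h::{real_inner,complete_space}^'p) set) \<Rightarrow> real \<Rightarrow> real \<Rightarrow> bool" where
  "moves_within \<epsilon> \<gamma> c d \<longleftrightarrow> speed grassmann \<gamma> integrable_on {c..d} \<and>
     (\<forall>z\<in>stiefel. orbit z = \<gamma> c \<longrightarrow> (\<exists>w\<in>stiefel. orbit w = \<gamma> d \<and>
        (\<exists>v :: real^'p. (\<forall>i. arccos (z $ i \<bullet> w $ i) \<le> v $ i) \<and>
           norm v \<le> (1 + \<epsilon>) * integral {c..d} (speed grassmann \<gamma>))))"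

lemma norm_frame_nth: "z \<in> stiefel \<Longrightarrow> norm (z $ i) = 1"
  by (simp add: stiefel_iff norm_eq_sqrt_inner)

lemma moves_within_refl:
  fixes \<gamma> :: "real \<Rightarrow> ('h::{real_inner,complete_space}^'p) set"
  shows "moves_within \<epsilon> \<gamma> c c"
  unfolding moves_within_def
proof (intro conjI ballI impI)
  fix z :: "'h^'p" assume z: "z \<in> stiefel" "orbit z = \<gamma> c"
  then show "\<exists>w\<in>stiefel. orbit w = \<gamma> c \<and> (\<exists>v :: real^'p. (\<forall>i. arccos (z $ i \<bullet> w $ i) \<le> v $ i) \<and>
           norm v \<le> (1 + \<epsilon>) * integral {c..c} (speed grassmann \<gamma>))"
    by (intro bexI[of _ z] conjI exI[of _ 0]) (auto simp: stiefel_iff)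
qed (use integrable_on_refl[of _ c] in \<open>simp only: box_real\<close>)

text \<open>Angles of corresponding columns add by the triangle inequality on the sphere, their
  bounds by the one in \<open>real^'p\<close>; this is why a whole vector of bounds is carried
  along. As every starting frame is allowed, the end frame of one piece may start the next.\<close>

lemma moves_within_trans:
  fixes \<gamma> :: "real \<Rightarrow> ('h::{real_inner,complete_space}^'p) set"
  assumes 1: "moves_within \<epsilon> \<gamma> a b" and 2: "moves_within \<epsilon> \<gamma> b c" and abc: "a \<le> b" "b \<le> c"
  shows "moves_within \<epsilon> \<gamma> a c"
  unfolding moves_within_def
proof (intro conjI ballI impI)
  have i: "speed grassmann \<gamma> integrable_on {a..b}" "speed grassmann \<gamma> integrable_on {b..c}"
    using 1 2 by (auto simp: moves_within_def)
  show int: "speed grassmann \<gamma> integrable_on {a..c}" by (rule Henstock_Kurzweil_Integration.integrable_combine[OF abc i])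
  fix z :: "'h^'p" assume z: "z \<in> stiefel" "orbit z = \<gamma> a"
  obtain y v where y: "y \<in> stiefel" "orbit y = \<gamma> b" "\<And>i. arccos (z $ i \<bullet> y $ i) \<le> v $ i"
    "norm v \<le> (1 + \<epsilon>) * integral {a..b} (speed grassmann \<gamma>)"
    using 1 z unfolding moves_within_def by blast
  obtain w v' where w: "w \<in> stiefel" "orbit w = \<gamma> c" "\<And>i. arccos (y $ i \<bullet> w $ i) \<le> v' $ i"
    "norm v' \<le> (1 + \<epsilon>) * integral {b..c} (speed grassmann \<gamma>)"
    using 2 y unfolding moves_within_def by blast
  have "arccos (z $ i \<bullet> w $ i) \<le> (v + v') $ i" for i
    using arccos_inner_triangle[of "z $ i" "y $ i" "w $ i"] y(3)[of i] w(3)[of i] z(1) y(1) w(1)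
    by (simp add: norm_frame_nth)
  moreover have "norm (v + v') \<le> (1 + \<epsilon>) * integral {a..c} (speed grassmann \<gamma>)"
  proof -
    have "norm (v + v') \<le> norm v + norm v'" by (rule norm_triangle_ineq)
    also have "\<dots> \<le> (1 + \<epsilon>) * (integral {a..b} (speed grassmann \<gamma>) + integral {b..c} (speed grassmann \<gamma>))"
      using y(4) w(4) by (simp add: distrib_left)
    also have "integral {a..b} (speed grassmann \<gamma>) + integral {b..c} (speed grassmann \<gamma>) = integral {a..c} (speed grassmann \<gamma>)"
      by (rule Henstock_Kurzweil_Integration.integral_combine[OF abc int])
    finally show ?thesis .
  qed
  ultimately show "\<exists>w\<in>stiefel. orbit w = \<gamma> c \<and> (\<exists>v :: real^'p. (\<forall>i. arccos (z $ i \<bullet> w $ i) \<le> v $ i) \<and>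
           norm v \<le> (1 + \<epsilon>) * integral {a..c} (speed grassmann \<gamma>))"
    using w(1,2) by blast
qed

text \<open>In a single chart the curve has a horizontal lift \<open>Y\<close>, whose displacement
  is at most the length of the piece. On a short piece the displacement of each column is a small
  chord and controls the angle up to the factor \<open>1 + \<epsilon>\<close>.\<close>

lemma moves_within_local:
  fixes \<gamma> :: "real \<Rightarrow> ('h::{real_inner,complete_space}^'p) set"
  assumes C1: "C1_curve_on grassmann a b \<gamma>" and ab: "0 \<le> a" "b \<le> 1" and t: "t \<in> {a..b}" and \<epsilon>: "\<epsilon> > 0"
  shows "\<exists>\<delta>>0. \<forall>c d. a \<le> c \<and> c \<le> d \<and> d \<le> b \<and> \<bar>c - t\<bar> < \<delta> \<and> \<bar>d - t\<bar> < \<delta> \<longrightarrow> moves_within \<epsilon> \<gamma> c d"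
proof -
  obtain x \<delta>0 v where x: "x \<in> stiefel" and \<delta>0: "\<delta>0 > 0"
    and dom: "\<And>s. s \<in> {a..b} \<Longrightarrow> \<bar>s - t\<bar> < \<delta>0 \<Longrightarrow> \<gamma> s \<in> chart_dom (grassmann_chart x)"
    and der: "\<And>s. s \<in> {a..b} \<Longrightarrow> \<bar>s - t\<bar> < \<delta>0 \<Longrightarrow>
      ((chart_map (grassmann_chart x) \<circ> \<gamma>) has_vector_derivative v s) (at s within {a..b})"
    and vc: "continuous_on ({a..b} \<inter> {t - \<delta>0<..<t + \<delta>0}) v"
    using C1 t unfolding C1_curve_on_def chart_sel by blast
  define u where "u = chart_map (grassmann_chart x) \<circ> \<gamma>"
  \<comment> \<open>Halving \<delta>0 gives a compact interval, on which the coefficient of the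
    lifting equation and the speed are bounded.\<close>
  define I where "I = {a..b} \<inter> {t - \<delta>0/2..t + \<delta>0/2}"
  have Is: "s \<in> {a..b}" "\<bar>s - t\<bar> < \<delta>0" if "s \<in> I" for s using that \<delta>0 by (auto simp: I_def)
  have cI: "compact I" unfolding I_def by (intro compact_Int) auto
  have vI: "continuous_on I v" by (rule continuous_on_subset[OF vc]) (use \<delta>0 in \<open>auto simp: I_def\<close>)
  have du: "(u has_vector_derivative v s) (at s within {a..b})" if "s \<in> I" for s
    unfolding u_def using der Is[OF that] by blast
  have uI: "continuous_on I u"
    by (rule continuous_on_vector_derivative[OF has_vector_derivative_within_subset[OF du]]) (auto simp: I_def)
  have Eu: "tcomp x (u s) = 0" if s: "s \<in> I" for s
  proof -
    obtain z where "z \<in> stiefel" "invertible (tcomp x z)" "\<gamma> s = orbit z"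
      using dom[OF Is[OF s]] by (rule chart_domE)
    then show ?thesis using tcomp_graph_coord[OF x] by (simp add: u_def chart_map_orbit)
  qed
  have inv: "invertible (mat 1 + tcomp (u s) (u s))" if "s \<in> I" for s
    by (rule invertible_gram[OF x Eu[OF that]])
  have gI: "continuous_on I (\<lambda>s. gram_inv (u s))"
    by (rule continuous_on_compose2[OF smooth_fun_continuous_on[OF smooth_fun_gram_inv] uI]) (use inv in auto)
  define L where "L = (\<lambda>s. - (gram_inv (u s) ** tcomp (u s) (v s)))"
  have "continuous_on I L"
    unfolding L_def by (intro continuous_on_minus matrix_mult.continuous_on gI tcomp.continuous_on uI vI)
  then have "bounded (L ` I)" by (rule compact_imp_bounded[OF compact_continuous_image[OF _ cI]])
  then obtain KL where "\<forall>y\<in>L ` I. norm y \<le> KL" unfolding bounded_iff by blast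
  then have KL: "\<And>s. s \<in> I \<Longrightarrow> norm (L s) \<le> KL" by blast
  obtain KM where KM: "KM > 0" "\<And>A B. norm ((A :: real^'p^'p) ** (B :: real^'p^'p)) \<le> norm A * norm B * KM"
    using matrix_mult.pos_bounded by blast
  define K where "K = \<bar>KL\<bar> * KM"
  have K: "K \<ge> 0" "\<And>s (m :: real^'p^'p). s \<in> I \<Longrightarrow> norm (L s ** m) \<le> K * norm m"
  proof -
    fix s and m :: "real^'p^'p" assume "s \<in> I"
    then have "norm (L s) * norm m * KM \<le> \<bar>KL\<bar> * norm m * KM"
      using KL[of s] KM(1) by (intro mult_right_mono) auto
    then show "norm (L s ** m) \<le> K * norm m" using KM(2)[of "L s" m] by (simp add: K_def ac_simps)
  qed (use KM(1) in \<open>simp add: K_def\<close>)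
  define q where "q = (\<lambda>s. sqrt (metric_form (u s) (v s) (v s)))"
  have qI: "continuous_on I q"
    unfolding q_def metric_form_def
    by (intro continuous_on_real_sqrt bounded_linear.continuous_on[OF bounded_linear_trace] matrix_mult.continuous_on
        continuous_on_diff tcomp.continuous_on uI vI gI)
  then have "bounded (q ` I)" by (rule compact_imp_bounded[OF compact_continuous_image[OF _ cI]])
  then obtain Kq where "\<forall>y\<in>q ` I. norm y \<le> Kq" unfolding bounded_iff by blast
  then have Kq: "\<And>s. s \<in> I \<Longrightarrow> norm (q s) \<le> Kq" by blast
  define r where "r = 2 * sqrt (1 - (inverse (1 + \<epsilon>))\<^sup>2)"
  have r: "r > 0"
  proof -
    have "inverse (1 + \<epsilon>) < 1" "0 < inverse (1 + \<epsilon>)" using \<epsilon> by (auto simp: inverse_less_1_iff)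
    then have "(inverse (1 + \<epsilon>))\<^sup>2 < 1" by (simp add: power_less_one_iff)
    then show ?thesis by (simp add: r_def)
  qed
  \<comment> \<open>The three bounds keep the piece inside \<open>I\<close>, make the lifting
    equation contractive, and keep the chords below the threshold \<open>r\<close>. The factors 2 in
    the denominators of the last two are there since \<open>d - c\<close> is only known to be less
    than \<open>2 * \<delta>\<close>; the summands 1 prevent division by zero.\<close>
  define \<delta> where "\<delta> = Min {\<delta>0 / 2, 1 / (2 * (K + 1)), r / (2 * (\<bar>Kq\<bar> + 1))}"
  have \<delta>: "\<delta> > 0" "\<delta> \<le> \<delta>0 / 2" "\<delta> \<le> 1 / (2 * (K + 1))" "\<delta> \<le> r / (2 * (\<bar>Kq\<bar> + 1))"
  proof -
    show "\<delta> > 0" using \<delta>0 K(1) r by (simp add: \<delta>_def add_pos_nonneg add_nonneg_pos)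
  qed (unfold \<delta>_def, (rule Min_le; simp)+)
  have "moves_within \<epsilon> \<gamma> c d" if cd: "a \<le> c" "c \<le> d" "d \<le> b" "\<bar>c - t\<bar> < \<delta>" "\<bar>d - t\<bar> < \<delta>" for c d
  proof (cases "c = d")
    case True
    then show ?thesis by (simp add: moves_within_refl)
  next
    case False
    then have c_d: "c < d" using cd by simp
    have sub: "{c..d} \<subseteq> I" using cd \<delta> by (auto simp: I_def)
    have dc: "d - c < 2 * \<delta>" using cd by linarith
    have "K * (d - c) \<le> (K + 1) * (d - c)" using c_d by (intro mult_right_mono) auto
    also have "\<dots> < (K + 1) * (1 / (K + 1))"
    proof (rule mult_strict_left_mono)
      have "d - c < 2 * (1 / (2 * (K + 1)))" using dc \<delta>(3) by linarith
      then show "d - c < 1 / (K + 1)" using K(1) by (simp add: field_simps)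
    qed (use K(1) in simp)
    finally have Kd: "K * (d - c) < 1" using K(1) by simp
    have "Kq * (d - c) \<le> (\<bar>Kq\<bar> + 1) * (d - c)" using c_d by (intro mult_right_mono) auto
    also have "\<dots> \<le> (\<bar>Kq\<bar> + 1) * (r / (\<bar>Kq\<bar> + 1))"
    proof (rule mult_left_mono)
      have "d - c \<le> 2 * (r / (2 * (\<bar>Kq\<bar> + 1)))" using dc \<delta>(4) by linarith
      then show "d - c \<le> r / (\<bar>Kq\<bar> + 1)" by (simp add: field_simps)
    qed simp
    finally have qd: "Kq * (d - c) \<le> r" by (simp add: add_pos_nonneg[THEN less_imp_neq[THEN not_sym]] add.commute)
    have sab: "{c..d} \<subseteq> {a..b}" using cd by auto
    have lift: "\<exists>Y Y'. Y c = z \<and> (\<forall>s\<in>{c..d}. Y s \<in> stiefel \<and> orbit (Y s) = \<gamma> s) \<and>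
        (\<forall>s\<in>{c..d}. (Y has_vector_derivative Y' s) (at s within {c..d}) \<and> tcomp (Y s) (Y' s) = 0 \<and> norm (Y' s) = q s)"
      if z: "z \<in> stiefel" "orbit z = \<gamma> c" for z
    proof -
      have "c \<in> I" using sub c_d by auto
      then have i: "invertible (tcomp x z)"
        using dom[OF Is] z(2) orbit_in_chart_dom[OF z(1), of x] by metis
      obtain Y Y' where Y: "Y c = z"
        "\<And>s. s \<in> {c..d} \<Longrightarrow> Y s \<in> stiefel \<and> invertible (tcomp x (Y s)) \<and> graph_coord x (Y s) = u s"
        "\<And>s. s \<in> {c..d} \<Longrightarrow> (Y has_vector_derivative Y' s) (at s within {c..d}) \<and> tcomp (Y s) (Y' s) = 0
           \<and> norm (Y' s) = sqrt (metric_form (u s) (v s) (v s))"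
      proof (rule horizontal_curve[OF x c_d _ _ _ K(1) Kd _ z(1) i, of u v])
        fix s assume s: "s \<in> {c..d}"
        then show "(u has_vector_derivative v s) (at s within {c..d})"
          using du sub has_vector_derivative_within_subset[OF _ sab] by blast
        show "tcomp x (u s) = 0" using Eu s sub by blast
        fix m :: "real^'p^'p" show "norm (- (gram_inv (u s) ** tcomp (u s) (v s)) ** m) \<le> K * norm m"
          using K(2)[of s m] s sub unfolding L_def by blast
      next
        show "continuous_on {c..d} v" by (rule continuous_on_subset[OF vI sub])
        show "graph_coord x z = u c" using z(2) chart_map_orbit[OF i] by (simp add: u_def)
      qed blast
      have "orbit (Y s) = \<gamma> s" if s: "s \<in> {c..d}" for s
      proof -
        obtain y where y: "y \<in> stiefel" "invertible (tcomp x y)" "\<gamma> s = orbit y"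
          using dom[OF Is] s sub by (metis chart_domE subsetD)
        then have "graph_coord x (Y s) = graph_coord x y" using Y(2)[OF s] by (simp add: u_def chart_map_orbit)
        then show ?thesis using orbit_eq_graph_coord[of "Y s" y x] Y(2)[OF s] y by simp
      qed
      then show ?thesis using Y unfolding q_def by blast
    qed
    \<comment> \<open>At the ends of the piece the one-sided derivative of the lift does not give
      the derivative within the unit interval; two points do not affect the integral.\<close>
    have speed: "speed grassmann \<gamma> s = q s" if s: "s \<in> {c..d} - {c, d}" for s
    proof -
      have "c \<in> I" using sub c_d by auto
      then obtain z where "z \<in> stiefel" "\<gamma> c = orbit z" using dom[OF Is] by (metis chart_domE)
      then obtain Y Y' where Y: "\<And>s. s \<in> {c..d} \<Longrightarrow> Y s \<in> stiefel \<and> orbit (Y s) = \<gamma> s"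
        "\<And>s. s \<in> {c..d} \<Longrightarrow> (Y has_vector_derivative Y' s) (at s within {c..d}) \<and> tcomp (Y s) (Y' s) = 0 \<and> norm (Y' s) = q s"
        using lift[of z] by metis
      have "(Y has_vector_derivative Y' s) (at s)"
        using Y(2)[of s] s at_within_Icc_at[of c s d] by auto
      then have "(Y has_vector_derivative Y' s) (at s within {0..1})" by (rule has_vector_derivative_at_within)
      then have "speed grassmann \<gamma> s = norm (Y' s)"
      proof (rule speed_horizontal_lift[where \<delta> = "min (s - c) (d - s)", rotated])
        show "s \<in> {0..1}" "0 < min (s - c) (d - s)" using s cd ab by auto
        show "tcomp (Y s) (Y' s) = 0" using Y(2)[of s] s by blast
        fix s' assume "\<bar>s' - s\<bar> < min (s - c) (d - s)"
        then have "s' \<in> {c..d}" by auto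
        then show "Y s' \<in> stiefel \<and> \<gamma> s' = orbit (Y s')" using Y(1) by simp
      qed
      then show ?thesis using Y(2)[of s] s by simp
    qed
    have qcd: "continuous_on {c..d} q" by (rule continuous_on_subset[OF qI sub])
    then have "q integrable_on {c..d}" by (rule integrable_continuous_real)
    then have int: "speed grassmann \<gamma> integrable_on {c..d}"
      by (rule integrable_spike_finite[of "{c, d}", rotated 2]) (use speed in auto)
    have intq: "integral {c..d} (speed grassmann \<gamma>) = integral {c..d} q"
      by (rule integral_spike[of "{c, d}"]) (use speed in auto)
    show ?thesis
      unfolding moves_within_def
    proof (intro conjI ballI impI int)
      fix z assume z: "z \<in> stiefel" "orbit z = \<gamma> c"
      obtain Y Y' where Y: "Y c = z" "\<And>s. s \<in> {c..d} \<Longrightarrow> Y s \<in> stiefel \<and> orbit (Y s) = \<gamma> s"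
        "\<And>s. s \<in> {c..d} \<Longrightarrow> (Y has_vector_derivative Y' s) (at s within {c..d}) \<and> tcomp (Y s) (Y' s) = 0 \<and> norm (Y' s) = q s"
        using lift[OF z] by metis
      have "norm (Y d - Y c) \<le> integral {c..d} q - integral {c..c} q"
      proof (rule differentiable_bound_general[OF c_d, where f' = Y' and \<phi>' = q])
        show "continuous_on {c..d} Y"
          by (rule continuous_on_vector_derivative) (use Y(3) in blast)
        show "continuous_on {c..d} (\<lambda>s. integral {c..s} q)"
          by (rule continuous_on_vector_derivative[OF integral_has_vector_derivative[OF qcd]])
        fix s assume s: "c < s" "s < d"
        then show "(Y has_vector_derivative Y' s) (at s)" using Y(3)[of s] at_within_Icc_at[of c s d] by auto
        show "((\<lambda>s. integral {c..s} q) has_vector_derivative q s) (at s)"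
          using integral_has_vector_derivative[OF qcd, of s] s at_within_Icc_at[of c s d] by auto
        show "norm (Y' s) \<le> q s" using Y(3)[of s] s by simp
      qed
      then have le: "norm (Y d - Y c) \<le> integral {c..d} (speed grassmann \<gamma>)" by (simp add: intq)
      have "integral {c..d} q \<le> Kq * (d - c)"
      proof -
        have "norm (integral {c..d} q) \<le> Kq * (d - c)"
          by (rule integral_bound[OF less_imp_le[OF c_d] qcd]) (use Kq sub in blast)
        then show ?thesis by (simp add: abs_le_iff)
      qed
      then have small: "norm (Y d - Y c) \<le> r" using le qd intq by linarith
      define w where "w = (\<chi> i. (1 + \<epsilon>) * norm ((Y d - Y c) $ i))"
      have "arccos (z $ i \<bullet> Y d $ i) \<le> w $ i" for i
      proof -
        have st: "Y d \<in> stiefel" using Y(2)[of d] c_d by simp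
        have nn: "norm (z $ i - Y d $ i) = norm ((Y d - Y c) $ i)" by (simp add: Y(1) norm_minus_commute)
        have "norm (z $ i - Y d $ i) \<le> r"
          using small Finite_Cartesian_Product.norm_nth_le[of "Y d - Y c" i] unfolding nn by linarith
        then show ?thesis
          using arccos_le_chord[OF norm_frame_nth[OF z(1)] norm_frame_nth[OF st] \<epsilon>, of i i] unfolding r_def nn
          by (simp add: w_def)
      qed
      moreover have "norm w = (1 + \<epsilon>) * norm (Y d - Y c)"
      proof -
        have "w = (1 + \<epsilon>) *\<^sub>R (\<chi> i. norm ((Y d - Y c) $ i))" by (simp add: w_def vec_eq_iff)
        moreover have "norm (\<chi> i. norm ((Y d - Y c) $ i)) = norm (Y d - Y c)" by (simp add: norm_vec_def)
        ultimately show ?thesis using \<epsilon> by simp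
      qed
      moreover have "(1 + \<epsilon>) * norm (Y d - Y c) \<le> (1 + \<epsilon>) * integral {c..d} (speed grassmann \<gamma>)"
        using le \<epsilon> by (intro mult_left_mono) auto
      moreover have "Y d \<in> stiefel" "orbit (Y d) = \<gamma> d" using Y(2)[of d] c_d by auto
      ultimately show "\<exists>w\<in>stiefel. orbit w = \<gamma> d \<and> (\<exists>v :: real^'p. (\<forall>i. arccos (z $ i \<bullet> w $ i) \<le> v $ i) \<and>
           norm v \<le> (1 + \<epsilon>) * integral {c..d} (speed grassmann \<gamma>))"
        by (intro bexI[of _ "Y d"] conjI exI[of _ w]) auto
    qed
  qed
  then show ?thesis using \<delta>(1) by blast
qed

text \<open>Bisection of the unit interval: the property is additive and holds for all short pieces
  ending or starting at a given time. The two sides are treated apart because at a breakpoint they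
  belong to different C1 pieces.\<close>

lemma moves_within_curve:
  fixes \<gamma> :: "real \<Rightarrow> ('h::{real_inner,complete_space}^'p) set"
  assumes \<gamma>: "piecewise_C1_curve grassmann \<gamma>" and \<epsilon>: "\<epsilon> > 0"
  shows "moves_within \<epsilon> \<gamma> 0 1"
proof -
  obtain B where B: "finite B" "{0, 1} \<subseteq> B" "B \<subseteq> {0..1}"
    "\<forall>a\<in>B. \<forall>b\<in>B. a < b \<and> {a<..<b} \<inter> B = {} \<longrightarrow> C1_curve_on grassmann a b \<gamma>"
    using \<gamma> unfolding piecewise_C1_curve_def by blast
  define P where "P = (\<lambda>c d. 0 \<le> c \<longrightarrow> d \<le> 1 \<longrightarrow> moves_within \<epsilon> \<gamma> c d)"
  have piece: "\<exists>\<delta>>0. \<forall>c d. a \<le> c \<and> c \<le> d \<and> d \<le> b \<and> \<bar>c - t\<bar> < \<delta> \<and> \<bar>d - t\<bar> < \<delta> \<longrightarrow> moves_within \<epsilon> \<gamma> c d"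
    if "a \<in> B" "b \<in> B" "a < b" "{a<..<b} \<inter> B = {}" "t \<in> {a..b}" for a b t
  proof (rule moves_within_local[OF _ _ _ that(5) \<epsilon>])
    show "C1_curve_on grassmann a b \<gamma>" using B(4) that(1-4) by blast
  qed (use that(1,2) B(3) in auto)
  have left: "\<exists>\<delta>>0. \<forall>c. 0 \<le> c \<and> c \<le> t \<and> t - c < \<delta> \<longrightarrow> moves_within \<epsilon> \<gamma> c t" if t: "0 < t" "t \<le> 1" for t
  proof -
    \<comment> \<open>The C1 piece that arrives at \<open>t\<close>: \<open>b\<close> may equal
      \<open>t\<close>, whereas \<open>a\<close> is strictly earlier.\<close>
    define a b where "a = Max {x \<in> B. x < t}" and "b = Min {x \<in> B. t \<le> x}"
    have "a \<in> {x \<in> B. x < t}" unfolding a_def by (rule Max_in) (use B t in auto)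
    moreover have "b \<in> {x \<in> B. t \<le> x}" unfolding b_def by (rule Min_in) (use B t in auto)
    moreover have "x \<le> a" if "x \<in> B" "x < t" for x unfolding a_def using that B by (intro Max_ge) auto
    moreover have "b \<le> x" if "x \<in> B" "t \<le> x" for x unfolding b_def using that B by (intro Min_le) auto
    ultimately have ab: "a \<in> B" "b \<in> B" "a < t" "t \<le> b" "{a<..<b} \<inter> B = {}" by (auto simp: not_le) (metis not_le)
    obtain \<delta> where \<delta>: "\<delta> > 0" "\<And>c d. a \<le> c \<and> c \<le> d \<and> d \<le> b \<and> \<bar>c - t\<bar> < \<delta> \<and> \<bar>d - t\<bar> < \<delta> \<Longrightarrow> moves_within \<epsilon> \<gamma> c d"
      using piece[OF ab(1,2) _ ab(5), of t] ab by auto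
    show ?thesis
      using \<delta> ab by (intro exI[of _ "min \<delta> (t - a)"]) auto
  qed
  have right: "\<exists>\<delta>>0. \<forall>d. t \<le> d \<and> d \<le> 1 \<and> d - t < \<delta> \<longrightarrow> moves_within \<epsilon> \<gamma> t d" if t: "0 \<le> t" "t < 1" for t
  proof -
    define a b where "a = Max {x \<in> B. x \<le> t}" and "b = Min {x \<in> B. t < x}"
    have "a \<in> {x \<in> B. x \<le> t}" unfolding a_def by (rule Max_in) (use B t in auto)
    moreover have "b \<in> {x \<in> B. t < x}" unfolding b_def by (rule Min_in) (use B t in auto)
    moreover have "x \<le> a" if "x \<in> B" "x \<le> t" for x unfolding a_def using that B by (intro Max_ge) auto
    moreover have "b \<le> x" if "x \<in> B" "t < x" for x unfolding b_def using that B by (intro Min_le) auto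
    ultimately have ab: "a \<in> B" "b \<in> B" "a \<le> t" "t < b" "{a<..<b} \<inter> B = {}" by (auto simp: not_le) (metis not_le)
    obtain \<delta> where \<delta>: "\<delta> > 0" "\<And>c d. a \<le> c \<and> c \<le> d \<and> d \<le> b \<and> \<bar>c - t\<bar> < \<delta> \<and> \<bar>d - t\<bar> < \<delta> \<Longrightarrow> moves_within \<epsilon> \<gamma> c d"
      using piece[OF ab(1,2) _ ab(5), of t] ab by auto
    show ?thesis
      using \<delta> ab by (intro exI[of _ "min \<delta> (b - t)"]) auto
  qed
  have "(0::real) \<le> 1" by simp
  then have "P 0 1"
  proof (induction rule: Bolzano)
    case (trans a b c)
    then show ?case unfolding P_def using moves_within_trans[of \<epsilon> \<gamma> a b c] by auto
  next
    case (local t)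
    obtain \<delta>1 where 1: "\<delta>1 > 0" "\<And>c. 0 \<le> c \<Longrightarrow> c \<le> t \<Longrightarrow> t - c < \<delta>1 \<Longrightarrow> moves_within \<epsilon> \<gamma> c t"
    proof (cases "t = 0")
      case True
      then show ?thesis using that[of 1] moves_within_refl by auto
    next
      case False
      then show ?thesis using left[of t] local that by auto
    qed
    obtain \<delta>2 where 2: "\<delta>2 > 0" "\<And>d. t \<le> d \<Longrightarrow> d \<le> 1 \<Longrightarrow> d - t < \<delta>2 \<Longrightarrow> moves_within \<epsilon> \<gamma> t d"
    proof (cases "t = 1")
      case True
      then show ?thesis using that[of 1] moves_within_refl by auto
    next
      case False
      then show ?thesis using right[of t] local that by auto
    qed
    have "P c d" if "c \<le> t \<and> t \<le> d \<and> d - c < min \<delta>1 \<delta>2" for c d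
      unfolding P_def using 1(2)[of c] 2(2)[of d] that moves_within_trans[of \<epsilon> \<gamma> c t d] by auto
    then show ?case using 1(1) 2(1) by (intro exI[of _ "min \<delta>1 \<delta>2"]) auto
  qed
  then show ?thesis by (simp add: P_def)
qed

section \<open>The Riemannian distance\<close>

lemma norm_rcomp_orthogonal:
  assumes "orthogonal_matrix A"
  shows "norm (rcomp y A) = norm y"
proof -
  have "rcomp y A \<bullet> rcomp y A = trace (transpose A ** (tcomp y y ** A))"
    by (simp add: inner_eq_trace_tcomp tcomp_rcomp_left tcomp_rcomp_right matrix_mul_assoc)
  also have "\<dots> = trace (tcomp y y ** (A ** transpose A))"
    by (subst trace_mul_sym) (simp add: matrix_mul_assoc)
  also have "\<dots> = y \<bullet> y" using assms by (simp add: orthogonal_matrix_def inner_eq_trace_tcomp)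
  finally show ?thesis by (simp add: norm_eq_sqrt_inner)
qed

lemma curve_length_ge:
  fixes z w :: "'h::{real_inner,complete_space}^'p"
  assumes \<gamma>: "piecewise_C1_curve grassmann \<gamma>" "\<gamma> 0 = orbit z" "\<gamma> 1 = orbit w"
    and z: "z \<in> stiefel" and w: "w \<in> stiefel"
    and principal: "principal_pair z w"
  shows "norm (\<chi> i. arccos (z $ i \<bullet> w $ i)) \<le> curve_length grassmann \<gamma>"
proof -
  have zw: "\<And>i j. i \<noteq> j \<Longrightarrow> z $ i \<bullet> w $ j = 0" "\<And>i. 0 \<le> z $ i \<bullet> w $ i"
    using principal by (auto simp: principal_pair_def)
  let ?\<theta> = "\<chi> i. arccos (z $ i \<bullet> w $ i) :: real^'p" and ?l = "curve_length grassmann \<gamma>"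
  have le1: "z $ i \<bullet> w $ i \<le> 1" for i
    using Cauchy_Schwarz_ineq2[of "z $ i" "w $ i"] norm_frame_nth[OF z] norm_frame_nth[OF w] by (simp add: abs_le_iff)
  have *: "norm ?\<theta> \<le> (1 + \<epsilon>) * ?l" if \<epsilon>: "\<epsilon> > 0" for \<epsilon>
  proof -
    obtain w' v where w': "w' \<in> stiefel" "orbit w' = orbit w"
      and v: "\<And>i. arccos (z $ i \<bullet> w' $ i) \<le> v $ i" "norm v \<le> (1 + \<epsilon>) * ?l"
      using moves_within_curve[OF \<gamma>(1) \<epsilon>] z \<gamma>(2,3) unfolding moves_within_def curve_length_def by metis
    obtain A where A: "orthogonal_matrix A" "w' = rcomp w A" using w'(2) by (rule orbit_eqE)
    have le: "?\<theta> $ i \<le> v $ i" for i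
    proof -
      \<comment> \<open>The entries of \<open>A\<close> are inner products of unit vectors; this
        bounds its diagonal.\<close>
      have "A = tcomp w w'" using w by (simp add: A(2) tcomp_rcomp_right stiefel_tcomp)
      then have "A $ i $ i \<le> 1" "- 1 \<le> A $ i $ i"
        using Cauchy_Schwarz_ineq2[of "w $ i" "w' $ i"] norm_frame_nth[OF w] norm_frame_nth[OF w'(1)]
        by (auto simp: tcomp_nth abs_le_iff)
      moreover have "z $ i \<bullet> w' $ i = A $ i $ i * (z $ i \<bullet> w $ i)"
      proof -
        have "z $ i \<bullet> w' $ i = (\<Sum>k\<in>UNIV. if k = i then A $ i $ i * (z $ i \<bullet> w $ i) else 0)"
          unfolding A(2) rcomp_nth inner_sum_right using zw(1) by (intro sum.cong) auto
        then show ?thesis by simp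
      qed
      ultimately have "z $ i \<bullet> w' $ i \<le> z $ i \<bullet> w $ i" using zw(2)[of i] mult_right_mono[of "A $ i $ i" 1] by simp
      moreover have "- 1 \<le> z $ i \<bullet> w' $ i"
        using Cauchy_Schwarz_ineq2[of "z $ i" "w' $ i"] norm_frame_nth[OF z] norm_frame_nth[OF w'(1)] by (simp add: abs_le_iff)
      ultimately have "arccos (z $ i \<bullet> w $ i) \<le> arccos (z $ i \<bullet> w' $ i)" by (intro arccos_le_arccos le1)
      then show ?thesis using v(1)[of i] by simp
    qed
    have "norm ?\<theta> \<le> norm v"
    proof (rule norm_le_componentwise_cart)
      fix i
      have "0 \<le> ?\<theta> $ i" using zw(2)[of i] le1[of i] by (simp add: arccos_lbound)
      then show "norm (?\<theta> $ i) \<le> norm (v $ i)" using le[of i] by (simp only: real_norm_def)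
    qed
    then show ?thesis using v(2) by linarith
  qed
  \<comment> \<open>The sign of the length is read off from the estimate itself with \<epsilon> =
    1.\<close>
  have l: "?l \<ge> 0"
  proof (rule ccontr)
    assume "\<not> ?thesis"
    then have "(1 + 1) * ?l < 0" by simp
    then show False using *[of 1] norm_ge_zero[of ?\<theta>] by linarith
  qed
  show ?thesis
  proof (rule field_le_epsilon)
    fix e :: real assume e: "e > 0"
    \<comment> \<open>The denominator \<open>?l + 1\<close> covers curves of length zero.\<close>
    have "norm ?\<theta> \<le> (1 + e / (?l + 1)) * ?l" using e l by (intro *) (simp add: add_nonneg_pos)
    also have "\<dots> = ?l + e * (?l / (?l + 1))" by (simp add: algebra_simps)
    also have "\<dots> \<le> ?l + e * 1" using e l by (intro add_left_mono mult_left_mono) auto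
    finally show "norm ?\<theta> \<le> ?l + e" by simp
  qed
qed

text \<open>The rotation curve attains the lower bound, so it realises the infimum, and the distance
  and the minimizing geodesic come from one construction.\<close>

lemma principal_geodesic:
  fixes z w :: "'h::{real_inner,complete_space}^'p"
  assumes z: "z \<in> stiefel" and w: "w \<in> stiefel"
    and principal: "principal_pair z w"
  shows "riem_dist grassmann (orbit z) (orbit w) = ereal (norm (\<chi> i. arccos (z $ i \<bullet> w $ i)))"
    "\<exists>\<gamma>. minimizing_geodesic grassmann (orbit z) (orbit w) \<gamma>"
proof -
  have zw: "\<And>i j. i \<noteq> j \<Longrightarrow> z $ i \<bullet> w $ j = 0" "\<And>i. 0 \<le> z $ i \<bullet> w $ i"
    using principal by (auto simp: principal_pair_def)
  define \<theta> where "\<theta> = (\<chi> i. arccos (z $ i \<bullet> w $ i) :: real^'p)"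
  have le1: "z $ i \<bullet> w $ i \<le> 1" for i
    using Cauchy_Schwarz_ineq2[of "z $ i" "w $ i"] norm_frame_nth[OF z] norm_frame_nth[OF w] by (simp add: abs_le_iff)
  have c: "cos (\<theta> $ i) = z $ i \<bullet> w $ i" for i using zw(2)[of i] le1[of i] by (simp add: \<theta>_def)
  have \<theta>: "0 \<le> \<theta> $ i" "\<theta> $ i \<le> pi / 2" for i
    unfolding \<theta>_def vec_lambda_beta using zw(2)[of i] le1[of i] arccos_le_pi2 by (auto intro: arccos_lbound)
  define e where "e = (\<chi> i. inverse (sin (\<theta> $ i)) *\<^sub>R (w $ i - cos (\<theta> $ i) *\<^sub>R z $ i))"
  have s0: "sin (\<theta> $ i) \<noteq> 0" if "\<theta> $ i \<noteq> 0" for i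
    using sin_gt_zero[of "\<theta> $ i"] \<theta>[of i] that pi_gt_zero by fastforce
  have zz: "z $ i \<bullet> z $ j = (if i = j then 1 else 0)" "w $ i \<bullet> w $ j = (if i = j then 1 else 0)" for i j
    using z w by (auto simp: stiefel_iff)
  have wz: "w $ i \<bullet> z $ j = (if i = j then cos (\<theta> $ i) else 0)" for i j
    using c[of i] zw(1)[of j i] by (auto simp: inner_commute)
  have zw': "z $ i \<bullet> w $ j = (if i = j then cos (\<theta> $ i) else 0)" for i j
    using c[of i] zw(1)[of i j] by auto
  interpret frame_rotation z e \<theta>
  proof
    fix i j
    show "z $ i \<bullet> e $ j = 0" by (simp add: e_def inner_diff_right zw' zz)
    show "e $ i \<bullet> e $ j = 0" if "i \<noteq> j"
      using that by (simp add: e_def inner_diff_right inner_diff_left zw' wz zz)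
    show "e $ i \<bullet> e $ i = 1" if "\<theta> $ i \<noteq> 0"
    proof -
      have "(w $ i - cos (\<theta> $ i) *\<^sub>R z $ i) \<bullet> (w $ i - cos (\<theta> $ i) *\<^sub>R z $ i) = (sin (\<theta> $ i))\<^sup>2"
        by (simp add: inner_diff_right inner_diff_left zw' wz zz sin_squared_eq flip: power2_eq_square)
      then have "e $ i \<bullet> e $ i = inverse (sin (\<theta> $ i)) * (inverse (sin (\<theta> $ i)) * (sin (\<theta> $ i))\<^sup>2)"
        by (simp add: e_def)
      then show ?thesis using s0[OF that] by (simp add: power2_eq_square field_simps)
    qed
  qed (rule z)
  have f0: "frame 0 = z" by (simp add: frame_def vec_eq_iff)
  have f1: "frame 1 = w"
  proof -
    have "frame 1 $ i = w $ i" for i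
    proof (cases "\<theta> $ i = 0")
      case True
      then have "(z $ i - w $ i) \<bullet> (z $ i - w $ i) = 0"
        using c[of i] by (simp add: inner_diff_left inner_diff_right zz zw' wz)
      then show ?thesis using True by (simp add: frame_def)
    next
      case False
      have "sin (\<theta> $ i) *\<^sub>R e $ i = w $ i - cos (\<theta> $ i) *\<^sub>R z $ i"
        using s0[OF False] by (simp add: e_def)
      then show ?thesis by (simp add: frame_def)
    qed
    then show ?thesis by (simp add: vec_eq_iff)
  qed
  have ends: "curve 0 = orbit z" "curve 1 = orbit w" by (simp_all add: curve_def f0 f1)
  have lower: "ereal (norm \<theta>) \<le> ereal (curve_length grassmann \<gamma>)"
    if "piecewise_C1_curve grassmann \<gamma>" "\<gamma> 0 = orbit z" "\<gamma> 1 = orbit w" for \<gamma>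
    using curve_length_ge[OF that z w principal] by (simp add: \<theta>_def)
  have dist: "riem_dist grassmann (orbit z) (orbit w) = ereal (norm \<theta>)"
    unfolding riem_dist_def
  proof (rule antisym)
    show "(INF \<gamma>\<in>{\<gamma>. piecewise_C1_curve grassmann \<gamma> \<and> \<gamma> 0 = orbit z \<and> \<gamma> 1 = orbit w}. ereal (curve_length grassmann \<gamma>))
        \<le> ereal (norm \<theta>)"
      by (rule INF_lower2[of curve]) (auto simp: piecewise_C1_curve ends curve_length_curve)
  qed (use lower in \<open>auto intro!: INF_greatest\<close>)
  then show "riem_dist grassmann (orbit z) (orbit w) = ereal (norm (\<chi> i. arccos (z $ i \<bullet> w $ i)))"
    by (simp add: \<theta>_def)
  show "\<exists>\<gamma>. minimizing_geodesic grassmann (orbit z) (orbit w) \<gamma>"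
    using geodesic_curve ends dist curve_length_curve unfolding minimizing_geodesic_def by metis
qed

lemma hopf_rinow_grassmann:
  "hopf_rinow (grassmann :: (('h::{real_inner,complete_space} ^ 'p) set, 'h ^ 'p) riem_structure)"
  unfolding hopf_rinow_def
proof (intro ballI)
  fix m m' :: "('h ^ 'p) set"
  assume "m \<in> points grassmann" "m' \<in> points grassmann"
  then obtain a b :: "'h^'p" where ab: "a \<in> stiefel" "m = orbit a" "b \<in> stiefel" "m' = orbit b" by auto
  obtain z w where zw: "z \<in> stiefel" "orbit z = orbit a" "w \<in> stiefel" "orbit w = orbit b" "principal_pair z w"
    by (rule principal_frames[OF ab(1,3)])
  show "\<exists>\<gamma>. minimizing_geodesic grassmann m m' \<gamma>"
    using principal_geodesic(2)[OF zw(1,3,5)] by (simp add: ab zw)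
qed

section \<open>Comparison with the distance of frames, and completeness\<close>

text \<open>For principal frames each chord is at most the angle. The matrix \<open>A\<close> that
  turns \<open>z\<close> into the given frame \<open>a\<close> is applied to both frames, which
  keeps the norm of their difference.\<close>

lemma riem_dist_ge_frame:
  fixes a b :: "'h::{real_inner,complete_space}^'p"
  assumes a: "a \<in> stiefel" and b: "b \<in> stiefel"
  obtains w where "w \<in> stiefel" "orbit w = orbit b" "ereal (norm (a - w)) \<le> riem_dist grassmann (orbit a) (orbit b)"
proof -
  obtain z y where z: "z \<in> stiefel" "orbit z = orbit a" and y: "y \<in> stiefel" "orbit y = orbit b"
    and pr: "principal_pair z y"
    by (rule principal_frames[OF a b])
  have zy: "\<And>i j. i \<noteq> j \<Longrightarrow> z $ i \<bullet> y $ j = 0" "\<And>i. 0 \<le> z $ i \<bullet> y $ i"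
    using pr by (auto simp: principal_pair_def)
  let ?\<theta> = "\<chi> i. arccos (z $ i \<bullet> y $ i) :: real^'p"
  obtain A where A: "orthogonal_matrix A" "a = rcomp z A" using z(2)[symmetric] by (rule orbit_eqE)
  have n: "norm ((\<chi> i. norm ((z - y) $ i)) :: real^'p) \<le> norm ?\<theta>"
  proof (rule norm_le_componentwise_cart)
    fix i
    have le1: "z $ i \<bullet> y $ i \<le> 1"
      using Cauchy_Schwarz_ineq2[of "z $ i" "y $ i"] norm_frame_nth[OF z(1)] norm_frame_nth[OF y(1)] by (simp add: abs_le_iff)
    have \<theta>: "cos (?\<theta> $ i) = z $ i \<bullet> y $ i" "0 \<le> ?\<theta> $ i" using zy(2)[of i] le1 by (auto simp: arccos_lbound)
    have "(norm (z $ i - y $ i))\<^sup>2 = 2 - 2 * (z $ i \<bullet> y $ i)"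
      by (intro norm_diff_unit_squared norm_frame_nth z y)
    also have "\<dots> = 2 - 2 * cos (2 * (?\<theta> $ i / 2))" using \<theta>(1) by simp
    also have "\<dots> = (2 * sin (?\<theta> $ i / 2))\<^sup>2" unfolding cos_double_sin by (simp add: power_mult_distrib)
    also have "\<dots> \<le> (?\<theta> $ i)\<^sup>2"
      using abs_sin_x_le_abs_x[of "?\<theta> $ i / 2"] \<theta>(2) by (intro abs_le_square_iff[THEN iffD1]) (simp add: abs_mult)
    finally have "norm (z $ i - y $ i) \<le> ?\<theta> $ i" using \<theta>(2) by (rule power2_le_imp_le)
    then show "norm ((\<chi> i. norm ((z - y) $ i)) $ i :: real) \<le> norm (?\<theta> $ i)" by simp
  qed
  show ?thesis
  proof
    show "rcomp y A \<in> stiefel" "orbit (rcomp y A) = orbit b"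
      using A(1) y by (auto simp: rcomp_stiefel orbit_rcomp)
    have "norm (a - rcomp y A) = norm (z - y)"
      using norm_rcomp_orthogonal[OF A(1), of "z - y"] by (simp add: A(2) rcomp.diff_left)
    also have "\<dots> = norm ((\<chi> i. norm ((z - y) $ i)) :: real^'p)" by (simp add: norm_vec_def)
    finally show "ereal (norm (a - rcomp y A)) \<le> riem_dist grassmann (orbit a) (orbit b)"
      using n principal_geodesic(1)[OF z(1) y(1) pr] z(2) y(2) by simp
  qed
qed

text \<open>The sum of the squared sines of the principal angles is the squared distance of
  \<open>b\<close> from its projection to the range of \<open>a\<close>, hence at most that of the
  two frames. The factor 2 comes from comparing an angle in [0, pi / 2] with its sine.\<close>

lemma riem_dist_le_frame:
  fixes a b :: "'h::{real_inner,complete_space}^'p"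
  assumes a: "a \<in> stiefel" and b: "b \<in> stiefel"
  obtains r where "0 \<le> r" "r \<le> 2 * norm (a - b)" "riem_dist grassmann (orbit a) (orbit b) = ereal r"
proof -
  obtain z y where z: "z \<in> stiefel" "orbit z = orbit a" and y: "y \<in> stiefel" "orbit y = orbit b"
    and pr: "principal_pair z y"
    by (rule principal_frames[OF a b])
  have zy: "\<And>i j. i \<noteq> j \<Longrightarrow> z $ i \<bullet> y $ j = 0" "\<And>i. 0 \<le> z $ i \<bullet> y $ i"
    using pr by (auto simp: principal_pair_def)
  let ?\<theta> = "\<chi> i. arccos (z $ i \<bullet> y $ i) :: real^'p"
  have comp: "(?\<theta> $ i)\<^sup>2 \<le> 4 * (1 - (z $ i \<bullet> y $ i)\<^sup>2)" for i
  proof -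
    let ?c = "z $ i \<bullet> y $ i"
    have le1: "?c \<le> 1"
      using Cauchy_Schwarz_ineq2[of "z $ i" "y $ i"] norm_frame_nth[OF z(1)] norm_frame_nth[OF y(1)] by (simp add: abs_le_iff)
    have "(norm (z $ i - y $ i))\<^sup>2 = 2 - 2 * ?c"
      by (intro norm_diff_unit_squared norm_frame_nth z y)
    then have n: "(norm (z $ i - y $ i))\<^sup>2 = 2 * (1 - ?c)" by simp
    have "arccos ?c * sqrt (1 - (norm (z $ i - y $ i) / 2)\<^sup>2) \<le> norm (z $ i - y $ i)"
      by (rule arccos_chord) (simp_all add: norm_frame_nth z y)
    then have "(arccos ?c * sqrt (1 - (norm (z $ i - y $ i) / 2)\<^sup>2))\<^sup>2 \<le> (norm (z $ i - y $ i))\<^sup>2"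
      using zy(2)[of i] le1 by (intro power_mono) (auto simp: arccos_lbound n power_divide)
    \<comment> \<open>With the squared chord \<open>2 * (1 - ?c)\<close> the square root becomes
      that of \<open>(1 + ?c) / 2\<close>. Dropping the nonnegative \<open>?c\<close> on the left
      and passing to its square on the right gives the bound.\<close>
    then have "(arccos ?c)\<^sup>2 * ((1 + ?c) / 2) \<le> 2 * (1 - ?c)"
      using zy(2)[of i] by (simp add: n power_mult_distrib power_divide field_simps)
    moreover have "(arccos ?c)\<^sup>2 * (1 / 2) \<le> (arccos ?c)\<^sup>2 * ((1 + ?c) / 2)"
      using zy(2)[of i] by (intro mult_left_mono) auto
    moreover have "1 - ?c \<le> 1 - ?c\<^sup>2" using zy(2)[of i] le1 by (simp add: power2_eq_square mult_left_le)
    ultimately show ?thesis by simp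
  qed
  have "(norm ?\<theta>)\<^sup>2 = (\<Sum>i\<in>UNIV. (?\<theta> $ i)\<^sup>2)"
    unfolding power2_norm_eq_inner by (simp add: inner_vec_def power2_eq_square)
  also have "\<dots> \<le> (\<Sum>i\<in>UNIV. 4 * (1 - (z $ i \<bullet> y $ i)\<^sup>2))" by (intro sum_mono comp)
  also have "\<dots> = 4 * (real CARD('p) - (\<Sum>i\<in>UNIV. (z $ i \<bullet> y $ i)\<^sup>2))"
    by (simp add: sum_subtractf flip: sum_distrib_left)
  also have "(\<Sum>i\<in>UNIV. (z $ i \<bullet> y $ i)\<^sup>2) = (norm (tcomp z y))\<^sup>2"
  proof -
    have "(\<Sum>j\<in>UNIV. (z $ i \<bullet> y $ j) * (z $ i \<bullet> y $ j)) = (z $ i \<bullet> y $ i)\<^sup>2" for i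
    proof -
      have "(\<Sum>j\<in>UNIV. (z $ i \<bullet> y $ j) * (z $ i \<bullet> y $ j)) = (\<Sum>j\<in>UNIV. if j = i then (z $ i \<bullet> y $ i)\<^sup>2 else 0)"
        using zy(1) by (intro sum.cong) (auto simp: power2_eq_square)
      then show ?thesis by simp
    qed
    then show ?thesis by (simp add: power2_norm_eq_inner inner_vec_def tcomp_nth)
  qed
  also have "norm (tcomp z y) = norm (tcomp a b)"
    using norm_tcomp_orbit[OF z(2), of y] norm_tcomp_orbit[OF y(2), of a] by (metis norm_transpose transpose_tcomp)
  also have "real CARD('p) - (norm (tcomp a b))\<^sup>2 = (norm (b - rcomp a (tcomp a b)))\<^sup>2"
    by (rule norm_residual[OF a b, symmetric])
  also have "\<dots> \<le> (norm (a - b))\<^sup>2"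
  proof -
    \<comment> \<open>\<open>b - a\<close> splits into the residual \<open>r\<close>, orthogonal to
      the range of \<open>a\<close>, and a part \<open>t\<close> inside that range.\<close>
    define r where "r = b - rcomp a (tcomp a b)"
    define t where "t = rcomp a (tcomp a b - mat 1)"
    have "tcomp a r = 0" using a by (simp add: r_def tcomp.diff_right tcomp_rcomp_right stiefel_tcomp)
    then have "t \<bullet> r = 0" by (simp add: t_def inner_rcomp)
    moreover have "b - a = r + t" by (simp add: r_def t_def rcomp.diff_right)
    ultimately have "(norm (b - a))\<^sup>2 = (norm r)\<^sup>2 + (norm t)\<^sup>2"
      by (simp add: power2_norm_eq_inner inner_add_left inner_add_right inner_commute[of r t])
    then show ?thesis by (simp add: norm_minus_commute r_def)
  qed
  finally have "(norm ?\<theta>)\<^sup>2 \<le> (2 * norm (a - b))\<^sup>2" by (simp add: power_mult_distrib)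
  then have "norm ?\<theta> \<le> 2 * norm (a - b)" by (rule power2_le_imp_le) simp
  then show ?thesis using that[of "norm ?\<theta>"] principal_geodesic(1)[OF z(1) y(1) pr] z(2) y(2) by simp
qed

lemma closed_stiefel_limit:
  fixes z :: "nat \<Rightarrow> 'h::real_inner^'p"
  assumes "\<And>k. z k \<in> stiefel" "z \<longlonglongrightarrow> y"
  shows "y \<in> stiefel"
proof -
  have "(\<lambda>k. tcomp (z k) (z k)) \<longlonglongrightarrow> tcomp y y" by (intro tcomp.tendsto assms)
  moreover have "(\<lambda>k. tcomp (z k) (z k)) = (\<lambda>_. mat 1)" using assms(1) by (simp add: stiefel_tcomp)
  ultimately show ?thesis by (simp add: stiefel_tcomp LIMSEQ_const_iff)
qed

text \<open>A rapidly Cauchy subsequence is lifted frame by frame, each frame chosen close to the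
  previous one. The limit of the lifts spans the limit point, and the opposite comparison of
  distances brings the whole sequence along.\<close>

lemma riem_complete_grassmann:
  "riem_complete (grassmann :: (('h::{real_inner,complete_space} ^ 'p) set, 'h ^ 'p) riem_structure)"
  unfolding riem_complete_def
proof (intro allI impI, elim conjE)
  let ?d = "riem_dist (grassmann :: (('h ^ 'p) set, 'h ^ 'p) riem_structure)"
  fix X :: "nat \<Rightarrow> ('h ^ 'p) set"
  assume X: "range X \<subseteq> points grassmann"
    and cauchy: "\<forall>\<epsilon>>0. \<exists>N. \<forall>m\<ge>N. \<forall>n\<ge>N. ?d (X m) (X n) < ereal \<epsilon>"
  have "\<exists>N. \<forall>m\<ge>N. \<forall>n\<ge>N. ?d (X m) (X n) < ereal ((1/2) ^ k)" for k using cauchy by simp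
  then obtain N where N: "\<And>k m n. N k \<le> m \<Longrightarrow> N k \<le> n \<Longrightarrow> ?d (X m) (X n) < ereal ((1/2) ^ k)" by metis
  \<comment> \<open>Partial sums of \<open>N\<close> are monotone and dominate
    \<open>N\<close>.\<close>
  define r where "r = (\<lambda>k. \<Sum>j\<le>k. N j)"
  have r: "r k \<le> r (Suc k)" "N k \<le> r k" for k
    unfolding r_def by (auto intro: member_le_sum)
  have step: "\<exists>w. (w \<in> stiefel \<and> X n = orbit w) \<and> norm (a - w) \<le> e"
    if a: "a \<in> stiefel" "X m = orbit a" and d: "?d (X m) (X n) < ereal e" for a m n e
  proof -
    obtain b where b: "b \<in> stiefel" "X n = orbit b" using X by auto
    obtain w where "w \<in> stiefel" "orbit w = orbit b" "ereal (norm (a - w)) \<le> ?d (orbit a) (orbit b)"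
      by (rule riem_dist_ge_frame[OF a(1) b(1)])
    moreover from this have "norm (a - w) \<le> e" using d a(2) b(2) by (metis ereal_less_eq(3) less_imp_le order_trans)
    ultimately show ?thesis using b(2) by auto
  qed
  have "\<exists>z. \<forall>k. (z k \<in> stiefel \<and> X (r k) = orbit (z k)) \<and> norm (z k - z (Suc k)) \<le> (1/2) ^ k"
  proof (rule dependent_nat_choice)
    show "\<exists>a. a \<in> stiefel \<and> X (r 0) = orbit a" using X by auto
    fix a k assume "a \<in> stiefel \<and> X (r k) = orbit a"
    moreover have "?d (X (r k)) (X (r (Suc k))) < ereal ((1/2) ^ k)"
      using r[of k] by (intro N) auto
    ultimately show "\<exists>w. (w \<in> stiefel \<and> X (r (Suc k)) = orbit w) \<and> norm (a - w) \<le> (1/2) ^ k"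
      using step by blast
  qed
  then obtain z where z: "\<And>k. z k \<in> stiefel" "\<And>k. X (r k) = orbit (z k)"
    "\<And>k. norm (z k - z (Suc k)) \<le> (1/2) ^ k" by blast
  \<comment> \<open>The exact partial sum of the geometric series keeps the bound inductive.\<close>
  have tele: "norm (z k - z (k + j)) \<le> 2 * (1/2) ^ k - 2 * (1/2) ^ (k + j)" for k j
  proof (induction j)
    case (Suc j)
    have "norm (z k - z (k + Suc j)) \<le> norm (z k - z (k + j)) + norm (z (k + j) - z (k + Suc j))"
      by (rule order_trans[OF _ norm_triangle_ineq]) simp
    then show ?case using Suc z(3)[of "k + j"] by simp
  qed simp
  have zb: "norm (z k - z n) \<le> 2 * (1/2) ^ k" if "k \<le> n" for k n
  proof -
    have "norm (z k - z (k + (n - k))) \<le> 2 * (1/2) ^ k"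
      by (rule order_trans[OF tele]) simp
    then show ?thesis using that by simp
  qed
  have small: "\<exists>k. C * (1/2) ^ k < e" if "e > 0" for e C :: real
  proof -
    have "(\<lambda>k. C * (1/2) ^ k) \<longlonglongrightarrow> C * 0" by (intro tendsto_intros) auto
    then have "\<forall>\<^sub>F k in sequentially. C * (1/2) ^ k < e" using that by (intro order_tendstoD) auto
    then show ?thesis by (auto simp: eventually_sequentially)
  qed
  have "Cauchy z"
    unfolding Cauchy_def
  proof (intro allI impI)
    fix e :: real assume "e > 0"
    then obtain k where k: "4 * (1/2) ^ k < e" using small by blast
    have "dist (z m) (z n) < e" if "m \<ge> k" "n \<ge> k" for m n
    proof -
      have "dist (z m) (z n) \<le> dist (z k) (z m) + dist (z k) (z n)" by (metis dist_commute dist_triangle)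
      also have "\<dots> \<le> 4 * (1/2) ^ k" using zb[OF that(1)] zb[OF that(2)] by (simp add: dist_norm)
      finally show ?thesis using k by simp
    qed
    then show "\<exists>M. \<forall>m\<ge>M. \<forall>n\<ge>M. dist (z m) (z n) < e" by blast
  qed
  then obtain y where y: "z \<longlonglongrightarrow> y" using Cauchy_convergent_iff convergent_def by blast
  have ys: "y \<in> stiefel" by (rule closed_stiefel_limit[OF z(1) y])
  have zy: "norm (z k - y) \<le> 2 * (1/2) ^ k" for k
  proof (rule tendsto_upperbound)
    show "(\<lambda>n. norm (z k - z n)) \<longlonglongrightarrow> norm (z k - y)" by (intro tendsto_intros y)
    show "\<forall>\<^sub>F n in sequentially. norm (z k - z n) \<le> 2 * (1/2) ^ k"
      using zb eventually_sequentially by blast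
  qed simp
  have "\<exists>f. 0 \<le> f \<and> ?d (X n) (orbit y) = ereal f" for n
    using X riem_dist_le_frame[OF _ ys] by (metis chart_sel(3) imageE range_subsetD)
  then obtain f where f: "\<And>n. 0 \<le> f n" "\<And>n. ?d (X n) (orbit y) = ereal (f n)" by metis
  have "f \<longlonglongrightarrow> 0"
  proof (rule LIMSEQ_I)
    fix e :: real assume "e > 0"
    \<comment> \<open>6 = 2 * (1 + 2): the factor of the distance bound, applied to the distances of
      \<open>z k\<close> from \<open>w\<close> and from the limit frame.\<close>
    then obtain k where k: "6 * (1/2) ^ k < e" using small by blast
    have "norm (f n - 0) < e" if n: "n \<ge> r k" for n
    proof -
      have "?d (X (r k)) (X n) < ereal ((1/2) ^ k)" using r(2)[of k] n by (intro N) auto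
      then obtain w where w: "w \<in> stiefel" "X n = orbit w" "norm (z k - w) \<le> (1/2) ^ k"
        using step[OF z(1,2)] by blast
      obtain q where "q \<le> 2 * norm (w - y)" "?d (orbit w) (orbit y) = ereal q"
        by (rule riem_dist_le_frame[OF w(1) ys])
      then have "f n \<le> 2 * norm (w - y)" using f(2)[of n] w(2) by simp
      also have "norm (w - y) \<le> norm (z k - w) + norm (z k - y)"
        by (metis norm_minus_commute norm_triangle_sub norm_diff_triangle_le order_refl)
      finally have "f n \<le> 6 * (1/2) ^ k" using w(3) zy[of k] by simp
      then show ?thesis using k f(1)[of n] by simp
    qed
    then show "\<exists>no. \<forall>n\<ge>no. norm (f n - 0) < e" by blast
  qed
  then have "(\<lambda>n. ?d (X n) (orbit y)) \<longlonglongrightarrow> 0" by (simp add: f(2) zero_ereal_def)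
  then show "\<exists>a\<in>points grassmann. (\<lambda>n. ?d (X n) a) \<longlonglongrightarrow> 0" using ys by auto
qed

theorem proposition2p4:
  assumes "(\<exists>B :: 'h::{real_inner,complete_space} set. finite B \<and> span B = UNIV) \<longrightarrow>
             dim (UNIV :: 'h set) \<ge> 2 * CARD('p::finite)"
  shows "riemannian_hilbert_manifold (grassmann :: (('h ^ 'p) set, 'h ^ 'p) riem_structure) \<and>
         riemannian_submersion_on stiefel (grassmann :: (('h ^ 'p) set, 'h ^ 'p) riem_structure) orbit \<and>
         riem_complete (grassmann :: (('h ^ 'p) set, 'h ^ 'p) riem_structure) \<and>
         hopf_rinow (grassmann :: (('h ^ 'p) set, 'h ^ 'p) riem_structure)"
  by (intro conjI riemannian_hilbert_manifold_grassmann riemannian_submersion_grassmann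
      riem_complete_grassmann hopf_rinow_grassmann)

end
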